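(* Let $G$ be an étale groupoid and let $\Theta:\mathcal{I}(C_r^*(G))\to\mathcal{O}(G^{(0)})$ be the map $\Theta(I)=U_I$, where $U_I=\bigcup_{f\in I\cap C_0(G^{(0)})}f^{-1}(\mathbb{C}\setminus\{0\})$. Then the following are equivalent: (1) $\Theta$ is a bijection. (2) $C_0(G^{(0)})$ separates the ideals of $C_r^*(G)$. (3) $G$ is inner exact and satisfies the residual intersection property. Moreover, if these properties are satisfied, then $\Theta$ is an isomorphism of lattices and hence a homeomorphism.
   Context: Groupoids are locally compact Hausdorff with continuous product and inversion; $G^{(0)}$ is the unit space, $r(g)=gg^{-1}$, $d(g)=g^{-1}g$. $G$ is étale if $r,d$ are local homeomorphisms. $D\subseteq G^{(0)}$ is invariant if $d(g)\in D$ implies $r(g)\in D$; then $G_D=\{g\in G: d(g)\in D\}$ is a groupoid with unit space $D$. $C_r^*(G)$ is the reduced groupoid $C^*$-algebra, and $C_0(G^{(0)})\subseteq C_r^*(G)$ via extension by zero. For a $C^*$-algebra $A$, $\mathcal{I}(A)$ is the lattice of closed two-sided ideals of $A$ with the Fell topology, whose sub-base consists of the sets $\{J\in\mathcal{I}(A): I\not\subseteq J\}$, $I\in\mathcal{I}(A)$. $\mathcal{O}(G^{(0)})$ is the lattice of open invariant subsets of $G^{(0)}$, with the topology inherited from the Fell topology on $\mathcal{I}(C_0(G^{(0)}))$ via the identification of ideals of $C_0(G^{(0)})$ with open subsets of $G^{(0)}$. The set $U_I$ is open and invariant for each $I\in\mathcal{I}(C_r^*(G))$. $C_0(G^{(0)})$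 separates the ideals of $C_r^*(G)$ if $\Theta$ is injective. $G$ is inner exact if for every closed invariant $D\subseteq G^{(0)}$ the sequence $0\to C_r^*(G_{G^{(0)}\setminus D})\to C_r^*(G)\to C_r^*(G_D)\to 0$ (maps induced by extension by zero and by restriction) is exact. $G$ has the intersection property if $I\cap C_0(G^{(0)})\neq\{0\}$ for every non-zero ideal $I\subseteq C_r^*(G)$, and the residual intersection property if $G_D$ has the intersection property for every closed invariant $D\subseteq G^{(0)}$. *)

theory Defs
  imports "HOL-Analysis.Analysis"
begin

section \<open>The complex Hilbert space of square-summable functions\<close>

typedef 'a ell2 = "{\<xi> :: 'a \<Rightarrow> complex. (\<lambda>x. (cmod (\<xi> x))\<^sup>2) summable_on UNIV}"
  morphisms ell2_apply Abs_ell2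
  by (rule exI[of _ "\<lambda>_. 0"]) simp

setup_lifting type_definition_ell2

lemma square_summable_add:
  fixes \<xi> \<eta> :: "'a \<Rightarrow> complex"
  assumes "(\<lambda>x. (cmod (\<xi> x))\<^sup>2) summable_on UNIV" "(\<lambda>x. (cmod (\<eta> x))\<^sup>2) summable_on UNIV"
  shows "(\<lambda>x. (cmod (\<xi> x + \<eta> x))\<^sup>2) summable_on UNIV"
proof (rule summable_on_comparison_test)
  show "(\<lambda>x. 2 * (cmod (\<xi> x))\<^sup>2 + 2 * (cmod (\<eta> x))\<^sup>2) summable_on UNIV"
    by (intro summable_on_add summable_on_cmult_right assms)
  fix x
  have "(cmod (\<xi> x + \<eta> x))\<^sup>2 \<le> (cmod (\<xi> x) + cmod (\<eta> x))\<^sup>2"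
    by (intro power_mono norm_triangle_ineq) simp
  also have "\<dots> \<le> 2 * (cmod (\<xi> x))\<^sup>2 + 2 * (cmod (\<eta> x))\<^sup>2"
    using zero_le_power2[of "cmod (\<xi> x) - cmod (\<eta> x)"] by (simp add: power2_sum power2_diff)
  finally show "(cmod (\<xi> x + \<eta> x))\<^sup>2 \<le> 2 * (cmod (\<xi> x))\<^sup>2 + 2 * (cmod (\<eta> x))\<^sup>2" .
qed simp

lemma square_summable_scale:
  fixes \<xi> :: "'a \<Rightarrow> complex"
  assumes "(\<lambda>x. (cmod (\<xi> x))\<^sup>2) summable_on UNIV"
  shows "(\<lambda>x. (cmod (c * \<xi> x))\<^sup>2) summable_on UNIV"
  unfolding norm_mult power_mult_distrib by (intro summable_on_cmult_right assms)

lift_definition scaleC_ell2 :: "complex \<Rightarrow> 'a ell2 \<Rightarrow> 'a ell2" is "\<lambda>c \<xi> x. c * \<xi> x"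
  by (rule square_summable_scale)

instantiation ell2 :: (type) real_normed_vector
begin

lift_definition zero_ell2 :: "'a ell2" is "\<lambda>_. 0" by simp

lift_definition plus_ell2 :: "'a ell2 \<Rightarrow> 'a ell2 \<Rightarrow> 'a ell2" is "\<lambda>\<xi> \<eta> x. \<xi> x + \<eta> x"
  by (rule square_summable_add)

lift_definition uminus_ell2 :: "'a ell2 \<Rightarrow> 'a ell2" is "\<lambda>\<xi> x. - \<xi> x" by simp

lift_definition minus_ell2 :: "'a ell2 \<Rightarrow> 'a ell2 \<Rightarrow> 'a ell2" is "\<lambda>\<xi> \<eta> x. \<xi> x - \<eta> x"
  using square_summable_add[of _ "\<lambda>x. - _ x"] by fastforce

lift_definition scaleR_ell2 :: "real \<Rightarrow> 'a ell2 \<Rightarrow> 'a ell2" is "\<lambda>c \<xi> x. of_real c * \<xi> x"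
  by (rule square_summable_scale)

lift_definition norm_ell2 :: "'a ell2 \<Rightarrow> real"
  is "\<lambda>\<xi>. sqrt (\<Sum>\<^sub>\<infinity>x. (cmod (\<xi> x))\<^sup>2)" .

definition dist_ell2 :: "'a ell2 \<Rightarrow> 'a ell2 \<Rightarrow> real" where "dist_ell2 \<xi> \<eta> = norm (\<xi> - \<eta>)"

definition sgn_ell2 :: "'a ell2 \<Rightarrow> 'a ell2" where "sgn_ell2 \<xi> = inverse (norm \<xi>) *\<^sub>R \<xi>"

definition uniformity_ell2 :: "('a ell2 \<times> 'a ell2) filter"
  where "uniformity_ell2 = (INF e\<in>{0<..}. principal {(\<xi>, \<eta>). dist \<xi> \<eta> < e})"

definition open_ell2 :: "'a ell2 set \<Rightarrow> bool"
  where "open_ell2 U = (\<forall>\<xi>\<in>U. \<forall>\<^sub>F (\<xi>', \<eta>) in uniformity. \<xi>' = \<xi> \<longrightarrow> \<eta> \<in> U)"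

instance
proof
  fix \<xi> \<eta> :: "'a ell2" and c :: real
  show "norm \<xi> = 0 \<longleftrightarrow> \<xi> = 0"
  proof (transfer, safe)
    fix \<xi> :: "'a \<Rightarrow> complex"
    assume s: "(\<lambda>x. (cmod (\<xi> x))\<^sup>2) summable_on UNIV" and z: "sqrt (\<Sum>\<^sub>\<infinity>x. (cmod (\<xi> x))\<^sup>2) = 0"
    show "\<xi> = (\<lambda>_. 0)"
    proof
      fix x
      have "(cmod (\<xi> x))\<^sup>2 = sum (\<lambda>x. (cmod (\<xi> x))\<^sup>2) {x}" by simp
      also have "\<dots> \<le> (\<Sum>\<^sub>\<infinity>x. (cmod (\<xi> x))\<^sup>2)" by (rule finite_sum_le_infsum[OF s]) auto
      finally show "\<xi> x = 0" using z by simp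
    qed
  qed simp
  show "norm (\<xi> + \<eta>) \<le> norm \<xi> + norm \<eta>"
  proof transfer
    fix \<xi> \<eta> :: "'a \<Rightarrow> complex"
    assume s: "(\<lambda>x. (cmod (\<xi> x))\<^sup>2) summable_on UNIV" "(\<lambda>x. (cmod (\<eta> x))\<^sup>2) summable_on UNIV"
    let ?N = "\<lambda>\<xi> :: 'a \<Rightarrow> complex. sqrt (\<Sum>\<^sub>\<infinity>x. (cmod (\<xi> x))\<^sup>2)"
    have fin: "L2_set (\<lambda>x. cmod (\<zeta> x)) F \<le> ?N \<zeta>"
      if "(\<lambda>x. (cmod (\<zeta> x))\<^sup>2) summable_on UNIV" "finite F" for F and \<zeta> :: "'a \<Rightarrow> complex"
      unfolding L2_set_def by (intro real_sqrt_le_mono finite_sum_le_infsum that) auto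
    have "(\<Sum>\<^sub>\<infinity>x. (cmod (\<xi> x + \<eta> x))\<^sup>2) \<le> (?N \<xi> + ?N \<eta>)\<^sup>2"
    proof (rule infsum_le_finite_sums[OF square_summable_add[OF s]])
      fix F :: "'a set" assume F: "finite F"
      have "L2_set (\<lambda>x. cmod (\<xi> x + \<eta> x)) F \<le> L2_set (\<lambda>x. cmod (\<xi> x) + cmod (\<eta> x)) F"
        by (intro L2_set_mono norm_triangle_ineq) auto
      also have "\<dots> \<le> L2_set (\<lambda>x. cmod (\<xi> x)) F + L2_set (\<lambda>x. cmod (\<eta> x)) F"
        by (rule L2_set_triangle_ineq)
      also have "\<dots> \<le> ?N \<xi> + ?N \<eta>" by (intro add_mono fin s F)
      finally show "(\<Sum>x\<in>F. (cmod (\<xi> x + \<eta> x))\<^sup>2) \<le> (?N \<xi> + ?N \<eta>)\<^sup>2"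
        unfolding L2_set_def by (rule sqrt_le_D)
    qed
    then show "?N (\<lambda>x. \<xi> x + \<eta> x) \<le> ?N \<xi> + ?N \<eta>"
      by (intro real_le_lsqrt) (auto intro!: add_nonneg_nonneg infsum_nonneg)
  qed
  show "norm (c *\<^sub>R \<xi>) = \<bar>c\<bar> * norm \<xi>"
    by transfer (simp add: norm_mult power_mult_distrib infsum_cmult_right' real_sqrt_mult)
qed (rule dist_ell2_def sgn_ell2_def uniformity_ell2_def open_ell2_def
    | (transfer, simp add: fun_eq_iff algebra_simps))+

end

lemma norm_scaleC_ell2: "norm (scaleC_ell2 c \<xi>) = cmod c * norm \<xi>"
  by transfer (simp add: norm_mult power_mult_distrib infsum_cmult_right' real_sqrt_mult)

lemma bounded_linear_scaleC_ell2: "bounded_linear (scaleC_ell2 c)"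
proof (rule bounded_linear_intro)
  show "norm (scaleC_ell2 c \<xi>) \<le> norm \<xi> * cmod c" for \<xi> :: "'a ell2"
    by (simp add: norm_scaleC_ell2 mult.commute)
qed (transfer, simp add: fun_eq_iff algebra_simps)+

type_synonym 'a op = "'a ell2 \<Rightarrow>\<^sub>L 'a ell2"

definition scaleC_op :: "complex \<Rightarrow> 'a op \<Rightarrow> 'a op"
  where "scaleC_op c T = Blinfun (scaleC_ell2 c) o\<^sub>L T"


section \<open>Ideals of operator algebras and the Fell topology\<close>

text \<open>All C*-algebras below are norm-closed *-subalgebras of the bounded operators on a
  Hilbert space \<open>'a ell2\<close>; they need not contain the identity operator.\<close>

definition closed_ideals :: "'a op set \<Rightarrow> 'a op set set" where
  "closed_ideals A = {I. I \<subseteq> A \<and> closed I \<and> 0 \<in> I \<and>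
     (\<forall>S\<in>I. \<forall>T\<in>I. S + T \<in> I) \<and> (\<forall>c. \<forall>T\<in>I. scaleC_op c T \<in> I) \<and>
     (\<forall>S\<in>A. \<forall>T\<in>I. S o\<^sub>L T \<in> I \<and> T o\<^sub>L S \<in> I)}"

definition ideal_join :: "'a op set \<Rightarrow> 'a op set \<Rightarrow> 'a op set \<Rightarrow> 'a op set" where
  "ideal_join A I J = \<Inter>{K \<in> closed_ideals A. I \<union> J \<subseteq> K}"

text \<open>The ideal \<open>A\<close> itself lies in no set of the sub-base, so the whole space (the empty
  intersection) is added explicitly; otherwise \<open>A\<close> would be missing from the topological space.\<close>

definition fell_topology :: "'a op set \<Rightarrow> 'a op set topology" where
  "fell_topology A = topology_generated_by
     (insert (closed_ideals A)
       ((\<lambda>I. {J \<in> closed_ideals A. \<not> I \<subseteq> J}) ` closed_ideals A))"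


section \<open>Etale groupoids\<close>

text \<open>The underlying set of a groupoid is the underlying set of its topology; \<open>mul g h\<close> is
  meaningful only for \<open>(g, h)\<close> in \<open>composable\<close>.\<close>

record 'a groupoid =
  gtop :: "'a topology"
  composable :: "('a \<times> 'a) set"
  mul :: "'a \<Rightarrow> 'a \<Rightarrow> 'a"
  inverse_arrow :: "'a \<Rightarrow> 'a"

abbreviation arrows :: "'a groupoid \<Rightarrow> 'a set"
  where "arrows G \<equiv> topspace (gtop G)"

definition rng :: "'a groupoid \<Rightarrow> 'a \<Rightarrow> 'a"
  where "rng G g = mul G g (inverse_arrow G g)"

definition dmn :: "'a groupoid \<Rightarrow> 'a \<Rightarrow> 'a"
  where "dmn G g = mul G (inverse_arrow G g) g"

definition units :: "'a groupoid \<Rightarrow> 'a set"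
  where "units G = dmn G ` arrows G"

definition unit_top :: "'a groupoid \<Rightarrow> 'a topology"
  where "unit_top G = subtopology (gtop G) (units G)"

text \<open>The first eight assumptions are the standard axioms for a groupoid given by a partial
  product and an inversion.\<close>

locale topological_groupoid =
  fixes G :: "'a groupoid"
  assumes composable_subset: "composable G \<subseteq> arrows G \<times> arrows G"
    and mul_closed: "(g, h) \<in> composable G \<Longrightarrow> mul G g h \<in> arrows G"
    and inverse_closed: "g \<in> arrows G \<Longrightarrow> inverse_arrow G g \<in> arrows G"
    and inverse_inverse: "g \<in> arrows G \<Longrightarrow> inverse_arrow G (inverse_arrow G g) = g"
    and composable_inverse: "g \<in> arrows G \<Longrightarrow> (inverse_arrow G g, g) \<in> composable G"
    and assoc: "(g, h) \<in> composable G \<Longrightarrow> (h, k) \<in> composable G \<Longrightarrow>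
      (mul G g h, k) \<in> composable G \<and> (g, mul G h k) \<in> composable G \<and>
      mul G (mul G g h) k = mul G g (mul G h k)"
    and cancel_left: "(g, h) \<in> composable G \<Longrightarrow> mul G (inverse_arrow G g) (mul G g h) = h"
    and cancel_right: "(h, g) \<in> composable G \<Longrightarrow> mul G (mul G h g) (inverse_arrow G g) = h"
    and locally_compact: "locally_compact_space (gtop G)"
    and Hausdorff: "Hausdorff_space (gtop G)"
    and continuous_mul: "continuous_map
      (subtopology (prod_topology (gtop G) (gtop G)) (composable G)) (gtop G)
      (\<lambda>(g, h). mul G g h)"
    and continuous_inverse: "continuous_map (gtop G) (gtop G) (inverse_arrow G)"

definition local_homeomorphism :: "'a topology \<Rightarrow> 'b topology \<Rightarrow> ('a \<Rightarrow> 'b) \<Rightarrow> bool" where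
  "local_homeomorphism X Y f \<longleftrightarrow> (\<forall>x\<in>topspace X. \<exists>U. openin X U \<and> x \<in> U \<and> openin Y (f ` U) \<and>
     homeomorphic_map (subtopology X U) (subtopology Y (f ` U)) f)"

locale etale_groupoid = topological_groupoid +
  assumes local_homeo_rng: "local_homeomorphism (gtop G) (unit_top G) (rng G)"
    and local_homeo_dmn: "local_homeomorphism (gtop G) (unit_top G) (dmn G)"

definition invariant :: "'a groupoid \<Rightarrow> 'a set \<Rightarrow> bool" where
  "invariant G D \<longleftrightarrow> D \<subseteq> units G \<and> (\<forall>g\<in>arrows G. dmn G g \<in> D \<longrightarrow> rng G g \<in> D)"

definition reduction_arrows :: "'a groupoid \<Rightarrow> 'a set \<Rightarrow> 'a set"
  where "reduction_arrows G D = {g \<in> arrows G. dmn G g \<in> D}"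

definition reduction :: "'a groupoid \<Rightarrow> 'a set \<Rightarrow> 'a groupoid" where
  "reduction G D =
     \<lparr> gtop = subtopology (gtop G) (reduction_arrows G D),
       composable = composable G \<inter> (reduction_arrows G D \<times> reduction_arrows G D),
       mul = mul G,
       inverse_arrow = inverse_arrow G \<rparr>"


section \<open>The reduced groupoid C*-algebra\<close>

text \<open>Functions on a groupoid or on its unit space are represented by functions on the whole
  type that vanish off that set. Hence extension by zero does not change the representing
  function.\<close>

definition Cc :: "'a topology \<Rightarrow> ('a \<Rightarrow> complex) set" where
  "Cc X = {f. continuous_map X euclidean f \<and> (\<forall>x. x \<notin> topspace X \<longrightarrow> f x = 0) \<and>
     compactin X (X closure_of {x \<in> topspace X. f x \<noteq> 0})}"

definition C0 :: "'a topology \<Rightarrow> ('a \<Rightarrow> complex) set" where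
  "C0 X = {f. continuous_map X euclidean f \<and> (\<forall>x. x \<notin> topspace X \<longrightarrow> f x = 0) \<and>
     (\<forall>e>0. compactin X {x \<in> topspace X. e \<le> cmod (f x)})}"

text \<open>The direct sum over all units \<open>x\<close> of the left regular representations \<open>\<lambda>\<^sub>x\<close> on the
  square-summable functions on \<open>G\<^sub>x = d\<inverse>(x)\<close>, where
  \<open>(\<lambda>\<^sub>x(f)\<xi>)(g) = (\<Sum>h\<in>G\<^sub>x. f (g h\<inverse>) \<xi>(h))\<close>. Since \<open>G\<close> is the disjoint union of the sets \<open>G\<^sub>x\<close>,
  it acts on the square-summable functions on \<open>G\<close>; it is extended by zero to
  the orthogonal complement of these in \<open>'a ell2\<close>. In particular, the operator norm of
  \<open>regular_rep G f\<close> is the reduced norm \<open>sup\<^sub>x \<parallel>\<lambda>\<^sub>x(f)\<parallel>\<close>. For etale \<open>G\<close> the formula gives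
  a bounded operator for all \<open>f\<close> in \<open>Cc (gtop G)\<close> and in \<open>C0 (unit_top G)\<close>.\<close>

definition regular_rep :: "'a groupoid \<Rightarrow> ('a \<Rightarrow> complex) \<Rightarrow> 'a op" where
  "regular_rep G f = Blinfun (\<lambda>\<xi>. Abs_ell2 (\<lambda>g.
     if g \<in> arrows G
     then \<Sum>\<^sub>\<infinity>h\<in>{h \<in> arrows G. dmn G h = dmn G g}.
            f (mul G g (inverse_arrow G h)) * ell2_apply \<xi> h
     else 0))"

definition Cr :: "'a groupoid \<Rightarrow> 'a op set"
  where "Cr G = closure (regular_rep G ` Cc (gtop G))"

text \<open>The copy of \<open>C\<^sub>0(G\<^sup>(\<^sup>0\<^sup>))\<close> inside the reduced C*-algebra: the function \<open>f\<close>, extended by zero,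
  acts as multiplication by \<open>f \<circ> r\<close>.\<close>

definition C0_units :: "'a groupoid \<Rightarrow> 'a op set"
  where "C0_units G = regular_rep G ` C0 (unit_top G)"


section \<open>The map from ideals to open invariant sets\<close>

definition Theta :: "'a groupoid \<Rightarrow> 'a op set \<Rightarrow> 'a set" where
  "Theta G I = (\<Union>f\<in>{f \<in> C0 (unit_top G). regular_rep G f \<in> I}. {x \<in> units G. f x \<noteq> 0})"

definition open_invariant :: "'a groupoid \<Rightarrow> 'a set set"
  where "open_invariant G = {U. openin (unit_top G) U \<and> invariant G U}"

text \<open>The ideal \<open>C\<^sub>0(U)\<close> of the copy of \<open>C\<^sub>0(G\<^sup>(\<^sup>0\<^sup>))\<close> that corresponds to the open set \<open>U\<close>.\<close>

definition ideal_of_open :: "'a groupoid \<Rightarrow> 'a set \<Rightarrow> 'a op set" where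
  "ideal_of_open G U = regular_rep G ` {f \<in> C0 (unit_top G). \<forall>x. x \<notin> U \<longrightarrow> f x = 0}"

definition open_invariant_topology :: "'a groupoid \<Rightarrow> 'a set topology" where
  "open_invariant_topology G =
     pullback_topology (open_invariant G) (ideal_of_open G) (fell_topology (C0_units G))"

definition C0_separates_ideals :: "'a groupoid \<Rightarrow> bool"
  where "C0_separates_ideals G \<longleftrightarrow> inj_on (Theta G) (closed_ideals (Cr G))"

definition lattice_isomorphism ::
  "'a set \<Rightarrow> ('a \<Rightarrow> 'a \<Rightarrow> 'a) \<Rightarrow> ('a \<Rightarrow> 'a \<Rightarrow> 'a) \<Rightarrow>
   'b set \<Rightarrow> ('b \<Rightarrow> 'b \<Rightarrow> 'b) \<Rightarrow> ('b \<Rightarrow> 'b \<Rightarrow> 'b) \<Rightarrow> ('a \<Rightarrow> 'b) \<Rightarrow> bool" where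
  "lattice_isomorphism L meet\<^sub>L join\<^sub>L M meet\<^sub>M join\<^sub>M f \<longleftrightarrow> bij_betw f L M \<and>
     (\<forall>x\<in>L. \<forall>y\<in>L. f (meet\<^sub>L x y) = meet\<^sub>M (f x) (f y) \<and> f (join\<^sub>L x y) = join\<^sub>M (f x) (f y))"


section \<open>Inner exactness and the residual intersection property\<close>

definition restrict_zero :: "'a set \<Rightarrow> ('a \<Rightarrow> complex) \<Rightarrow> 'a \<Rightarrow> complex"
  where "restrict_zero S f = (\<lambda>g. if g \<in> S then f g else 0)"

text \<open>The map between reduced C*-algebras induced by a map \<open>t\<close> between the algebras of continuous
  compactly supported functions is its continuous extension. By density it is determined
  uniquely on \<open>Cr H\<close>, and it is a *-homomorphism into \<open>Cr K\<close> whenever \<open>t\<close> is a *-homomorphism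
  from \<open>Cc (gtop H)\<close> to \<open>Cc (gtop K)\<close>.\<close>

definition induced_map ::
  "'a groupoid \<Rightarrow> 'a groupoid \<Rightarrow> (('a \<Rightarrow> complex) \<Rightarrow> ('a \<Rightarrow> complex)) \<Rightarrow> ('a op \<Rightarrow> 'a op) \<Rightarrow> bool"
  where "induced_map H K t \<phi> \<longleftrightarrow> continuous_on (Cr H) \<phi> \<and>
    (\<forall>f\<in>Cc (gtop H). \<phi> (regular_rep H f) = regular_rep K (t f))"

definition short_exact :: "'a op set \<Rightarrow> 'a op set \<Rightarrow> 'a op set \<Rightarrow> ('a op \<Rightarrow> 'a op) \<Rightarrow> ('a op \<Rightarrow> 'a op) \<Rightarrow> bool"
  where "short_exact A B C \<iota> \<pi> \<longleftrightarrow> inj_on \<iota> A \<and> \<iota> ` A = {T \<in> B. \<pi> T = 0} \<and> \<pi> ` B = C"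

definition inner_exact :: "'a groupoid \<Rightarrow> bool" where
  "inner_exact G \<longleftrightarrow> (\<forall>D. closedin (unit_top G) D \<and> invariant G D \<longrightarrow>
     (\<exists>\<iota> \<pi>. induced_map (reduction G (units G - D)) G (\<lambda>f. f) \<iota> \<and>
            induced_map G (reduction G D) (restrict_zero (reduction_arrows G D)) \<pi> \<and>
            short_exact (Cr (reduction G (units G - D))) (Cr G) (Cr (reduction G D)) \<iota> \<pi>))"

definition intersection_property :: "'a groupoid \<Rightarrow> bool" where
  "intersection_property G \<longleftrightarrow> (\<forall>I\<in>closed_ideals (Cr G). I \<noteq> {0} \<longrightarrow> I \<inter> C0_units G \<noteq> {0})"

definition residual_intersection_property :: "'a groupoid \<Rightarrow> bool" where
  "residual_intersection_property G \<longleftrightarrow>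
     (\<forall>D. closedin (unit_top G) D \<and> invariant G D \<longrightarrow> intersection_property (reduction G D))"

end

theory Submission imports Defs begin

text \<open>Write \<open>A\<close> for the reduced algebra of \<open>G\<close>. The proof rests on the fact that all algebras in question
  act on one Hilbert space. Let \<open>D\<close> be closed and invariant, \<open>U\<close> its complement in the units, and \<open>P\<close>
  the projection onto the functions that live on \<open>G\<^sub>D\<close>; it commutes with \<open>A\<close>. Extension by zero from
  \<open>G\<^sub>U\<close> is then the inclusion of an ideal \<open>A\<^sub>U \<subseteq> A\<close>, and restriction to \<open>G\<^sub>D\<close> is \<open>T \<mapsto> P T\<close>. So \<open>G\<close> is
  inner exact precisely when \<open>A\<^sub>U\<close> is the whole kernel of \<open>T \<mapsto> P T\<close> on \<open>A\<close>, for every \<open>D\<close>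
  (\<open>inner_exact_iff\<close>); the surjectivity onto the algebra of \<open>G\<^sub>D\<close> holds for every etale \<open>G\<close>
  (\<open>Cr_reduction_closed\<close>).

  Three facts about \<open>\<Theta>\<close> hold for every etale \<open>G\<close>: \<open>\<Theta>(I)\<close> is open and invariant, because an ideal
  is stable under conjugation by functions carried by bisections (\<open>Theta_invariant\<close>); \<open>\<Theta>(A\<^sub>U) = U\<close>
  (\<open>Theta_Cr_reduction\<close>), so \<open>\<Theta>\<close> is always onto; and \<open>A\<^sub>U \<subseteq> I\<close> for \<open>U = \<Theta>(I)\<close>
  (\<open>Cr_Theta_sub\<close>). The first two give the equivalence of bijectivity and injectivity.

  If \<open>\<Theta>\<close> is injective, then \<open>A\<^sub>U\<close> and the kernel of \<open>T \<mapsto> P T\<close> coincide because both are mapped to \<open>U\<close>,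
  and an ideal of the algebra of \<open>G\<^sub>D\<close> without non-zero functions is zero because its preimage in \<open>A\<close> is
  mapped to \<open>U\<close>, too. Conversely, let \<open>I\<close> be an ideal, \<open>U = \<Theta>(I)\<close> and \<open>D\<close> the complement of \<open>U\<close>.
  The image \<open>P I\<close> is a closed ideal of the algebra of \<open>G\<^sub>D\<close>. By exactness it contains no non-zero function, so
  the intersection property of \<open>G\<^sub>D\<close> makes it zero. Hence \<open>I\<close> lies in the kernel \<open>A\<^sub>U\<close>, that is
  \<open>I = A\<^sub>U\<close> (\<open>ideal_eq_Cr_Theta\<close>), and \<open>\<Theta>(I)\<close> determines \<open>I\<close>.

  The one point of operator theory is that \<open>P I\<close> is closed (\<open>closed_compression\<close>). This is the closedness of the range of
  a *-homomorphism, and follows from an estimate for \<open>T (1 + T\<^sup>* T / c\<^sup>2)\<^sup>-\<^sup>1\<close>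
  (\<open>resolvent_almost_lifting\<close>) in place of the continuous functional calculus.

  A bijective \<open>\<Theta>\<close> is an order isomorphism with inverse \<open>U \<mapsto> A\<^sub>U\<close>, hence a lattice isomorphism. For the
  topologies one replaces an arbitrary open set of units by its saturation (\<open>saturation\<close>).\<close>

section \<open>The Hilbert space of square-summable functions\<close>

lemma ell2_square_summable: "(\<lambda>x. (cmod (ell2_apply \<xi> x))\<^sup>2) summable_on UNIV"
  using ell2_apply[of \<xi>] by simp

lemma ell2_eqI: "(\<And>x. ell2_apply \<xi> x = ell2_apply \<eta> x) \<Longrightarrow> \<xi> = \<eta>"
  by (metis ell2_apply_inject ext)

lemma ell2_apply_zero [simp]: "ell2_apply 0 x = 0"
  by (simp add: zero_ell2.rep_eq)

lemma ell2_apply_add [simp]: "ell2_apply (\<xi> + \<eta>) x = ell2_apply \<xi> x + ell2_apply \<eta> x"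
  by (simp add: plus_ell2.rep_eq)

lemma ell2_apply_diff [simp]: "ell2_apply (\<xi> - \<eta>) x = ell2_apply \<xi> x - ell2_apply \<eta> x"
  by (simp add: minus_ell2.rep_eq)

lemma ell2_apply_scaleR [simp]: "ell2_apply (c *\<^sub>R \<xi>) x = c *\<^sub>R ell2_apply \<xi> x"
  by (simp add: scaleR_ell2.rep_eq scaleR_conv_of_real)

lemma ell2_apply_scaleC [simp]: "ell2_apply (scaleC_ell2 c \<xi>) x = c * ell2_apply \<xi> x"
  by (simp add: scaleC_ell2.rep_eq)

lemma ell2_norm_square: "(norm \<xi>)\<^sup>2 = (\<Sum>\<^sub>\<infinity>x. (cmod (ell2_apply \<xi> x))\<^sup>2)"
  by (simp add: norm_ell2.rep_eq infsum_nonneg)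

lemma ell2_finite_sum_le: "finite F \<Longrightarrow> (\<Sum>x\<in>F. (cmod (ell2_apply \<xi> x))\<^sup>2) \<le> (norm \<xi>)\<^sup>2"
  unfolding ell2_norm_square by (rule finite_sum_le_infsum[OF ell2_square_summable]) auto

lemma cmod_ell2_apply_le: "cmod (ell2_apply \<xi> x) \<le> norm \<xi>"
  by (rule power2_le_imp_le) (use ell2_finite_sum_le[of "{x}" \<xi>] in simp_all)

lemma square_summableI:
  fixes f :: "'a \<Rightarrow> complex"
  assumes "\<And>F. finite F \<Longrightarrow> (\<Sum>x\<in>F. (cmod (f x))\<^sup>2) \<le> c"
  shows "(\<lambda>x. (cmod (f x))\<^sup>2) summable_on UNIV"
  by (rule nonneg_bdd_above_summable_on) (use assms in \<open>auto intro!: bdd_aboveI2\<close>)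

lemma ell2_norm_leI:
  assumes "\<And>F. finite F \<Longrightarrow> (\<Sum>x\<in>F. (cmod (ell2_apply \<xi> x))\<^sup>2) \<le> c\<^sup>2" "0 \<le> c"
  shows "norm \<xi> \<le> c"
proof -
  have "(norm \<xi>)\<^sup>2 \<le> c\<^sup>2"
    unfolding ell2_norm_square by (rule infsum_le_finite_sums[OF ell2_square_summable assms(1)])
  then show ?thesis using assms(2) by (rule power2_le_imp_le)
qed

lemma ell2_inner_summable: "(\<lambda>x. ell2_apply \<xi> x \<bullet> ell2_apply \<eta> x) summable_on UNIV"
proof (rule Infinite_Sum.abs_summable_summable, rule Infinite_Sum.abs_summable_on_comparison_test')
  show "(\<lambda>x. (cmod (ell2_apply \<xi> x))\<^sup>2 + (cmod (ell2_apply \<eta> x))\<^sup>2) summable_on UNIV"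
    by (intro summable_on_add ell2_square_summable)
  fix x
  have "norm (ell2_apply \<xi> x \<bullet> ell2_apply \<eta> x) \<le> cmod (ell2_apply \<xi> x) * cmod (ell2_apply \<eta> x)"
    by (simp add: Cauchy_Schwarz_ineq2)
  also have "\<dots> \<le> (cmod (ell2_apply \<xi> x))\<^sup>2 + (cmod (ell2_apply \<eta> x))\<^sup>2"
    using sum_squares_bound[of "cmod (ell2_apply \<xi> x)" "cmod (ell2_apply \<eta> x)"]
      mult_nonneg_nonneg[OF norm_ge_zero norm_ge_zero, of "ell2_apply \<xi> x" "ell2_apply \<eta> x"] by linarith
  finally show "norm (ell2_apply \<xi> x \<bullet> ell2_apply \<eta> x) \<le> (cmod (ell2_apply \<xi> x))\<^sup>2 + (cmod (ell2_apply \<eta> x))\<^sup>2" .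
qed

instantiation ell2 :: (type) real_inner
begin

text \<open>This is the real part of the Hermitian inner product; an operator has the same adjoint for both.\<close>

definition inner_ell2 :: "'a ell2 \<Rightarrow> 'a ell2 \<Rightarrow> real"
  where "inner_ell2 \<xi> \<eta> = (\<Sum>\<^sub>\<infinity>x. ell2_apply \<xi> x \<bullet> ell2_apply \<eta> x)"

instance
proof
  fix \<xi> \<eta> \<zeta> :: "'a ell2" and c :: real
  have self: "\<xi> \<bullet> \<xi> = (norm \<xi>)\<^sup>2" for \<xi> :: "'a ell2"
    unfolding inner_ell2_def ell2_norm_square by (simp add: power2_norm_eq_inner)
  show "\<xi> \<bullet> \<eta> = \<eta> \<bullet> \<xi>" unfolding inner_ell2_def by (simp add: inner_commute)
  show "(\<xi> + \<eta>) \<bullet> \<zeta> = \<xi> \<bullet> \<zeta> + \<eta> \<bullet> \<zeta>"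
    unfolding inner_ell2_def by (simp add: inner_add_left infsum_add ell2_inner_summable)
  show "c *\<^sub>R \<xi> \<bullet> \<eta> = c * (\<xi> \<bullet> \<eta>)"
    unfolding inner_ell2_def by (simp add: infsum_cmult_right')
  show "0 \<le> \<xi> \<bullet> \<xi>" "(\<xi> \<bullet> \<xi> = 0) = (\<xi> = 0)" "norm \<xi> = sqrt (\<xi> \<bullet> \<xi>)" by (simp_all add: self)
qed

end

text \<open>Completeness of \<open>\<ell>\<^sup>2\<close> makes the space of operators a Banach space, in which the fixed points and the
  limits below exist.\<close>

instance ell2 :: (type) banach
proof
  fix X :: "nat \<Rightarrow> 'a ell2"
  assume X: "Cauchy X"
  have "Cauchy (\<lambda>n. ell2_apply (X n) x)" for x
  proof (rule CauchyI)
    fix e :: real assume "0 < e"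
    then obtain M where "\<forall>m\<ge>M. \<forall>n\<ge>M. norm (X m - X n) < e" using CauchyD[OF X] by blast
    moreover have "cmod (ell2_apply (X m) x - ell2_apply (X n) x) \<le> norm (X m - X n)" for m n
      using cmod_ell2_apply_le[of "X m - X n" x] by simp
    ultimately show "\<exists>M. \<forall>m\<ge>M. \<forall>n\<ge>M. norm (ell2_apply (X m) x - ell2_apply (X n) x) < e"
      by (meson le_less_trans)
  qed
  then have "\<forall>x. \<exists>l. (\<lambda>n. ell2_apply (X n) x) \<longlonglongrightarrow> l" by (simp add: Cauchy_convergent_iff convergent_def)
  then obtain L where L: "\<And>x. (\<lambda>n. ell2_apply (X n) x) \<longlonglongrightarrow> L x" by metis
  \<comment> \<open>the Cauchy estimate on finite sets survives the pointwise limit, uniformly in the finite set\<close>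
  have tail: "\<exists>N. \<forall>n\<ge>N. \<forall>F. finite F \<longrightarrow> (\<Sum>x\<in>F. (cmod (ell2_apply (X n) x - L x))\<^sup>2) \<le> e\<^sup>2"
    if "0 < e" for e :: real
  proof -
    obtain N where N: "\<forall>m\<ge>N. \<forall>n\<ge>N. norm (X m - X n) < e" using CauchyD[OF X \<open>0 < e\<close>] by blast
    have "(\<Sum>x\<in>F. (cmod (ell2_apply (X n) x - L x))\<^sup>2) \<le> e\<^sup>2" if "n \<ge> N" "finite F" for n and F :: "'a set"
    proof (rule tendsto_upperbound)
      show "(\<lambda>m. \<Sum>x\<in>F. (cmod (ell2_apply (X n) x - ell2_apply (X m) x))\<^sup>2)
         \<longlonglongrightarrow> (\<Sum>x\<in>F. (cmod (ell2_apply (X n) x - L x))\<^sup>2)" by (intro tendsto_intros L)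
      have "(\<Sum>x\<in>F. (cmod (ell2_apply (X n) x - ell2_apply (X m) x))\<^sup>2) \<le> e\<^sup>2" if "m \<ge> N" for m
      proof -
        have "(\<Sum>x\<in>F. (cmod (ell2_apply (X n) x - ell2_apply (X m) x))\<^sup>2) \<le> (norm (X n - X m))\<^sup>2"
          using ell2_finite_sum_le[OF \<open>finite F\<close>, of "X n - X m"] by simp
        also have "\<dots> \<le> e\<^sup>2" using N \<open>m \<ge> N\<close> \<open>n \<ge> N\<close> by (intro power_mono) (auto intro: less_imp_le)
        finally show ?thesis .
      qed
      then show "\<forall>\<^sub>F m in sequentially. (\<Sum>x\<in>F. (cmod (ell2_apply (X n) x - ell2_apply (X m) x))\<^sup>2) \<le> e\<^sup>2"
        unfolding eventually_sequentially by blast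
    qed simp
    then show ?thesis by blast
  qed
  obtain n0 where n0: "\<And>F. finite F \<Longrightarrow> (\<Sum>x\<in>F. (cmod (ell2_apply (X n0) x - L x))\<^sup>2) \<le> 1\<^sup>2"
    using tail[of 1] by auto
  have "(\<lambda>x. (cmod (L x))\<^sup>2) summable_on UNIV"
    using square_summable_add[OF ell2_square_summable[of "X n0"] square_summable_scale[OF square_summableI[OF n0], of "-1"]]
    by simp
  then have Labs: "ell2_apply (Abs_ell2 L) x = L x" for x by (simp add: Abs_ell2_inverse)
  have "X \<longlonglongrightarrow> Abs_ell2 L"
  proof (rule LIMSEQ_I)
    fix e :: real assume "0 < e"
    then obtain N where N: "\<forall>n\<ge>N. \<forall>F. finite F \<longrightarrow> (\<Sum>x\<in>F. (cmod (ell2_apply (X n) x - L x))\<^sup>2) \<le> (e/2)\<^sup>2"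
      using tail[of "e/2"] by auto
    have "norm (X n - Abs_ell2 L) \<le> e/2" if "n \<ge> N" for n
      by (rule ell2_norm_leI) (use N that \<open>0 < e\<close> in \<open>auto simp: Labs\<close>)
    then show "\<exists>N. \<forall>n\<ge>N. norm (X n - Abs_ell2 L) < e" using \<open>0 < e\<close> by fastforce
  qed
  then show "convergent X" by (rule convergentI)
qed

lift_definition single :: "'a \<Rightarrow> complex \<Rightarrow> 'a ell2" is "\<lambda>x c y. if y = x then c else 0"
  by (rule finite_nonzero_values_imp_summable_on) (rule finite_subset[of _ "{_}"], auto)

lemma ell2_apply_single: "ell2_apply (single x c) y = (if y = x then c else 0)"
  by (simp add: single.rep_eq)

lemma norm_single [simp]: "norm (single x c) = cmod c"
proof (rule antisym)
  show "norm (single x c) \<le> cmod c"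
  proof (rule ell2_norm_leI)
    fix F :: "'a set" assume "finite F"
    have "(\<Sum>y\<in>F. (cmod (ell2_apply (single x c) y))\<^sup>2) = (\<Sum>y\<in>F. if y = x then (cmod c)\<^sup>2 else 0)"
      by (rule sum.cong) (auto simp: ell2_apply_single)
    also have "\<dots> \<le> (cmod c)\<^sup>2" using \<open>finite F\<close> by (simp add: sum.delta)
    finally show "(\<Sum>y\<in>F. (cmod (ell2_apply (single x c) y))\<^sup>2) \<le> (cmod c)\<^sup>2" .
  qed simp
  show "cmod c \<le> norm (single x c)"
    using cmod_ell2_apply_le[of "single x c" x] by (simp add: ell2_apply_single)
qed

lemma inner_single: "\<xi> \<bullet> single y b = ell2_apply \<xi> y \<bullet> b"
proof -
  have "\<xi> \<bullet> single y b = (\<Sum>\<^sub>\<infinity>x\<in>{y}. ell2_apply \<xi> x \<bullet> ell2_apply (single y b) x)"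
    unfolding inner_ell2_def by (rule infsum_cong_neutral) (auto simp: ell2_apply_single)
  then show ?thesis by (simp add: ell2_apply_single)
qed

text \<open>Continuous linear maps on \<open>\<ell>\<^sup>2\<close> are compared on the vectors with one-point support, whose finite
  sums are dense; every operator identity below reduces in this way to one about the coefficients.\<close>

lemma ell2_approx:
  assumes "0 < e" obtains F where "finite F" "norm (\<xi> - (\<Sum>x\<in>F. single x (ell2_apply \<xi> x))) < e"
proof -
  obtain F where F: "finite F"
    "dist (\<Sum>x\<in>F. (cmod (ell2_apply \<xi> x))\<^sup>2) (\<Sum>\<^sub>\<infinity>x. (cmod (ell2_apply \<xi> x))\<^sup>2) \<le> (e/2)\<^sup>2"
    using infsum_finite_approximation[OF ell2_square_summable, of "(e/2)\<^sup>2" \<xi>] \<open>0 < e\<close> by auto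
  have ap: "ell2_apply (\<Sum>x\<in>F. single x (ell2_apply \<xi> x)) y = (if y \<in> F then ell2_apply \<xi> y else 0)" for y
  proof -
    have "ell2_apply (\<Sum>x\<in>F. single x (ell2_apply \<xi> x)) y = (\<Sum>x\<in>F. ell2_apply (single x (ell2_apply \<xi> x)) y)"
      using F(1) by (induction F rule: finite_induct) auto
    also have "\<dots> = (\<Sum>x\<in>F. if x = y then ell2_apply \<xi> y else 0)"
      by (rule sum.cong) (auto simp: ell2_apply_single)
    finally show ?thesis using F(1) by simp
  qed
  have "norm (\<xi> - (\<Sum>x\<in>F. single x (ell2_apply \<xi> x))) \<le> e/2"
  proof (rule ell2_norm_leI)
    fix E :: "'a set" assume E: "finite E"
    have "(\<Sum>x\<in>E. (cmod (ell2_apply (\<xi> - (\<Sum>x\<in>F. single x (ell2_apply \<xi> x))) x))\<^sup>2)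
        = (\<Sum>x\<in>E. if x \<in> F then 0 else (cmod (ell2_apply \<xi> x))\<^sup>2)"
      by (rule sum.cong) (auto simp: ap)
    also have "\<dots> = (\<Sum>x\<in>E - F. (cmod (ell2_apply \<xi> x))\<^sup>2)"
      using E by (simp add: sum.If_cases) (rule sum.cong, auto)
    also have "\<dots> = (\<Sum>x\<in>E \<union> F. (cmod (ell2_apply \<xi> x))\<^sup>2) - (\<Sum>x\<in>F. (cmod (ell2_apply \<xi> x))\<^sup>2)"
      using sum.union_disjoint[of "E - F" F "\<lambda>x. (cmod (ell2_apply \<xi> x))\<^sup>2"] E F(1)
      by (simp add: Diff_Int_distrib2)
    also have "\<dots> \<le> (\<Sum>\<^sub>\<infinity>x. (cmod (ell2_apply \<xi> x))\<^sup>2) - (\<Sum>x\<in>F. (cmod (ell2_apply \<xi> x))\<^sup>2)"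
      using ell2_finite_sum_le[of "E \<union> F" \<xi>] E F(1) by (simp add: ell2_norm_square)
    also have "\<dots> \<le> (e/2)\<^sup>2" using F(2) by (simp add: dist_real_def)
    finally show "(\<Sum>x\<in>E. (cmod (ell2_apply (\<xi> - (\<Sum>x\<in>F. single x (ell2_apply \<xi> x))) x))\<^sup>2) \<le> (e/2)\<^sup>2" .
  qed (use assms in simp)
  then show ?thesis using that F(1) assms by simp
qed

lemma bounded_linear_eq_on_singles:
  fixes f g :: "'a ell2 \<Rightarrow> 'b::real_normed_vector"
  assumes "bounded_linear f" "bounded_linear g" "\<And>x c. f (single x c) = g (single x c)"
  shows "f \<xi> = g \<xi>"
proof (rule ccontr)
  interpret f: bounded_linear f by fact
  interpret g: bounded_linear g by fact
  interpret h: bounded_linear "\<lambda>\<xi>. f \<xi> - g \<xi>" by (intro bounded_linear_sub assms)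
  assume "f \<xi> \<noteq> g \<xi>"
  obtain K where K: "0 < K" "\<And>\<xi>. norm (f \<xi> - g \<xi>) \<le> norm \<xi> * K" using h.pos_bounded by blast
  obtain F where F: "finite F" "norm (\<xi> - (\<Sum>x\<in>F. single x (ell2_apply \<xi> x))) < norm (f \<xi> - g \<xi>) / K"
    using ell2_approx[of "norm (f \<xi> - g \<xi>) / K" \<xi>] K \<open>f \<xi> \<noteq> g \<xi>\<close> by auto
  let ?s = "\<Sum>x\<in>F. single x (ell2_apply \<xi> x)"
  have "f ?s = g ?s" by (simp add: f.sum g.sum assms(3))
  then have "norm (f \<xi> - g \<xi>) = norm (f (\<xi> - ?s) - g (\<xi> - ?s))" by (simp add: f.diff g.diff)
  also have "\<dots> \<le> norm (\<xi> - ?s) * K" by (rule K)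
  also have "\<dots> < norm (f \<xi> - g \<xi>)" using F(2) K(1) by (simp add: pos_less_divide_eq)
  finally show False by simp
qed

lemma op_eqI_singles:
  fixes S T :: "'a op"
  assumes "\<And>x c. S (single x c) = T (single x c)" shows "S = T"
  by (rule blinfun_eqI, rule bounded_linear_eq_on_singles) (auto intro: blinfun.bounded_linear_right assms)

lemma scaleC_op_apply [simp]: "scaleC_op c T \<xi> = scaleC_ell2 c (T \<xi>)"
  unfolding scaleC_op_def by (simp add: bounded_linear_Blinfun_apply bounded_linear_scaleC_ell2)

lemma norm_scaleC_op_le: "norm (scaleC_op c T) \<le> cmod c * norm T"
  by (rule norm_blinfun_bound) (auto simp: norm_scaleC_ell2 mult.assoc intro!: mult_left_mono norm_blinfun)

lemma bounded_linear_scaleC_op: "bounded_linear (scaleC_op c)"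
  by (rule bounded_linear_intro[where K = "cmod c"])
    (auto intro!: blinfun_eqI ell2_eqI simp: blinfun.add_left blinfun.scaleR_left algebra_simps
      norm_scaleC_op_le[unfolded mult.commute[of "cmod c"]])

lemma scaleR_eq_scaleC_op: "r *\<^sub>R T = scaleC_op (of_real r) T"
  by (auto intro!: blinfun_eqI ell2_eqI simp: blinfun.scaleR_left scaleR_conv_of_real)

lift_definition restrict_ell2 :: "'a set \<Rightarrow> 'a ell2 \<Rightarrow> 'a ell2" is "\<lambda>S \<xi> x. if x \<in> S then \<xi> x else 0"
  by (erule summable_on_comparison_test) auto

lemma ell2_apply_restrict [simp]:
  "ell2_apply (restrict_ell2 S \<xi>) x = (if x \<in> S then ell2_apply \<xi> x else 0)"
  by (simp add: restrict_ell2.rep_eq)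

lemma norm_restrict_ell2_le: "norm (restrict_ell2 S \<xi>) \<le> norm \<xi>"
proof (rule ell2_norm_leI)
  fix F :: "'a set" assume "finite F"
  have "(\<Sum>x\<in>F. (cmod (ell2_apply (restrict_ell2 S \<xi>) x))\<^sup>2) \<le> (\<Sum>x\<in>F. (cmod (ell2_apply \<xi> x))\<^sup>2)"
    by (rule sum_mono) auto
  also have "\<dots> \<le> (norm \<xi>)\<^sup>2" by (rule ell2_finite_sum_le) fact
  finally show "(\<Sum>x\<in>F. (cmod (ell2_apply (restrict_ell2 S \<xi>) x))\<^sup>2) \<le> (norm \<xi>)\<^sup>2" .
qed simp

definition proj :: "'a set \<Rightarrow> 'a op" where "proj S = Blinfun (restrict_ell2 S)"

lemma proj_apply [simp]: "proj S \<xi> = restrict_ell2 S \<xi>"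
proof -
  have "bounded_linear (restrict_ell2 S)"
    by (rule bounded_linear_intro[where K = 1]) (auto intro!: ell2_eqI simp: norm_restrict_ell2_le)
  then show ?thesis by (simp add: proj_def bounded_linear_Blinfun_apply)
qed

lemma restrict_single: "restrict_ell2 S (single x c) = (if x \<in> S then single x c else 0)"
  by (rule ell2_eqI) (auto simp: ell2_apply_single)

lemma proj_idem: "proj S o\<^sub>L proj S = proj S"
  by (auto intro!: blinfun_eqI ell2_eqI)

lemma norm_proj_le: "norm (proj S) \<le> 1"
  by (rule norm_blinfun_bound) (auto simp: norm_restrict_ell2_le)

section \<open>Restricting an algebra of operators to an invariant subspace\<close>

text \<open>Each \<open>\<pi> T\<close> has an approximate lift \<open>X\<close> of controlled norm that removes half of it. A point in the
  closure of the image is then lifted by a convergent series, as in the open mapping theorem.\<close>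

lemma closed_image_if_almost_lifting:
  fixes \<pi> :: "'b::banach \<Rightarrow> 'c::real_normed_vector"
  assumes \<pi>: "bounded_linear \<pi>" and V: "closed V" "subspace V"
    and lift: "\<And>T. T \<in> V \<Longrightarrow> \<exists>X\<in>V. norm X \<le> norm (\<pi> T) \<and> norm (\<pi> (T - X)) \<le> norm (\<pi> T) / 2"
  shows "closed (\<pi> ` V)"
proof -
  interpret \<pi>: bounded_linear \<pi> by fact
  have "S \<in> \<pi> ` V" if S: "S \<in> closure (\<pi> ` V)" for S
  proof -
    have approx: "\<exists>Z\<in>V. norm (S - \<pi> Z) < e" if "0 < e" for e
      using S that unfolding closure_approachable by (force simp: dist_norm norm_minus_commute)
    \<comment> \<open>one step costs an error of \<open>1/8\<close> for replacing \<open>S\<close> by an element of the image, so the remainder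
      is multiplied by at most \<open>1/8 + (9/8) / 2 \<le> 7/8\<close>\<close>
    have "\<exists>Y. \<forall>n. (Y n \<in> V \<and> norm (S - \<pi> (Y n)) < (7/8)^n * (norm S + 1)) \<and>
            norm (Y (Suc n) - Y n) \<le> 2 * (7/8)^n * (norm S + 1)"
    proof (rule dependent_nat_choice)
      show "\<exists>Y. Y \<in> V \<and> norm (S - \<pi> Y) < (7/8)^0 * (norm S + 1)"
        by (rule exI[of _ 0]) (use V(2) in \<open>simp add: subspace_0 \<pi>.zero\<close>)
    next
      fix Y n assume Y: "Y \<in> V \<and> norm (S - \<pi> Y) < (7/8)^n * (norm S + 1)"
      define e where "e = (7/8)^n * (norm S + 1)"
      have "0 < e" unfolding e_def using norm_ge_zero[of S] by (intro mult_pos_pos) (simp, linarith)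
      then obtain Z where Z: "Z \<in> V" "norm (S - \<pi> Z) < e/8" using approx[of "e/8"] by auto
      have ZY: "Z - Y \<in> V" using Z(1) Y V(2) by (simp add: subspace_diff)
      have "norm (\<pi> (Z - Y)) \<le> norm (S - \<pi> Y) + norm (S - \<pi> Z)"
        using norm_triangle_ineq4[of "S - \<pi> Y" "S - \<pi> Z"] by (simp add: \<pi>.diff)
      then have n1: "norm (\<pi> (Z - Y)) \<le> 9/8 * e" using Y Z(2) by (simp add: e_def)
      obtain X where X: "X \<in> V" "norm X \<le> norm (\<pi> (Z - Y))" "norm (\<pi> (Z - Y - X)) \<le> norm (\<pi> (Z - Y)) / 2"
        using lift[OF ZY] by blast
      have "norm (S - \<pi> (Y + X)) \<le> norm (S - \<pi> Z) + norm (\<pi> (Z - Y - X))"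
        using norm_triangle_ineq[of "S - \<pi> Z" "\<pi> (Z - Y - X)"] by (simp add: \<pi>.diff \<pi>.add algebra_simps)
      then have "norm (S - \<pi> (Y + X)) < 7/8 * e" using Z(2) X(3) n1 \<open>0 < e\<close> by linarith
      moreover have "norm X \<le> 2 * e" using X(2) n1 \<open>0 < e\<close> by linarith
      ultimately show "\<exists>Y'. (Y' \<in> V \<and> norm (S - \<pi> Y') < (7/8)^Suc n * (norm S + 1)) \<and>
            norm (Y' - Y) \<le> 2 * (7/8)^n * (norm S + 1)"
        using Y X(1) V(2) by (intro exI[of _ "Y + X"]) (simp add: e_def subspace_add)
    qed
    then obtain Y where Y: "\<And>n. Y n \<in> V" "\<And>n. norm (S - \<pi> (Y n)) < (7/8)^n * (norm S + 1)"
      "\<And>n. norm (Y (Suc n) - Y n) \<le> 2 * (7/8)^n * (norm S + 1)" by blast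
    have "summable (\<lambda>n. Y (Suc n) - Y n)"
    proof (rule summable_comparison_test')
      show "summable (\<lambda>n. 2 * (7/8)^n * (norm S + 1))"
        by (intro summable_mult summable_mult2 summable_geometric) simp
    qed (rule Y(3))
    then obtain L where "(\<lambda>n. \<Sum>k<n. Y (Suc k) - Y k) \<longlonglongrightarrow> L"
      by (auto simp: summable_def sums_def)
    then have "(\<lambda>n. (Y n - Y 0) + Y 0) \<longlonglongrightarrow> L + Y 0"
      by (intro tendsto_add) (auto simp: sum_lessThan_telescope)
    then have L: "Y \<longlonglongrightarrow> L + Y 0" by simp
    then have "L + Y 0 \<in> V" using V(1) Y(1) by (metis closed_sequentially)
    moreover have "(\<lambda>n. \<pi> (Y n)) \<longlonglongrightarrow> S"
    proof (rule Lim_transform2[OF tendsto_const])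
      have "(\<lambda>n. (7/8)^n * (norm S + 1)) \<longlonglongrightarrow> 0"
        by (intro tendsto_mult_left_zero LIMSEQ_power_zero) simp
      then show "(\<lambda>n. S - \<pi> (Y n)) \<longlonglongrightarrow> 0"
        by (rule Lim_null_comparison[rotated]) (rule eventuallyI, rule less_imp_le, rule Y(2))
    qed
    then have "\<pi> (L + Y 0) = S" using \<pi>.tendsto[OF L] LIMSEQ_unique by blast
    ultimately show ?thesis by blast
  qed
  then show ?thesis by (metis closure_subset closed_closure subsetI subset_antisym)
qed

definition adjoint_op :: "'h::real_inner \<Rightarrow>\<^sub>L 'h \<Rightarrow> 'h \<Rightarrow>\<^sub>L 'h \<Rightarrow> bool"
  where "adjoint_op S T \<longleftrightarrow> (\<forall>\<xi> \<eta>. S \<xi> \<bullet> \<eta> = \<xi> \<bullet> T \<eta>)"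

lemma adjoint_opD: "adjoint_op S T \<Longrightarrow> S \<xi> \<bullet> \<eta> = \<xi> \<bullet> T \<eta>"
  unfolding adjoint_op_def by blast

lemma norm_le_from_square: "(x::real)\<^sup>2 \<le> c * x \<Longrightarrow> 0 \<le> c \<Longrightarrow> x \<le> c"
  by (metis mult_le_cancel_right not_le order.trans power2_eq_square)

lemma norm_adjoint_apply_le:
  assumes "adjoint_op S T" shows "norm (T \<eta>) \<le> norm S * norm \<eta>"
proof (rule norm_le_from_square)
  have "(norm (T \<eta>))\<^sup>2 = S (T \<eta>) \<bullet> \<eta>" by (simp add: power2_norm_eq_inner adjoint_opD[OF assms])
  also have "\<dots> \<le> norm (S (T \<eta>)) * norm \<eta>" by (rule norm_cauchy_schwarz)
  also have "\<dots> \<le> (norm S * norm (T \<eta>)) * norm \<eta>" by (intro mult_right_mono norm_blinfun) simp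
  finally show "(norm (T \<eta>))\<^sup>2 \<le> norm S * norm \<eta> * norm (T \<eta>)" by (simp add: mult_ac)
qed simp

text \<open>Put \<open>c = \<parallel>P T\<parallel>\<close> and \<open>X = T (1 + T\<^sup>* T / c\<^sup>2)\<^sup>-\<^sup>1\<close>. In the functional calculus, \<open>t / (1 + t\<^sup>2/c\<^sup>2)\<close> is at
  most \<open>c/2\<close> for every \<open>t \<ge> 0\<close>, and it differs from \<open>t\<close> by at most \<open>c/2\<close> as long as \<open>t \<le> c\<close>. So \<open>X\<close> is
  bounded in terms of \<open>P T\<close>, however large \<open>T\<close> may be, while \<open>P X\<close> is off \<open>P T\<close> by at most \<open>c/2\<close>. The
  proof replaces the functional calculus by the identity for \<open>\<parallel>\<eta> + a \<eta>\<parallel>\<^sup>2\<close>, \<open>a = T\<^sup>* T / c\<^sup>2\<close>, and obtains \<open>X\<close> as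
  a fixed point, so that \<open>X\<close> does not leave \<open>V\<close>.\<close>

lemma resolvent_almost_lifting:
  fixes T Ts P :: "'h::{real_inner,banach} \<Rightarrow>\<^sub>L 'h"
  assumes V: "closed V" "subspace V" "T \<in> V" "\<And>X. X \<in> V \<Longrightarrow> X o\<^sub>L (Ts o\<^sub>L T) \<in> V"
    and adj: "adjoint_op T Ts"
    and P: "P o\<^sub>L P = P" "P o\<^sub>L T = T o\<^sub>L P" "P o\<^sub>L Ts = Ts o\<^sub>L P" "norm P \<le> 1"
  shows "\<exists>X\<in>V. norm X \<le> norm (P o\<^sub>L T) \<and> norm (P o\<^sub>L (T - X)) \<le> norm (P o\<^sub>L T) / 2"
proof (cases "norm (P o\<^sub>L T) = 0")
  case True
  then show ?thesis by (intro bexI[of _ 0]) (use V(2) in \<open>auto simp: subspace_0\<close>)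
next
  case False
  define c where "c = norm (P o\<^sub>L T)"
  have c: "0 < c" using False by (simp add: c_def)
  define a where "a = (1 / c\<^sup>2) *\<^sub>R (Ts o\<^sub>L T)"
  define m where "m = (norm T / c)\<^sup>2"
  \<comment> \<open>\<open>1 + a = (m + 1) (1 - k)\<close>, and \<open>k\<close> is a strict contraction because \<open>0 \<le> a \<le> m\<close>\<close>
  define k where "k = (1 / (m + 1)) *\<^sub>R (m *\<^sub>R id_blinfun - a)"
  have m: "0 \<le> m" by (simp add: m_def)
  have PP: "P (P \<xi>) = P \<xi>" "P (T \<xi>) = T (P \<xi>)" "P (Ts \<xi>) = Ts (P \<xi>)" for \<xi>
    using P(1-3) by (metis blinfun_apply_blinfun_compose)+
  have a_ap: "a \<xi> = (1 / c\<^sup>2) *\<^sub>R Ts (T \<xi>)" for \<xi> by (simp add: a_def blinfun.scaleR_left)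
  have inner_a: "\<xi> \<bullet> a \<xi> = (norm (T \<xi>))\<^sup>2 / c\<^sup>2" for \<xi>
    by (simp add: a_ap adjoint_opD[OF adj, symmetric] power2_norm_eq_inner)
  have expand: "(norm (\<eta> + a \<eta>))\<^sup>2 = (norm \<eta>)\<^sup>2 + 2 * ((norm (T \<eta>))\<^sup>2 / c\<^sup>2) + (norm (a \<eta>))\<^sup>2" for \<eta>
    unfolding power2_norm_eq_inner inner_add_left inner_add_right
    using inner_a[of \<eta>] inner_commute[of \<eta> "a \<eta>"] by (simp add: power2_norm_eq_inner)
  have norm_k: "norm k \<le> m / (m + 1)"
  proof (rule norm_blinfun_bound)
    fix \<xi>
    have "norm (m *\<^sub>R \<xi> - a \<xi>) \<le> m * norm \<xi>"
    proof (rule power2_le_imp_le)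
      have "norm (a \<xi>) = norm (Ts (T \<xi>)) / c\<^sup>2" by (simp add: a_ap)
      also have "\<dots> \<le> (norm T * norm (T \<xi>)) / c\<^sup>2"
        by (intro divide_right_mono norm_adjoint_apply_le adj) simp
      finally have "(norm (a \<xi>))\<^sup>2 \<le> ((norm T * norm (T \<xi>)) / c\<^sup>2)\<^sup>2" by (intro power_mono) auto
      also have "\<dots> = m * ((norm (T \<xi>))\<^sup>2 / c\<^sup>2)" by (simp add: m_def power_divide power_mult_distrib)
      finally have "(norm (a \<xi>))\<^sup>2 \<le> m * ((norm (T \<xi>))\<^sup>2 / c\<^sup>2)" .
      moreover have "(norm (m *\<^sub>R \<xi> - a \<xi>))\<^sup>2 = m\<^sup>2 * (norm \<xi>)\<^sup>2 - 2 * m * ((norm (T \<xi>))\<^sup>2 / c\<^sup>2) + (norm (a \<xi>))\<^sup>2"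
        unfolding inner_a[symmetric] unfolding power2_norm_eq_inner
        by (simp add: inner_diff_left inner_diff_right inner_commute[of "a \<xi>" \<xi>] power2_eq_square
          algebra_simps)
      moreover have "0 \<le> m * ((norm (T \<xi>))\<^sup>2 / c\<^sup>2)" using m by simp
      ultimately show "(norm (m *\<^sub>R \<xi> - a \<xi>))\<^sup>2 \<le> (m * norm \<xi>)\<^sup>2" unfolding power_mult_distrib by linarith
    qed (use m in simp)
    then show "norm (k \<xi>) \<le> m / (m + 1) * norm \<xi>"
      using m by (simp add: k_def blinfun.scaleR_left blinfun.diff_left divide_right_mono)
  qed (use m in simp)
  have q: "0 \<le> m / (m + 1)" "m / (m + 1) < 1" using m by auto
  have Xk: "X o\<^sub>L k = (1 / (m + 1)) *\<^sub>R (m *\<^sub>R X - (1 / c\<^sup>2) *\<^sub>R (X o\<^sub>L (Ts o\<^sub>L T)))" for X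
    by (rule blinfun_eqI) (simp add: k_def a_ap blinfun.scaleR_left blinfun.scaleR_right blinfun.diff_left blinfun.diff_right)
  \<comment> \<open>\<open>X (1 - k) = T / (m + 1)\<close>, that is \<open>X (1 + a) = T\<close>\<close>
  have "\<exists>!X\<in>V. (X o\<^sub>L k) + (1 / (m + 1)) *\<^sub>R T = X"
  proof (rule Banach_fix[OF _ _ q])
    show "complete V" using V(1) by (simp add: complete_eq_closed)
    show "V \<noteq> {}" using V(3) by blast
    show "(\<lambda>X. (X o\<^sub>L k) + (1 / (m + 1)) *\<^sub>R T) ` V \<subseteq> V"
      unfolding Xk using V(3,4) by (auto intro!: subspace_add[OF V(2)] subspace_scale[OF V(2)] subspace_diff[OF V(2)])
    fix X Y assume "X \<in> V" "Y \<in> V"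
    have "dist ((X o\<^sub>L k) + (1 / (m + 1)) *\<^sub>R T) ((Y o\<^sub>L k) + (1 / (m + 1)) *\<^sub>R T) = norm ((X - Y) o\<^sub>L k)"
      by (simp add: dist_norm bounded_bilinear.diff_left[OF bounded_bilinear_blinfun_compose])
    also have "\<dots> \<le> norm (X - Y) * norm k" by (rule norm_blinfun_compose)
    also have "\<dots> \<le> m / (m + 1) * dist X Y" using mult_left_mono[OF norm_k norm_ge_zero, of "X - Y"]
      unfolding dist_norm by (simp only: mult.commute)
    finally show "dist ((X o\<^sub>L k) + (1 / (m + 1)) *\<^sub>R T) ((Y o\<^sub>L k) + (1 / (m + 1)) *\<^sub>R T) \<le> m / (m + 1) * dist X Y" .
  qed
  then obtain X where X: "X \<in> V" "(X o\<^sub>L k) + (1 / (m + 1)) *\<^sub>R T = X" by blast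
  \<comment> \<open>\<open>R\<close> is the inverse of \<open>1 + a\<close>\<close>
  have "\<exists>!R\<in>UNIV. (k o\<^sub>L R) + (1 / (m + 1)) *\<^sub>R id_blinfun = R"
  proof (rule Banach_fix[OF _ _ q])
    show "complete (UNIV :: ('h \<Rightarrow>\<^sub>L 'h) set)" by (rule complete_UNIV)
    fix X Y :: "'h \<Rightarrow>\<^sub>L 'h"
    have "dist ((k o\<^sub>L X) + (1 / (m + 1)) *\<^sub>R id_blinfun) ((k o\<^sub>L Y) + (1 / (m + 1)) *\<^sub>R id_blinfun) = norm (k o\<^sub>L (X - Y))"
      by (simp add: dist_norm bounded_bilinear.diff_right[OF bounded_bilinear_blinfun_compose])
    also have "\<dots> \<le> norm k * norm (X - Y)" by (rule norm_blinfun_compose)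
    also have "\<dots> \<le> m / (m + 1) * dist X Y" using mult_right_mono[OF norm_k norm_ge_zero, of "X - Y"]
      unfolding dist_norm .
    finally show "dist ((k o\<^sub>L X) + (1 / (m + 1)) *\<^sub>R id_blinfun) ((k o\<^sub>L Y) + (1 / (m + 1)) *\<^sub>R id_blinfun) \<le> m / (m + 1) * dist X Y" .
  qed auto
  then obtain R where R: "(k o\<^sub>L R) + (1 / (m + 1)) *\<^sub>R id_blinfun = R" by blast
  have m1: "m + 1 \<noteq> 0" using m by simp
  have clear: "\<beta> = \<gamma> + \<tau> - \<alpha>" if "(1 / (m + 1)) *\<^sub>R (m *\<^sub>R \<beta> - \<alpha>) + (1 / (m + 1)) *\<^sub>R \<tau> = \<beta>" "\<gamma> = 0"
    for \<alpha> \<beta> \<gamma> \<tau> :: 'h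
  proof -
    have "(m + 1) *\<^sub>R \<beta> = (m *\<^sub>R \<beta> - \<alpha>) + \<tau>"
      using that(1)[symmetric] m1
      by (metis (no_types, lifting) divide_self_if eq_vector_fraction_iff real_vector_affinity_eq scaleR_one scaleR_right_distrib vector_fraction_eq_iff)
    then show ?thesis using that(2) by (simp add: algebra_simps)
  qed
  have XR: "X \<xi> + X (a \<xi>) = T \<xi>" for \<xi>
  proof -
    have "(1 / (m + 1)) *\<^sub>R (m *\<^sub>R X \<xi> - X (a \<xi>)) + (1 / (m + 1)) *\<^sub>R T \<xi> = ((X o\<^sub>L k) + (1 / (m + 1)) *\<^sub>R T) \<xi>"
      by (simp add: k_def blinfun.add_left blinfun.scaleR_left blinfun.scaleR_right blinfun.diff_left blinfun.diff_right)
    then have "X \<xi> = 0 + T \<xi> - X (a \<xi>)" using X(2) by (intro clear) simp_all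
    then show ?thesis by (metis add_0 diff_add_cancel)
  qed
  have RR: "R \<xi> + a (R \<xi>) = \<xi>" for \<xi>
  proof -
    have "(1 / (m + 1)) *\<^sub>R (m *\<^sub>R R \<xi> - a (R \<xi>)) + (1 / (m + 1)) *\<^sub>R \<xi> = ((k o\<^sub>L R) + (1 / (m + 1)) *\<^sub>R id_blinfun) \<xi>"
      by (simp add: k_def blinfun.add_left blinfun.scaleR_left blinfun.scaleR_right blinfun.diff_left blinfun.diff_right)
    then have "R \<xi> = 0 + \<xi> - a (R \<xi>)" using R by (intro clear) simp_all
    then show ?thesis by (metis add_0 diff_add_cancel)
  qed
  have X_ap: "X \<xi> = T (R \<xi>)" for \<xi>
    using XR[of "R \<xi>"] RR[of \<xi>] by (metis blinfun.add_right)
  have "norm X \<le> c"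
  proof (rule norm_blinfun_bound)
    fix \<xi>
    have "2 * ((norm (T (R \<xi>)))\<^sup>2 / c\<^sup>2) \<le> (norm \<xi>)\<^sup>2"
      using expand[of "R \<xi>"] RR[of \<xi>] by simp
    moreover have "0 \<le> (norm (T (R \<xi>)))\<^sup>2 / c\<^sup>2" by simp
    ultimately have "(norm (T (R \<xi>)))\<^sup>2 / c\<^sup>2 \<le> (norm \<xi>)\<^sup>2" by linarith
    then have "(norm (T (R \<xi>)))\<^sup>2 \<le> (c * norm \<xi>)\<^sup>2" using c by (simp add: field_simps)
    then show "norm (X \<xi>) \<le> c * norm \<xi>"
      unfolding X_ap by (rule power2_le_imp_le) (use c in simp)
  qed (use c in simp)
  moreover have "norm (P o\<^sub>L (T - X)) \<le> c / 2"
  proof (rule norm_blinfun_bound)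
    fix \<xi>
    define \<eta> where "\<eta> = P (R \<xi>)"
    have PT: "norm (T (P \<zeta>)) \<le> c * norm (P \<zeta>)" for \<zeta>
    proof -
      have "T (P \<zeta>) = (P o\<^sub>L T) (P \<zeta>)" by (simp add: PP)
      then show ?thesis unfolding c_def by (metis norm_blinfun)
    qed
    have P1: "norm (P \<zeta>) \<le> norm \<zeta>" for \<zeta>
      using norm_blinfun[of P \<zeta>] P(4) by (meson mult_left_le_one_le norm_ge_zero order_trans)
    have P\<eta>: "P \<eta> = \<eta>" by (simp add: \<eta>_def PP)
    have s: "norm (a \<eta>) \<le> norm (T \<eta>) / c"
    proof -
      have "norm (Ts (T \<eta>)) \<le> c * norm (T \<eta>)"
      proof (rule norm_le_from_square)
        have e: "Ts (T \<eta>) = P (Ts (T \<eta>))" by (metis PP P\<eta>)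
        have "(norm (Ts (T \<eta>)))\<^sup>2 = T (Ts (T \<eta>)) \<bullet> T \<eta>"
          by (simp add: power2_norm_eq_inner adjoint_opD[OF adj])
        also have "\<dots> \<le> norm (T (Ts (T \<eta>))) * norm (T \<eta>)" by (rule norm_cauchy_schwarz)
        also have "\<dots> \<le> (c * norm (Ts (T \<eta>))) * norm (T \<eta>)"
          using PT[of "Ts (T \<eta>)"] e by (intro mult_right_mono) auto
        finally show "(norm (Ts (T \<eta>)))\<^sup>2 \<le> c * norm (T \<eta>) * norm (Ts (T \<eta>))" by (simp add: mult_ac)
      qed (use c in simp)
      then have "norm (Ts (T \<eta>)) / c\<^sup>2 \<le> c * norm (T \<eta>) / c\<^sup>2" by (rule divide_right_mono) simp
      then show ?thesis using c by (simp add: a_ap power2_eq_square)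
    qed
    have t: "norm (T \<eta>) / c \<le> norm \<eta>"
      using PT[of \<eta>] c P\<eta> by (simp add: pos_divide_le_eq mult.commute)
    have Pa: "P (a \<zeta>) = a (P \<zeta>)" for \<zeta> by (simp add: a_ap PP blinfun.scaleR_right)
    have P\<xi>: "\<eta> + a \<eta> = P \<xi>"
      unfolding \<eta>_def Pa[symmetric] blinfun.add_right[symmetric] RR ..
    have "4 * (norm (a \<eta>))\<^sup>2 \<le> (norm (P \<xi>))\<^sup>2"
    proof -
      have "(norm (a \<eta>))\<^sup>2 \<le> (norm (T \<eta>) / c)\<^sup>2" "(norm (T \<eta>) / c)\<^sup>2 \<le> (norm \<eta>)\<^sup>2"
        by (rule power_mono[OF s] power_mono[OF t]; use c in simp)+
      then show ?thesis using expand[of \<eta>] unfolding P\<xi> by (simp add: power_divide)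
    qed
    also have "\<dots> \<le> (norm \<xi>)\<^sup>2" by (intro power_mono P1) simp
    finally have "(2 * norm (a \<eta>))\<^sup>2 \<le> (norm \<xi>)\<^sup>2" by (simp add: power_mult_distrib)
    then have h: "norm (a \<eta>) \<le> norm \<xi> / 2" using power2_le_imp_le[OF _ norm_ge_zero] by fastforce
    have TX: "(T - X) \<xi> = T (a (R \<xi>))"
      using RR[of \<xi>] by (metis X_ap add_diff_cancel_left' blinfun.diff_left blinfun.diff_right)
    have "(P o\<^sub>L (T - X)) \<xi> = T (P (a \<eta>))"
      by (simp add: TX PP Pa \<eta>_def)
    then have "norm ((P o\<^sub>L (T - X)) \<xi>) \<le> c * norm (a \<eta>)"
      using PT[of "a \<eta>"] Pa P\<eta> by simp
    also have "\<dots> \<le> c * (norm \<xi> / 2)" using c h by simp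
    finally show "norm ((P o\<^sub>L (T - X)) \<xi>) \<le> c / 2 * norm \<xi>" by simp
  qed (use c in simp)
  ultimately show ?thesis using X(1) unfolding c_def by blast
qed

lemma closed_compression:
  fixes P :: "'h::{real_inner,banach} \<Rightarrow>\<^sub>L 'h"
  assumes V: "closed V" "subspace V"
    and adj: "\<And>T. T \<in> V \<Longrightarrow> \<exists>Ts. adjoint_op T Ts \<and> P o\<^sub>L Ts = Ts o\<^sub>L P \<and> (\<forall>X\<in>V. X o\<^sub>L (Ts o\<^sub>L T) \<in> V)"
    and P: "P o\<^sub>L P = P" "\<And>T. T \<in> V \<Longrightarrow> P o\<^sub>L T = T o\<^sub>L P" "norm P \<le> 1"
  shows "closed ((\<lambda>T. P o\<^sub>L T) ` V)"
proof (rule closed_image_if_almost_lifting[OF _ V])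
  show "bounded_linear ((o\<^sub>L) P)"
    by (rule bounded_bilinear.bounded_linear_right[OF bounded_bilinear_blinfun_compose])
  fix T assume T: "T \<in> V"
  then obtain Ts where Ts: "adjoint_op T Ts" "P o\<^sub>L Ts = Ts o\<^sub>L P" "\<forall>X\<in>V. X o\<^sub>L (Ts o\<^sub>L T) \<in> V"
    using adj by blast
  show "\<exists>X\<in>V. norm X \<le> norm (P o\<^sub>L T) \<and> norm (P o\<^sub>L (T - X)) \<le> norm (P o\<^sub>L T) / 2"
    by (rule resolvent_almost_lifting[where Ts = Ts]) (use V T Ts P in auto)
qed

section \<open>Groupoids and their regular representations\<close>

text \<open>The axioms of a groupoid without a topology. They pass to reductions to invariant sets, and they suffice for
  the operator identities of the regular representation.\<close>

locale algebraic_groupoid =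
  fixes G :: "'a groupoid"
  assumes composable_sub: "composable G \<subseteq> arrows G \<times> arrows G"
    and mul_in: "(g, h) \<in> composable G \<Longrightarrow> mul G g h \<in> arrows G"
    and inv_in: "g \<in> arrows G \<Longrightarrow> inverse_arrow G g \<in> arrows G"
    and inv_inv: "g \<in> arrows G \<Longrightarrow> inverse_arrow G (inverse_arrow G g) = g"
    and inv_composable: "g \<in> arrows G \<Longrightarrow> (inverse_arrow G g, g) \<in> composable G"
    and mul_assoc: "(g, h) \<in> composable G \<Longrightarrow> (h, k) \<in> composable G \<Longrightarrow>
      (mul G g h, k) \<in> composable G \<and> (g, mul G h k) \<in> composable G \<and>
      mul G (mul G g h) k = mul G g (mul G h k)"
    and inv_mul_cancel: "(g, h) \<in> composable G \<Longrightarrow> mul G (inverse_arrow G g) (mul G g h) = h"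
    and mul_inv_cancel: "(h, g) \<in> composable G \<Longrightarrow> mul G (mul G h g) (inverse_arrow G g) = h"
begin

lemma composable_inv: "g \<in> arrows G \<Longrightarrow> (g, inverse_arrow G g) \<in> composable G"
  by (metis inv_in inv_inv inv_composable)

lemma composable_iff: "(g, h) \<in> composable G \<longleftrightarrow> g \<in> arrows G \<and> h \<in> arrows G \<and> dmn G g = rng G h"
proof
  assume gh: "(g, h) \<in> composable G"
  then have in_arrows: "g \<in> arrows G" "h \<in> arrows G" using composable_sub by auto
  have 1: "(inverse_arrow G g, mul G g h) \<in> composable G"
    using mul_assoc[OF inv_composable gh] in_arrows by blast
  have 2: "(mul G g h, inverse_arrow G h) \<in> composable G"
    using mul_assoc[OF gh composable_inv] in_arrows by blast
  have "rng G h = mul G (mul G (inverse_arrow G g) (mul G g h)) (inverse_arrow G h)"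
    by (simp add: rng_def inv_mul_cancel[OF gh])
  also have "\<dots> = dmn G g"
    using mul_assoc[OF 1 2] mul_inv_cancel[OF gh] by (simp add: dmn_def)
  finally show "g \<in> arrows G \<and> h \<in> arrows G \<and> dmn G g = rng G h" using in_arrows by simp
next
  assume *: "g \<in> arrows G \<and> h \<in> arrows G \<and> dmn G g = rng G h"
  then have g: "g \<in> arrows G" by simp
  have 1: "(g, dmn G g) \<in> composable G" and gd: "mul G g (dmn G g) = g"
    using mul_assoc[OF composable_inv[OF g] inv_composable[OF g]] mul_inv_cancel[OF composable_inv[OF inv_in[OF g]]]
      mul_inv_cancel[of g "inverse_arrow G g"] composable_inv[OF inv_in[OF g]] composable_inv[OF g] inv_inv[OF g]
    by (simp_all add: dmn_def)
  have 2: "(rng G h, h) \<in> composable G"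
    using mul_assoc[OF composable_inv inv_composable] * unfolding rng_def by auto
  show "(g, h) \<in> composable G" using mul_assoc[OF 1] 2 gd * by auto
qed

lemma dmn_inv: "g \<in> arrows G \<Longrightarrow> dmn G (inverse_arrow G g) = rng G g"
  by (simp add: dmn_def rng_def inv_inv)

lemma rng_inv: "g \<in> arrows G \<Longrightarrow> rng G (inverse_arrow G g) = dmn G g"
  by (simp add: dmn_def rng_def inv_inv)

lemma mul_arrow: "g \<in> arrows G \<Longrightarrow> h \<in> arrows G \<Longrightarrow> dmn G g = rng G h \<Longrightarrow> mul G g h \<in> arrows G"
  by (simp add: mul_in composable_iff)

lemma mul_assoc': "\<lbrakk>g \<in> arrows G; h \<in> arrows G; k \<in> arrows G; dmn G g = rng G h; dmn G h = rng G k\<rbrakk> \<Longrightarrow>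
    mul G (mul G g h) k = mul G g (mul G h k)"
  using mul_assoc by (simp add: composable_iff)

lemma dmn_mul:
  assumes "g \<in> arrows G" "h \<in> arrows G" "dmn G g = rng G h" shows "dmn G (mul G g h) = dmn G h"
proof -
  have "(mul G g h, inverse_arrow G h) \<in> composable G"
    using mul_assoc[of g h "inverse_arrow G h"] composable_inv assms composable_iff by blast
  then show ?thesis using rng_inv assms by (simp add: composable_iff)
qed

lemma rng_mul:
  assumes "g \<in> arrows G" "h \<in> arrows G" "dmn G g = rng G h" shows "rng G (mul G g h) = rng G g"
proof -
  have "(inverse_arrow G g, mul G g h) \<in> composable G"
    using mul_assoc[of "inverse_arrow G g" g h] inv_composable assms composable_iff by blast
  then show ?thesis using dmn_inv assms by (simp add: composable_iff)
qed

lemma dmn_in: "g \<in> arrows G \<Longrightarrow> dmn G g \<in> arrows G"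
  unfolding dmn_def by (rule mul_in[OF inv_composable])

lemma rng_mul_self: "g \<in> arrows G \<Longrightarrow> mul G (rng G g) g = g"
  using mul_inv_cancel[OF composable_inv, of g] inv_inv unfolding rng_def by auto

lemma dmn_dmn: "g \<in> arrows G \<Longrightarrow> dmn G (dmn G g) = dmn G g"
  using dmn_mul[of "inverse_arrow G g" g] inv_in dmn_inv unfolding dmn_def[of G g] by simp

lemma rng_dmn: "g \<in> arrows G \<Longrightarrow> rng G (dmn G g) = dmn G g"
  using rng_mul[of "inverse_arrow G g" g] inv_in dmn_inv rng_inv by (simp add: dmn_def[of G g, symmetric])

lemma unitsD: "u \<in> units G \<Longrightarrow> u \<in> arrows G \<and> dmn G u = u \<and> rng G u = u"
  unfolding units_def using dmn_in dmn_dmn rng_dmn by auto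

lemma units_iff: "u \<in> units G \<longleftrightarrow> u \<in> arrows G \<and> dmn G u = u"
  using unitsD by (metis image_eqI units_def)

lemma dmn_units: "g \<in> arrows G \<Longrightarrow> dmn G g \<in> units G"
  by (simp add: units_def)

lemma rng_units: "g \<in> arrows G \<Longrightarrow> rng G g \<in> units G"
  using dmn_units[OF inv_in] dmn_inv by fastforce

lemma unit_mul: "u \<in> units G \<Longrightarrow> h \<in> arrows G \<Longrightarrow> rng G h = u \<Longrightarrow> mul G u h = h"
  using rng_mul_self by blast

lemma inv_mul:
  assumes "g \<in> arrows G" "h \<in> arrows G" "dmn G g = rng G h"
  shows "inverse_arrow G (mul G g h) = mul G (inverse_arrow G h) (inverse_arrow G g)"
proof -
  let ?y = "inverse_arrow G (mul G g h)"
  have gh: "mul G g h \<in> arrows G" "(g, h) \<in> composable G" using assms by (auto simp: mul_arrow composable_iff)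
  have y: "?y \<in> arrows G" "dmn G ?y = rng G g" "rng G ?y = dmn G h"
    using gh assms by (auto simp: inv_in dmn_inv rng_inv rng_mul dmn_mul)
  have "mul G ?y g = mul G ?y (mul G (mul G g h) (inverse_arrow G h))"
    by (simp add: mul_inv_cancel[OF gh(2)])
  also have "\<dots> = mul G (mul G ?y (mul G g h)) (inverse_arrow G h)"
    using y gh assms by (intro mul_assoc'[symmetric]) (auto simp: inv_in rng_inv rng_mul dmn_mul)
  also have "mul G ?y (mul G g h) = dmn G h" using assms by (simp add: dmn_def[symmetric] dmn_mul)
  also have "mul G (dmn G h) (inverse_arrow G h) = inverse_arrow G h"
    using assms by (intro unit_mul dmn_units) (auto simp: inv_in rng_inv)
  finally have "mul G ?y g = inverse_arrow G h" .
  then show ?thesis using mul_inv_cancel[of ?y g] y assms by (simp add: composable_iff)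
qed

text \<open>The arrow \<open>g h\<^sup>-\<^sup>1\<close> that indexes the matrix entry of a convolution operator at \<open>(g, h)\<close>.\<close>

abbreviation quo :: "'a \<Rightarrow> 'a \<Rightarrow> 'a"
  where "quo g h \<equiv> mul G g (inverse_arrow G h)"

lemma quo:
  assumes "g \<in> arrows G" "h \<in> arrows G" "dmn G g = dmn G h"
  shows "quo g h \<in> arrows G" "dmn G (quo g h) = rng G h" "rng G (quo g h) = rng G g"
    "inverse_arrow G (quo g h) = quo h g"
  using assms by (auto simp: inv_in dmn_inv rng_inv mul_arrow dmn_mul rng_mul inv_mul inv_inv)

lemma quo_mul_cancel:
  assumes "g \<in> arrows G" "h \<in> arrows G" "dmn G g = dmn G h" shows "mul G (quo g h) h = g"
  using mul_inv_cancel[of g "inverse_arrow G h"] assms by (simp add: composable_iff inv_in rng_inv inv_inv)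

lemma mul_quo_cancel:
  assumes "g \<in> arrows G" "h \<in> arrows G" "dmn G g = rng G h" shows "quo (mul G g h) h = g"
  using mul_inv_cancel[of g h] assms by (simp add: composable_iff)

lemma quo_quo:
  assumes "g \<in> arrows G" "h \<in> arrows G" "x \<in> arrows G" "dmn G g = dmn G x" "dmn G h = dmn G x"
  shows "quo (quo g x) (quo h x) = quo g h"
proof -
  have "quo (quo g x) (quo h x) = mul G (quo g x) (mul G x (inverse_arrow G h))"
    using assms by (simp add: quo)
  also have "\<dots> = mul G (mul G (quo g x) x) (inverse_arrow G h)"
    using assms by (intro mul_assoc'[symmetric]) (auto simp: quo inv_in rng_inv)
  finally show ?thesis using assms by (simp add: quo_mul_cancel)
qed

lemma quo_self: "g \<in> arrows G \<Longrightarrow> quo g g = rng G g"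
  by (simp add: rng_def)

lemma quo_unit_imp_eq:
  assumes "g \<in> arrows G" "h \<in> arrows G" "dmn G g = dmn G h" "quo g h \<in> units G" shows "g = h"
  by (metis assms quo(2) quo_mul_cancel unitsD unit_mul)

lemma inj_quo_right: "g \<in> arrows G \<Longrightarrow> inj_on (quo g) {h \<in> arrows G. dmn G h = dmn G g}"
proof (rule inj_onI)
  fix h h' assume "g \<in> arrows G" "h \<in> {h \<in> arrows G. dmn G h = dmn G g}" "h' \<in> {h \<in> arrows G. dmn G h = dmn G g}"
    and eq: "quo g h = quo g h'"
  then have "(g, inverse_arrow G h) \<in> composable G" "(g, inverse_arrow G h') \<in> composable G" "h \<in> arrows G" "h' \<in> arrows G"
    by (auto simp: composable_iff inv_in rng_inv)
  then show "h = h'" using eq by (metis inv_mul_cancel inv_inv)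
qed

lemma inj_quo_left: "h \<in> arrows G \<Longrightarrow> inj_on (\<lambda>g. quo g h) {g \<in> arrows G. dmn G g = dmn G h}"
  by (rule inj_onI) (metis (mono_tags, lifting) mem_Collect_eq quo_mul_cancel)

end

text \<open>A function with finitely many non-zero values, boundedly many, on each fibre of \<open>r\<close> and of \<open>d\<close>
  gives a matrix with boundedly many non-zero entries in each row and column.\<close>

definition fibre_bounded :: "'a groupoid \<Rightarrow> ('a \<Rightarrow> complex) \<Rightarrow> nat \<Rightarrow> real \<Rightarrow> bool" where
  "fibre_bounded G f n C \<longleftrightarrow> (\<forall>k. cmod (f k) \<le> C) \<and>
     (\<forall>x. finite {k \<in> arrows G. f k \<noteq> 0 \<and> rng G k = x} \<and> card {k \<in> arrows G. f k \<noteq> 0 \<and> rng G k = x} \<le> n) \<and>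
     (\<forall>x. finite {k \<in> arrows G. f k \<noteq> 0 \<and> dmn G k = x} \<and> card {k \<in> arrows G. f k \<noteq> 0 \<and> dmn G k = x} \<le> n)"

definition fibre_finite :: "'a groupoid \<Rightarrow> ('a \<Rightarrow> complex) \<Rightarrow> bool"
  where "fibre_finite G f \<longleftrightarrow> (\<exists>n C. fibre_bounded G f n C)"

lemma fibre_finite_mono:
  assumes "fibre_finite G f" "\<And>k. cmod (f' k) \<le> cmod (f k)" "arrows H \<subseteq> arrows G" "rng H = rng G" "dmn H = dmn G"
  shows "fibre_finite H f'"
proof -
  obtain n C where f: "fibre_bounded G f n C" using assms(1) fibre_finite_def by blast
  have nz: "f' k \<noteq> 0 \<Longrightarrow> f k \<noteq> 0" for k using assms(2)[of k] by auto
  have sub: "{k \<in> arrows H. f' k \<noteq> 0 \<and> rng H k = x} \<subseteq> {k \<in> arrows G. f k \<noteq> 0 \<and> rng G k = x}"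
    "{k \<in> arrows H. f' k \<noteq> 0 \<and> dmn H k = x} \<subseteq> {k \<in> arrows G. f k \<noteq> 0 \<and> dmn G k = x}" for x
    using nz assms(3-5) by auto
  have "fibre_bounded H f' n C"
    unfolding fibre_bounded_def
    using f sub finite_subset[OF sub(1)] finite_subset[OF sub(2)] card_mono[OF _ sub(1)] card_mono[OF _ sub(2)] assms(2)
    unfolding fibre_bounded_def by (meson order_trans)
  then show ?thesis using fibre_finite_def by blast
qed

lemma fibre_finite_add:
  assumes "fibre_finite G f" "fibre_finite G f'" shows "fibre_finite G (\<lambda>k. f k + f' k)"
proof -
  obtain n C where f: "fibre_bounded G f n C" using assms(1) fibre_finite_def by blast
  obtain n' C' where f': "fibre_bounded G f' n' C'" using assms(2) fibre_finite_def by blast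
  have card: "finite {k \<in> arrows G. f k + f' k \<noteq> 0 \<and> p k = x} \<and> card {k \<in> arrows G. f k + f' k \<noteq> 0 \<and> p k = x} \<le> n + n'"
    if 1: "finite {k \<in> arrows G. f k \<noteq> 0 \<and> p k = x}" "card {k \<in> arrows G. f k \<noteq> 0 \<and> p k = x} \<le> n"
      "finite {k \<in> arrows G. f' k \<noteq> 0 \<and> p k = x}" "card {k \<in> arrows G. f' k \<noteq> 0 \<and> p k = x} \<le> n'"
    for p :: "'a \<Rightarrow> 'a" and x
  proof -
    have sub: "{k \<in> arrows G. f k + f' k \<noteq> 0 \<and> p k = x} \<subseteq>
        {k \<in> arrows G. f k \<noteq> 0 \<and> p k = x} \<union> {k \<in> arrows G. f' k \<noteq> 0 \<and> p k = x}" by auto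
    have "card {k \<in> arrows G. f k + f' k \<noteq> 0 \<and> p k = x} \<le>
        card ({k \<in> arrows G. f k \<noteq> 0 \<and> p k = x} \<union> {k \<in> arrows G. f' k \<noteq> 0 \<and> p k = x})"
      by (rule card_mono[OF _ sub]) (use 1 in simp)
    also have "\<dots> \<le> n + n'" using card_Un_le 1(2,4) by (meson add_mono order_trans)
    finally show ?thesis using finite_subset[OF sub] 1(1,3) by simp
  qed
  have "cmod (f k + f' k) \<le> C + C'" for k
    using f f' unfolding fibre_bounded_def by (meson add_mono norm_triangle_ineq order_trans)
  then have "fibre_bounded G (\<lambda>k. f k + f' k) (n + n') (C + C')"
    using f f' unfolding fibre_bounded_def by (intro conjI allI card[THEN conjunct1] card[THEN conjunct2]) auto
  then show ?thesis using fibre_finite_def by blast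
qed

text \<open>Pointwise formulas for operators enter here: a linear assignment of coefficient functions with bounded
  finite square sums is what the raw \<open>Blinfun\<close> and \<open>Abs_ell2\<close> in the regular representation need.\<close>

lemma ell2_operator:
  fixes \<Phi> :: "'a ell2 \<Rightarrow> 'a \<Rightarrow> complex"
  assumes lin: "\<And>\<xi> \<eta> g. \<Phi> (\<xi> + \<eta>) g = \<Phi> \<xi> g + \<Phi> \<eta> g" "\<And>r \<xi> g. \<Phi> (r *\<^sub>R \<xi>) g = r *\<^sub>R \<Phi> \<xi> g"
    and bound: "\<And>\<xi> F. finite F \<Longrightarrow> (\<Sum>g\<in>F. (cmod (\<Phi> \<xi> g))\<^sup>2) \<le> (B * norm \<xi>)\<^sup>2" and "0 \<le> B"
  shows "ell2_apply (Blinfun (\<lambda>\<xi>. Abs_ell2 (\<Phi> \<xi>)) \<xi>) = \<Phi> \<xi>" "norm (Blinfun (\<lambda>\<xi>. Abs_ell2 (\<Phi> \<xi>))) \<le> B"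
proof -
  have abs: "ell2_apply (Abs_ell2 (\<Phi> \<xi>)) = \<Phi> \<xi>" for \<xi>
    by (rule Abs_ell2_inverse) (use square_summableI[OF bound] in simp)
  have norm: "norm (Abs_ell2 (\<Phi> \<xi>)) \<le> B * norm \<xi>" for \<xi>
    by (rule ell2_norm_leI) (use bound \<open>0 \<le> B\<close> in \<open>simp_all add: abs\<close>)
  have bl: "bounded_linear (\<lambda>\<xi>. Abs_ell2 (\<Phi> \<xi>))"
    by (rule bounded_linear_intro[where K = B])
      (auto intro!: ell2_eqI simp: abs lin norm mult.commute[of _ B])
  show "ell2_apply (Blinfun (\<lambda>\<xi>. Abs_ell2 (\<Phi> \<xi>)) \<xi>) = \<Phi> \<xi>"
    by (simp add: bounded_linear_Blinfun_apply[OF bl] abs)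
  show "norm (Blinfun (\<lambda>\<xi>. Abs_ell2 (\<Phi> \<xi>))) \<le> B"
    by (rule norm_blinfun_bound) (use \<open>0 \<le> B\<close> norm in \<open>auto simp: bounded_linear_Blinfun_apply[OF bl]\<close>)
qed

definition conv :: "'a groupoid \<Rightarrow> ('a \<Rightarrow> complex) \<Rightarrow> ('a \<Rightarrow> complex) \<Rightarrow> 'a \<Rightarrow> complex" where
  "conv G f k = (\<lambda>g. if g \<in> arrows G
     then \<Sum>\<^sub>\<infinity>h\<in>{h \<in> arrows G. dmn G h = dmn G g}. f (mul G g (inverse_arrow G h)) * k h else 0)"

definition star :: "'a groupoid \<Rightarrow> ('a \<Rightarrow> complex) \<Rightarrow> 'a \<Rightarrow> complex"
  where "star G f = (\<lambda>g. if g \<in> arrows G then cnj (f (inverse_arrow G g)) else 0)"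

context algebraic_groupoid
begin

lemma row_bound:
  assumes f: "fibre_bounded G f n C" and g: "g \<in> arrows G"
  shows "finite {h \<in> arrows G. dmn G h = dmn G g \<and> f (quo g h) \<noteq> 0}"
    "card {h \<in> arrows G. dmn G h = dmn G g \<and> f (quo g h) \<noteq> 0} \<le> n"
proof -
  let ?S = "{h \<in> arrows G. dmn G h = dmn G g \<and> f (quo g h) \<noteq> 0}"
  let ?T = "{k \<in> arrows G. f k \<noteq> 0 \<and> rng G k = rng G g}"
  have inj: "inj_on (quo g) ?S" by (rule inj_on_subset[OF inj_quo_right[OF g]]) auto
  have sub: "quo g ` ?S \<subseteq> ?T" using quo g by auto
  have T: "finite ?T" "card ?T \<le> n" using f unfolding fibre_bounded_def by blast+
  show "finite ?S" by (rule inj_on_finite[OF inj sub T(1)])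
  show "card ?S \<le> n" using card_inj_on_le[OF inj sub T(1)] T(2) by simp
qed

lemma column_bound:
  assumes f: "fibre_bounded G f n C" and h: "h \<in> arrows G"
  shows "finite {g \<in> arrows G. dmn G g = dmn G h \<and> f (quo g h) \<noteq> 0}"
    "card {g \<in> arrows G. dmn G g = dmn G h \<and> f (quo g h) \<noteq> 0} \<le> n"
proof -
  let ?S = "{g \<in> arrows G. dmn G g = dmn G h \<and> f (quo g h) \<noteq> 0}"
  let ?T = "{k \<in> arrows G. f k \<noteq> 0 \<and> dmn G k = rng G h}"
  have inj: "inj_on (\<lambda>g. quo g h) ?S" by (rule inj_on_subset[OF inj_quo_left[OF h]]) auto
  have sub: "(\<lambda>g. quo g h) ` ?S \<subseteq> ?T" using quo h by auto
  have T: "finite ?T" "card ?T \<le> n" using f unfolding fibre_bounded_def by blast+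
  show "finite ?S" by (rule inj_on_finite[OF inj sub T(1)])
  show "card ?S \<le> n" using card_inj_on_le[OF inj sub T(1)] T(2) by simp
qed

lemma conv_finite:
  assumes f: "fibre_finite G f" and g: "g \<in> arrows G"
  shows "conv G f k g = (\<Sum>h\<in>{h \<in> arrows G. dmn G h = dmn G g \<and> f (quo g h) \<noteq> 0}. f (quo g h) * k h)"
proof -
  obtain n C where "fibre_bounded G f n C" using f fibre_finite_def by blast
  note fin = row_bound(1)[OF this g]
  have "conv G f k g = (\<Sum>\<^sub>\<infinity>h\<in>{h \<in> arrows G. dmn G h = dmn G g \<and> f (quo g h) \<noteq> 0}. f (quo g h) * k h)"
    unfolding conv_def using g by (simp only: if_True) (rule infsum_cong_neutral, auto)
  then show ?thesis by (simp only: infsum_finite[OF fin])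
qed

text \<open>Schur's test: at most \<open>n\<close> entries in each row and column, all bounded by \<open>C\<close>, give the norm bound \<open>n C\<close>.\<close>

lemma regular_rep_bound:
  assumes f: "fibre_bounded G f n C"
  shows "ell2_apply (regular_rep G f \<xi>) = conv G f (ell2_apply \<xi>)" "norm (regular_rep G f) \<le> real n * C"
proof -
  have C: "0 \<le> C" "\<And>k. cmod (f k) \<le> C" using f norm_ge_zero order_trans unfolding fibre_bounded_def by blast+
  have fin: "fibre_finite G f" using f fibre_finite_def by blast
  define S where "S g = {h \<in> arrows G. dmn G h = dmn G g \<and> f (quo g h) \<noteq> 0}" for g
  have S: "finite (S g)" "card (S g) \<le> n" if "g \<in> arrows G" for g
    using row_bound[OF f that] by (auto simp: S_def)
  have cv: "conv G f k g = (\<Sum>h\<in>S g. f (quo g h) * k h)" if "g \<in> arrows G" for g k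
    using conv_finite[OF fin that] by (simp add: S_def)
  have pt: "(cmod (conv G f (ell2_apply \<xi>) g))\<^sup>2 \<le> C\<^sup>2 * real n * (\<Sum>h\<in>S g. (cmod (ell2_apply \<xi> h))\<^sup>2)"
    if g: "g \<in> arrows G" for \<xi> g
  proof -
    have "cmod (conv G f (ell2_apply \<xi>) g) \<le> (\<Sum>h\<in>S g. C * cmod (ell2_apply \<xi> h))"
      unfolding cv[OF g] by (rule sum_norm_le) (auto simp: norm_mult intro!: mult_right_mono C)
    then have "(cmod (conv G f (ell2_apply \<xi>) g))\<^sup>2 \<le> (C * (\<Sum>h\<in>S g. cmod (ell2_apply \<xi> h)))\<^sup>2"
      by (intro power_mono) (auto simp: sum_distrib_left)
    also have "\<dots> = C\<^sup>2 * (\<Sum>h\<in>S g. cmod (ell2_apply \<xi> h))\<^sup>2" by (simp add: power_mult_distrib)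
    also have "\<dots> \<le> C\<^sup>2 * (real n * (\<Sum>h\<in>S g. (cmod (ell2_apply \<xi> h))\<^sup>2))"
    proof (rule mult_left_mono)
      have "(\<Sum>h\<in>S g. cmod (ell2_apply \<xi> h))\<^sup>2 \<le> real (card (S g)) * (\<Sum>h\<in>S g. (cmod (ell2_apply \<xi> h))\<^sup>2)"
        using Cauchy_Schwarz_ineq_sum[of "\<lambda>_. 1" "\<lambda>h. cmod (ell2_apply \<xi> h)" "S g"] by simp
      also have "\<dots> \<le> real n * (\<Sum>h\<in>S g. (cmod (ell2_apply \<xi> h))\<^sup>2)"
        using S(2)[OF g] by (intro mult_right_mono sum_nonneg) auto
      finally show "(\<Sum>h\<in>S g. cmod (ell2_apply \<xi> h))\<^sup>2 \<le> real n * (\<Sum>h\<in>S g. (cmod (ell2_apply \<xi> h))\<^sup>2)" .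
    qed simp
    finally show ?thesis by (simp add: mult.assoc)
  qed
  have bound: "(\<Sum>g\<in>F. (cmod (conv G f (ell2_apply \<xi>) g))\<^sup>2) \<le> (real n * C * norm \<xi>)\<^sup>2"
    if F: "finite F" for F \<xi>
  proof -
    define E where "E = F \<inter> arrows G"
    define H where "H = (\<Union>g\<in>E. S g)"
    have E: "finite E" using F by (simp add: E_def)
    then have H: "finite H" unfolding H_def using S(1) by (auto simp: E_def)
    have "(\<Sum>g\<in>F. (cmod (conv G f (ell2_apply \<xi>) g))\<^sup>2) = (\<Sum>g\<in>E. (cmod (conv G f (ell2_apply \<xi>) g))\<^sup>2)"
      by (rule sum.mono_neutral_right) (use F in \<open>auto simp: E_def conv_def\<close>)
    also have "\<dots> \<le> (\<Sum>g\<in>E. C\<^sup>2 * real n * (\<Sum>h\<in>S g. (cmod (ell2_apply \<xi> h))\<^sup>2))"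
      by (rule sum_mono) (auto simp: E_def intro!: pt)
    also have "\<dots> = C\<^sup>2 * real n * (\<Sum>g\<in>E. \<Sum>h\<in>S g. (cmod (ell2_apply \<xi> h))\<^sup>2)" by (simp add: sum_distrib_left)
    finally have outer: "(\<Sum>g\<in>F. (cmod (conv G f (ell2_apply \<xi>) g))\<^sup>2) \<le>
      C\<^sup>2 * real n * (\<Sum>g\<in>E. \<Sum>h\<in>S g. (cmod (ell2_apply \<xi> h))\<^sup>2)" .
    have "(\<Sum>g\<in>E. \<Sum>h\<in>S g. (cmod (ell2_apply \<xi> h))\<^sup>2) = (\<Sum>g\<in>E. \<Sum>h\<in>{h \<in> H. h \<in> S g}. (cmod (ell2_apply \<xi> h))\<^sup>2)"
      by (intro sum.cong) (auto simp: H_def)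
    also have "\<dots> = (\<Sum>h\<in>H. \<Sum>g\<in>{g \<in> E. h \<in> S g}. (cmod (ell2_apply \<xi> h))\<^sup>2)"
      by (rule sum.swap_restrict[OF E H])
    also have "\<dots> \<le> (\<Sum>h\<in>H. real n * (cmod (ell2_apply \<xi> h))\<^sup>2)"
    proof (rule sum_mono)
      fix h assume "h \<in> H"
      then have h: "h \<in> arrows G" by (auto simp: H_def S_def)
      have "card {g \<in> E. h \<in> S g} \<le> card {g \<in> arrows G. dmn G g = dmn G h \<and> f (quo g h) \<noteq> 0}"
        by (rule card_mono[OF column_bound(1)[OF f h]]) (auto simp: E_def S_def)
      then have "card {g \<in> E. h \<in> S g} \<le> n" using column_bound(2)[OF f h] by simp
      then show "(\<Sum>g\<in>{g \<in> E. h \<in> S g}. (cmod (ell2_apply \<xi> h))\<^sup>2) \<le> real n * (cmod (ell2_apply \<xi> h))\<^sup>2"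
        by (simp add: mult_right_mono)
    qed
    also have "\<dots> \<le> real n * (norm \<xi>)\<^sup>2"
      unfolding sum_distrib_left[symmetric] by (intro mult_left_mono ell2_finite_sum_le H) simp
    finally have "C\<^sup>2 * real n * (\<Sum>g\<in>E. \<Sum>h\<in>S g. (cmod (ell2_apply \<xi> h))\<^sup>2) \<le> C\<^sup>2 * real n * (real n * (norm \<xi>)\<^sup>2)"
      by (rule mult_left_mono) simp
    with outer show ?thesis by (simp add: power_mult_distrib power2_eq_square mult_ac)
  qed
  have rep: "regular_rep G f = Blinfun (\<lambda>\<xi>. Abs_ell2 (conv G f (ell2_apply \<xi>)))"
    unfolding regular_rep_def conv_def ..
  have off: "conv G f k g = 0" if "g \<notin> arrows G" for k g using that by (simp add: conv_def)
  have lin1: "conv G f (ell2_apply (\<xi> + \<eta>)) g = conv G f (ell2_apply \<xi>) g + conv G f (ell2_apply \<eta>) g"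
    for \<xi> \<eta> :: "'a ell2" and g
    by (cases "g \<in> arrows G") (simp_all add: cv off sum.distrib distrib_left)
  have lin2: "conv G f (ell2_apply (r *\<^sub>R \<xi>)) g = r *\<^sub>R conv G f (ell2_apply \<xi>) g" for \<xi> :: "'a ell2" and r g
    by (cases "g \<in> arrows G") (simp_all add: cv off scaleR_sum_right)
  show "ell2_apply (regular_rep G f \<xi>) = conv G f (ell2_apply \<xi>)"
    unfolding rep by (rule ell2_operator(1)[OF lin1 lin2 bound]) (use C in auto)
  show "norm (regular_rep G f) \<le> real n * C"
    unfolding rep by (rule ell2_operator(2)[OF lin1 lin2 bound]) (use C in auto)
qed

lemma regular_rep_apply: "fibre_finite G f \<Longrightarrow> ell2_apply (regular_rep G f \<xi>) = conv G f (ell2_apply \<xi>)"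
  using regular_rep_bound(1) fibre_finite_def by blast

lemma regular_rep_single:
  assumes "fibre_finite G f"
  shows "ell2_apply (regular_rep G f (single x c)) g =
    (if g \<in> arrows G \<and> x \<in> arrows G \<and> dmn G g = dmn G x then f (quo g x) * c else 0)"
proof (cases "g \<in> arrows G \<and> x \<in> arrows G \<and> dmn G g = dmn G x")
  case True
  then have "conv G f (ell2_apply (single x c)) g = (\<Sum>\<^sub>\<infinity>h\<in>{x}. f (quo g h) * ell2_apply (single x c) h)"
    unfolding conv_def by (simp only: if_True) (rule infsum_cong_neutral, auto simp: ell2_apply_single)
  then show ?thesis using True by (simp add: regular_rep_apply[OF assms] ell2_apply_single)
next
  case False
  then have "conv G f (ell2_apply (single x c)) g = 0"
    unfolding conv_def by (auto intro!: infsum_0 simp: ell2_apply_single)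
  then show ?thesis using False by (auto simp: regular_rep_apply[OF assms])
qed

lemma regular_rep_add:
  assumes "fibre_finite G f" "fibre_finite G f'"
  shows "regular_rep G (\<lambda>k. f k + f' k) = regular_rep G f + regular_rep G f'"
  by (intro op_eqI_singles ell2_eqI)
    (simp add: blinfun.add_left regular_rep_single assms fibre_finite_add algebra_simps)

lemma fibre_finite_scale:
  assumes "fibre_finite G f" shows "fibre_finite G (\<lambda>k. c * f k)"
proof -
  obtain n C where f: "fibre_bounded G f n C" using assms fibre_finite_def by blast
  have "fibre_bounded G (\<lambda>k. c * f k) n (cmod c * C)"
  proof (cases "c = 0")
    case True then show ?thesis unfolding fibre_bounded_def by auto
  next
    case False then show ?thesis using f unfolding fibre_bounded_def by (auto simp: norm_mult mult_left_mono)
  qed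
  then show ?thesis using fibre_finite_def by blast
qed

lemma regular_rep_scale:
  assumes "fibre_finite G f" shows "regular_rep G (\<lambda>k. c * f k) = scaleC_op c (regular_rep G f)"
  by (intro op_eqI_singles ell2_eqI) (simp add: regular_rep_single assms fibre_finite_scale)

lemma regular_rep_zero: "regular_rep G (\<lambda>_. 0) = 0"
proof -
  have "fibre_finite G (\<lambda>_. 0)" unfolding fibre_finite_def fibre_bounded_def by (auto intro!: exI[of _ 0])
  then show ?thesis by (intro op_eqI_singles ell2_eqI) (simp add: regular_rep_single)
qed

text \<open>On one-point vectors the identity is the substitution \<open>p = h x\<^sup>-\<^sup>1\<close> in the convolution sum. That \<open>f * k\<close>
  is again fibre-finite is clear only for continuous functions, hence the last hypothesis.\<close>

lemma regular_rep_mult: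
  assumes "fibre_finite G f" "fibre_finite G k" "fibre_finite G (conv G f k)"
  shows "regular_rep G f o\<^sub>L regular_rep G k = regular_rep G (conv G f k)"
proof (intro op_eqI_singles ell2_eqI)
  fix x c g
  let ?K = "ell2_apply (regular_rep G k (single x c))"
  have lhs: "ell2_apply ((regular_rep G f o\<^sub>L regular_rep G k) (single x c)) g = conv G f ?K g"
    by (simp add: regular_rep_apply assms)
  show "ell2_apply ((regular_rep G f o\<^sub>L regular_rep G k) (single x c)) g =
    ell2_apply (regular_rep G (conv G f k) (single x c)) g"
  proof (cases "g \<in> arrows G \<and> x \<in> arrows G \<and> dmn G g = dmn G x")
    case True
    have bij: "bij_betw (\<lambda>h. quo h x) {h \<in> arrows G. dmn G h = dmn G g} {p \<in> arrows G. dmn G p = dmn G (quo g x)}"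
      by (rule bij_betw_byWitness[where f' = "\<lambda>p. mul G p x"])
        (use True in \<open>auto simp: quo quo_mul_cancel mul_quo_cancel mul_arrow dmn_mul\<close>)
    have "conv G f ?K g = (\<Sum>\<^sub>\<infinity>h\<in>{h \<in> arrows G. dmn G h = dmn G g}. f (quo g h) * ?K h)"
      using True by (simp add: conv_def)
    also have "\<dots> = (\<Sum>\<^sub>\<infinity>h\<in>{h \<in> arrows G. dmn G h = dmn G g}. f (quo (quo g x) (quo h x)) * k (quo h x) * c)"
      using True by (intro infsum_cong) (auto simp: regular_rep_single assms quo_quo)
    also have "\<dots> = (\<Sum>\<^sub>\<infinity>p\<in>{p \<in> arrows G. dmn G p = dmn G (quo g x)}. f (quo (quo g x) p) * k p * c)"
      by (rule infsum_reindex_bij_betw[OF bij])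
    also have "\<dots> = conv G f k (quo g x) * c"
      using True by (simp add: conv_def quo infsum_cmult_left')
    finally show ?thesis using True lhs by (simp add: regular_rep_single assms)
  next
    case False
    then have "conv G f ?K g = 0"
      unfolding conv_def by (auto intro!: infsum_0 simp: regular_rep_single assms)
    then show ?thesis using False lhs by (auto simp: regular_rep_single assms)
  qed
qed

lemma fibre_finite_star:
  assumes "fibre_finite G f" shows "fibre_finite G (star G f)"
proof -
  obtain n C where f: "fibre_bounded G f n C" using assms fibre_finite_def by blast
  have C: "0 \<le> C" using f norm_ge_zero order_trans unfolding fibre_bounded_def by blast
  have inj: "inj_on (inverse_arrow G) A" if "A \<subseteq> arrows G" for A
    by (rule inj_onI) (metis inv_inv subsetD that)
  have r: "{k \<in> arrows G. star G f k \<noteq> 0 \<and> rng G k = x} = inverse_arrow G ` {k \<in> arrows G. f k \<noteq> 0 \<and> dmn G k = x}" for x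
  proof (intro equalityI subsetI)
    fix k assume "k \<in> {k \<in> arrows G. star G f k \<noteq> 0 \<and> rng G k = x}"
    then show "k \<in> inverse_arrow G ` {k \<in> arrows G. f k \<noteq> 0 \<and> dmn G k = x}"
      by (intro image_eqI[of _ _ "inverse_arrow G k"]) (auto simp: star_def inv_in rng_inv dmn_inv inv_inv)
  qed (auto simp: star_def inv_in rng_inv dmn_inv inv_inv)
  have d: "{k \<in> arrows G. star G f k \<noteq> 0 \<and> dmn G k = x} = inverse_arrow G ` {k \<in> arrows G. f k \<noteq> 0 \<and> rng G k = x}" for x
  proof (intro equalityI subsetI)
    fix k assume "k \<in> {k \<in> arrows G. star G f k \<noteq> 0 \<and> dmn G k = x}"
    then show "k \<in> inverse_arrow G ` {k \<in> arrows G. f k \<noteq> 0 \<and> rng G k = x}"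
      by (intro image_eqI[of _ _ "inverse_arrow G k"]) (auto simp: star_def inv_in rng_inv dmn_inv inv_inv)
  qed (auto simp: star_def inv_in rng_inv dmn_inv inv_inv)
  have "card (inverse_arrow G ` {k \<in> arrows G. f k \<noteq> 0 \<and> p k = x}) = card {k \<in> arrows G. f k \<noteq> 0 \<and> p k = x}" for p :: "'a \<Rightarrow> 'a" and x
    by (rule card_image) (rule inj, auto)
  then have "fibre_bounded G (star G f) n C"
    unfolding fibre_bounded_def r d using f C unfolding fibre_bounded_def by (auto simp: star_def)
  then show ?thesis using fibre_finite_def by blast
qed

lemma inner_cmult_left: "(z * c) \<bullet> b = c \<bullet> (cnj z * b)" for z c b :: complex
  by (simp add: inner_complex_def algebra_simps)

lemma adjoint_regular_rep:
  assumes "fibre_finite G f" shows "adjoint_op (regular_rep G f) (regular_rep G (star G f))"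
proof -
  have 1: "regular_rep G f (single x c) \<bullet> single y b = single x c \<bullet> regular_rep G (star G f) (single y b)" for x y b c
  proof -
    have "regular_rep G f (single x c) \<bullet> single y b =
        (if y \<in> arrows G \<and> x \<in> arrows G \<and> dmn G y = dmn G x then (f (quo y x) * c) \<bullet> b else 0)"
      by (simp add: inner_single regular_rep_single assms)
    also have "\<dots> = (if y \<in> arrows G \<and> x \<in> arrows G \<and> dmn G y = dmn G x then (star G f (quo x y) * b) \<bullet> c else 0)"
      by (simp add: star_def quo inner_cmult_left inner_commute[of c])
    also have "\<dots> = regular_rep G (star G f) (single y b) \<bullet> single x c"
      by (auto simp: inner_single regular_rep_single assms fibre_finite_star)
    finally show ?thesis by (simp add: inner_commute)
  qed
  have 2: "regular_rep G f \<xi> \<bullet> single y b = \<xi> \<bullet> regular_rep G (star G f) (single y b)" for \<xi> y b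
    by (rule bounded_linear_eq_on_singles[where f = "\<lambda>\<xi>. regular_rep G f \<xi> \<bullet> single y b"])
      (use 1 in \<open>auto intro!: bounded_linear_intros\<close>)
  have "regular_rep G f \<xi> \<bullet> \<eta> = \<xi> \<bullet> regular_rep G (star G f) \<eta>" for \<xi> \<eta>
    by (rule bounded_linear_eq_on_singles[where f = "\<lambda>\<eta>. regular_rep G f \<xi> \<bullet> \<eta>"])
      (use 2 in \<open>auto intro!: bounded_linear_intros\<close>)
  then show ?thesis by (simp add: adjoint_op_def)
qed

end

lemma restrict_zero_apply: "restrict_zero S f k = (if k \<in> S then f k else 0)"
  by (simp add: restrict_zero_def)

lemma arrows_reduction [simp]: "arrows (reduction G D) = reduction_arrows G D"
  by (auto simp: reduction_def reduction_arrows_def)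

lemma mul_reduction [simp]: "mul (reduction G D) = mul G"
  by (simp add: reduction_def)

lemma inverse_arrow_reduction [simp]: "inverse_arrow (reduction G D) = inverse_arrow G"
  by (simp add: reduction_def)

lemma dmn_reduction [simp]: "dmn (reduction G D) = dmn G"
  by (simp add: dmn_def fun_eq_iff)

lemma rng_reduction [simp]: "rng (reduction G D) = rng G"
  by (simp add: rng_def fun_eq_iff)

lemma reduction_arrows_sub: "reduction_arrows G D \<subseteq> arrows G"
  by (auto simp: reduction_arrows_def)

context algebraic_groupoid
begin

lemma invariant_rng_iff: "invariant G D \<Longrightarrow> g \<in> arrows G \<Longrightarrow> rng G g \<in> D \<longleftrightarrow> dmn G g \<in> D"
  unfolding invariant_def by (metis dmn_inv inv_in rng_inv)

lemma invariant_complement: "invariant G D \<Longrightarrow> invariant G (units G - D)"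
  using invariant_rng_iff rng_units unfolding invariant_def by blast

lemma reduction_arrows_mul:
  "invariant G D \<Longrightarrow> g \<in> arrows G \<Longrightarrow> h \<in> arrows G \<Longrightarrow> dmn G g = rng G h \<Longrightarrow>
    mul G g h \<in> reduction_arrows G D \<longleftrightarrow> h \<in> reduction_arrows G D"
  by (auto simp: reduction_arrows_def mul_arrow dmn_mul)

lemma algebraic_groupoid_reduction:
  assumes D: "invariant G D" shows "algebraic_groupoid (reduction G D)"
proof
  have comp: "(g, h) \<in> composable (reduction G D) \<longleftrightarrow>
      g \<in> reduction_arrows G D \<and> h \<in> reduction_arrows G D \<and> (g, h) \<in> composable G" for g h
    by (auto simp: reduction_def)
  have inv: "inverse_arrow G g \<in> reduction_arrows G D" if "g \<in> reduction_arrows G D" for g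
    using that invariant_rng_iff[OF D] by (auto simp: reduction_arrows_def inv_in dmn_inv)
  have mul: "mul G g h \<in> reduction_arrows G D"
    if "g \<in> reduction_arrows G D" "h \<in> reduction_arrows G D" "(g, h) \<in> composable G" for g h
    using that reduction_arrows_mul[OF D] by (auto simp: composable_iff)
  have arr: "g \<in> arrows G" if "g \<in> reduction_arrows G D" for g using that by (simp add: reduction_arrows_def)
  show "composable (reduction G D) \<subseteq> arrows (reduction G D) \<times> arrows (reduction G D)"
    by (auto simp: comp)
  fix g h k
  show "mul (reduction G D) g h \<in> arrows (reduction G D)" if "(g, h) \<in> composable (reduction G D)"
    using that mul by (simp add: comp)
  show "inverse_arrow (reduction G D) g \<in> arrows (reduction G D)" if "g \<in> arrows (reduction G D)"
    using that inv by simp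
  show "inverse_arrow (reduction G D) (inverse_arrow (reduction G D) g) = g" if "g \<in> arrows (reduction G D)"
    using that arr inv_inv by simp
  show "(inverse_arrow (reduction G D) g, g) \<in> composable (reduction G D)" if "g \<in> arrows (reduction G D)"
    using that arr inv inv_composable by (simp add: comp)
  show "(mul (reduction G D) g h, k) \<in> composable (reduction G D) \<and> (g, mul (reduction G D) h k) \<in> composable (reduction G D) \<and>
      mul (reduction G D) (mul (reduction G D) g h) k = mul (reduction G D) g (mul (reduction G D) h k)"
    if "(g, h) \<in> composable (reduction G D)" "(h, k) \<in> composable (reduction G D)"
    using that mul mul_assoc by (simp add: comp)
  show "mul (reduction G D) (inverse_arrow (reduction G D) g) (mul (reduction G D) g h) = h"
    if "(g, h) \<in> composable (reduction G D)"
    using that inv_mul_cancel by (simp add: comp)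
  show "mul (reduction G D) (mul (reduction G D) h g) (inverse_arrow (reduction G D) g) = h"
    if "(h, g) \<in> composable (reduction G D)"
    using that mul_inv_cancel by (simp add: comp)
qed

lemma units_reduction:
  assumes "invariant G D" shows "units (reduction G D) = D"
proof -
  have "D \<subseteq> units G" using assms by (simp add: invariant_def)
  then show ?thesis
    unfolding units_def[of "reduction G D"] using unitsD by (force simp: reduction_arrows_def image_iff)
qed

lemma fibre_finite_restrict:
  assumes "fibre_finite G f" shows "fibre_finite (reduction G D) (restrict_zero S f)"
  by (rule fibre_finite_mono[OF assms]) (auto simp: restrict_zero_def reduction_arrows_def)

text \<open>The non-zero matrix entries of a convolution operator join arrows with the same source, so discarding the
  rows outside \<open>G\<^sub>D\<close> discards the columns outside \<open>G\<^sub>D\<close>, too.\<close>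

lemma regular_rep_restrict:
  assumes D: "invariant G D" and f: "fibre_finite G f"
  shows "regular_rep (reduction G D) (restrict_zero (reduction_arrows G D) f) =
    proj (reduction_arrows G D) o\<^sub>L regular_rep G f"
proof -
  interpret R: algebraic_groupoid "reduction G D" by (rule algebraic_groupoid_reduction[OF D])
  have mem: "g \<in> reduction_arrows G D \<longleftrightarrow> g \<in> arrows G \<and> dmn G g \<in> D" for g
    by (simp add: reduction_arrows_def)
  have "ell2_apply (regular_rep (reduction G D) (restrict_zero (reduction_arrows G D) f) (single x c)) g =
      ell2_apply ((proj (reduction_arrows G D) o\<^sub>L regular_rep G f) (single x c)) g" for x c g
    using invariant_rng_iff[OF D, of x]
    by (auto simp: R.regular_rep_single[OF fibre_finite_restrict[OF f]] regular_rep_single[OF f]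
        restrict_zero_apply mem quo)
  then show ?thesis by (intro op_eqI_singles ell2_eqI)
qed

lemma regular_rep_reduction_supported:
  assumes D: "invariant G D" and f: "fibre_finite G f" "\<And>g. g \<notin> reduction_arrows G D \<Longrightarrow> f g = 0"
  shows "regular_rep (reduction G D) f = regular_rep G f"
proof -
  have "restrict_zero (reduction_arrows G D) f = f" using f(2) by (auto simp: restrict_zero_def)
  moreover have "proj (reduction_arrows G D) o\<^sub>L regular_rep G f = regular_rep G f"
    using invariant_rng_iff[OF D] f(2)
    by (intro op_eqI_singles ell2_eqI)
      (auto simp: regular_rep_single f(1) reduction_arrows_def quo)
  ultimately show ?thesis using regular_rep_restrict[OF D f(1)] by simp
qed

lemma proj_commutes_regular_rep:
  assumes "fibre_finite G f"
  shows "proj (reduction_arrows G D) o\<^sub>L regular_rep G f = regular_rep G f o\<^sub>L proj (reduction_arrows G D)"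
  by (intro op_eqI_singles ell2_eqI)
    (auto simp: regular_rep_single assms reduction_arrows_def restrict_single)

lemma fibre_bounded_unit_function:
  assumes "\<And>x. cmod (f x) \<le> C" "\<And>x. x \<notin> units G \<Longrightarrow> f x = 0" shows "fibre_bounded G f 1 C"
proof -
  have "{k \<in> arrows G. f k \<noteq> 0 \<and> p k = x} \<subseteq> {x}" if "\<And>u. u \<in> units G \<Longrightarrow> p u = u" for p :: "'a \<Rightarrow> 'a" and x
    using assms(2) that by force
  from this[THEN finite_subset] this[THEN card_mono[rotated]] show ?thesis
    unfolding fibre_bounded_def using assms(1) unitsD by (simp add: )
qed

text \<open>Functions on the units act by multiplication, because \<open>g h\<^sup>-\<^sup>1\<close> is a unit only for \<open>g = h\<close>.\<close>

lemma regular_rep_unit_function: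
  assumes "fibre_finite G f" "\<And>x. x \<notin> units G \<Longrightarrow> f x = 0"
  shows "ell2_apply (regular_rep G f (single x c)) y = (if y = x \<and> x \<in> arrows G then f (rng G x) * c else 0)"
  using assms(2) quo_unit_imp_eq by (auto simp: regular_rep_single[OF assms(1)] quo_self)

lemma conv_unit_function_left:
  assumes "\<And>x. x \<notin> units G \<Longrightarrow> f x = 0"
  shows "conv G f k g = (if g \<in> arrows G then f (rng G g) * k g else 0)"
proof (cases "g \<in> arrows G")
  case True
  then have "conv G f k g = (\<Sum>\<^sub>\<infinity>h\<in>{g}. f (quo g h) * k h)"
    unfolding conv_def using assms quo_unit_imp_eq True
    by (simp only: if_True) (rule infsum_cong_neutral, force+)
  then show ?thesis using True by (simp add: quo_self)
qed (simp add: conv_def)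

lemma regular_rep_unit_mult:
  assumes f: "fibre_finite G f" "\<And>x. x \<notin> units G \<Longrightarrow> f x = 0" and k: "fibre_finite G k"
    and m: "\<And>g. m g = (if g \<in> arrows G then f (rng G g) * k g else 0)" and "fibre_finite G m"
  shows "regular_rep G f o\<^sub>L regular_rep G k = regular_rep G m"
proof -
  have "conv G f k = m" using conv_unit_function_left[OF f(2)] m by auto
  then show ?thesis using regular_rep_mult[OF f(1) k] assms(5) by simp
qed

text \<open>Conjugation by a function \<open>\<phi>\<close> carried by a bisection moves a function on the units along the
  bisection, from sources to ranges; this makes the support of \<open>I \<inter> C\<^sub>0(G\<^sup>(\<^sup>0\<^sup>))\<close> invariant for an ideal \<open>I\<close>.\<close>

context
  fixes f \<phi> :: "'a \<Rightarrow> complex" and B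
  assumes f: "\<And>x. x \<notin> units G \<Longrightarrow> f x = 0"
    and \<phi>: "\<And>x. x \<notin> B \<Longrightarrow> \<phi> x = 0" and B: "B \<subseteq> arrows G" "inj_on (dmn G) B" "inj_on (rng G) B"
begin

lemma conjugate_summand:
  assumes "g \<in> arrows G"
  shows "conv G \<phi> (conv G f (star G \<phi>)) g =
    (\<Sum>\<^sub>\<infinity>h\<in>{h \<in> arrows G. dmn G h = dmn G g}. \<phi> (quo g h) * (f (rng G h) * cnj (\<phi> (inverse_arrow G h))))"
  unfolding conv_def[of G \<phi>] using assms
  by (auto simp: conv_unit_function_left f star_def intro!: infsum_cong)

lemma conjugate_off_units: "g \<notin> units G \<Longrightarrow> conv G \<phi> (conv G f (star G \<phi>)) g = 0"
proof (cases "g \<in> arrows G")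
  case True
  assume g: "g \<notin> units G"
  have "\<phi> (quo g h) * (f (rng G h) * cnj (\<phi> (inverse_arrow G h))) = 0"
    if h: "h \<in> arrows G" "dmn G h = dmn G g" for h
  proof (rule ccontr)
    assume "\<not> ?thesis"
    then have "quo g h \<in> B" "inverse_arrow G h \<in> B" using \<phi> by auto
    moreover have "dmn G (quo g h) = dmn G (inverse_arrow G h)" using h True by (simp add: quo dmn_inv)
    ultimately have "quo g h = inverse_arrow G h" using B(2) by (auto dest: inj_onD)
    then have "g = dmn G h" using quo_mul_cancel[of g h] h True by (simp add: dmn_def)
    then show False using g h dmn_units by blast
  qed
  then show ?thesis unfolding conjugate_summand[OF True] by (intro infsum_0) blast
qed (simp add: conv_def)

lemma conjugate_at_range:
  assumes g: "g \<in> B"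
  shows "conv G \<phi> (conv G f (star G \<phi>)) (rng G g) = (\<phi> g * cnj (\<phi> g)) * f (dmn G g)"
proof -
  have ga: "g \<in> arrows G" using g B by blast
  let ?u = "rng G g"
  have u: "?u \<in> units G" "?u \<in> arrows G" "dmn G ?u = ?u" using rng_units[OF ga] unitsD by auto
  have quo_u: "quo ?u h = inverse_arrow G h" if "h \<in> arrows G" "dmn G h = ?u" for h
    using that by (intro unit_mul) (auto simp: u inv_in rng_inv)
  have "conv G \<phi> (conv G f (star G \<phi>)) ?u =
      (\<Sum>\<^sub>\<infinity>h\<in>{inverse_arrow G g}. \<phi> (quo ?u h) * (f (rng G h) * cnj (\<phi> (inverse_arrow G h))))"
    unfolding conjugate_summand[OF u(2)]
  proof (rule infsum_cong_neutral)
    fix h assume "h \<in> {h \<in> arrows G. dmn G h = dmn G ?u} - {inverse_arrow G g}"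
    then have h: "h \<in> arrows G" "dmn G h = ?u" "h \<noteq> inverse_arrow G g" using u by auto
    then have "inverse_arrow G h \<noteq> g" using inv_inv by metis
    moreover have "rng G (inverse_arrow G h) = rng G g" using h by (simp add: rng_inv)
    ultimately have "inverse_arrow G h \<notin> B" using B(3) g by (auto dest: inj_onD)
    then show "\<phi> (quo ?u h) * (f (rng G h) * cnj (\<phi> (inverse_arrow G h))) = 0" using \<phi> by simp
  qed (use ga u in \<open>auto simp: inv_in dmn_inv\<close>)
  also have "\<dots> = (\<phi> g * cnj (\<phi> g)) * f (dmn G g)"
    using ga quo_u[of "inverse_arrow G g"] by (simp add: inv_in dmn_inv inv_inv rng_inv mult_ac)
  finally show ?thesis .
qed

end

end

section \<open>Functions with compact support on locally compact Hausdorff spaces\<close>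

lemma continuous_map_iff_tendsto:
  "continuous_map X euclidean f \<longleftrightarrow> (\<forall>x\<in>topspace X. (f \<longlongrightarrow> f x) (atin X x))"
  by (simp add: continuous_map_atin)

locale lch_space =
  fixes X :: "'a topology"
  assumes lc: "locally_compact_space X" and haus: "Hausdorff_space X"
begin

lemma crs: "completely_regular_space X"
  using locally_compact_regular_imp_completely_regular_space lc haus by blast

lemma closedin_compact: "compactin X K \<Longrightarrow> closedin X K"
  using compactin_imp_closedin haus by blast

lemma lch_open: "openin X S \<Longrightarrow> lch_space (subtopology X S)"
  using locally_compact_space_open_subset lc haus Hausdorff_space_subtopology by (unfold_locales) blast+

lemma lch_closed: "closedin X S \<Longrightarrow> lch_space (subtopology X S)"
  using locally_compact_space_closed_subset lc haus Hausdorff_space_subtopology by (unfold_locales) blast+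

lemma tendsto_zero_off:
  assumes "closedin X K" "\<And>x. x \<notin> K \<Longrightarrow> f x = (0::complex)" "x \<in> topspace X" "x \<notin> K"
  shows "(f \<longlongrightarrow> 0) (atin X x)"
proof (rule tendsto_eventually)
  show "\<forall>\<^sub>F y in atin X x. f y = 0"
    unfolding eventually_atin
    by (rule disjI2, rule exI[of _ "topspace X - K"]) (use assms in \<open>auto intro: openin_diff\<close>)
qed

lemma Cc_iff:
  "f \<in> Cc X \<longleftrightarrow> continuous_map X euclidean f \<and> (\<exists>K. compactin X K \<and> (\<forall>x. x \<notin> K \<longrightarrow> f x = 0))"
proof
  assume f: "f \<in> Cc X"
  let ?K = "X closure_of {x \<in> topspace X. f x \<noteq> 0}"
  have "f x = 0" if "x \<notin> ?K" for x
    using f that closure_of_subset[of "{x \<in> topspace X. f x \<noteq> 0}" X] unfolding Cc_def by blast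
  then show "continuous_map X euclidean f \<and> (\<exists>K. compactin X K \<and> (\<forall>x. x \<notin> K \<longrightarrow> f x = 0))"
    using f unfolding Cc_def by blast
next
  assume "continuous_map X euclidean f \<and> (\<exists>K. compactin X K \<and> (\<forall>x. x \<notin> K \<longrightarrow> f x = 0))"
  then obtain K where K: "continuous_map X euclidean f" "compactin X K" "\<And>x. x \<notin> K \<Longrightarrow> f x = 0" by blast
  have "X closure_of {x \<in> topspace X. f x \<noteq> 0} \<subseteq> K"
    by (rule closure_of_minimal) (use K closedin_compact in auto)
  then have "compactin X (X closure_of {x \<in> topspace X. f x \<noteq> 0})"
    by (rule closed_compactin[OF K(2)]) simp
  then show "f \<in> Cc X" using K compactin_subset_topspace[OF K(2)] unfolding Cc_def by blast
qed

lemma CcI: "continuous_map X euclidean f \<Longrightarrow> compactin X K \<Longrightarrow> (\<And>x. x \<notin> K \<Longrightarrow> f x = 0) \<Longrightarrow> f \<in> Cc X"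
  using Cc_iff by blast

lemma CcE:
  assumes "f \<in> Cc X"
  obtains K where "continuous_map X euclidean f" "compactin X K" "K \<subseteq> topspace X" "\<And>x. x \<notin> K \<Longrightarrow> f x = 0"
  using assms Cc_iff compactin_subset_topspace by metis

text \<open>Extension by zero from an open subset stays continuous, as the support is closed in the whole space.\<close>

lemma Cc_open_iff:
  assumes S: "openin X S"
  shows "f \<in> Cc (subtopology X S) \<longleftrightarrow>
    continuous_map X euclidean f \<and> (\<exists>K. compactin X K \<and> K \<subseteq> S \<and> (\<forall>x. x \<notin> K \<longrightarrow> f x = 0))"
proof -
  interpret S: lch_space "subtopology X S" by (rule lch_open[OF S])
  have "continuous_map X euclidean f"
    if f: "continuous_map (subtopology X S) euclidean f" and K: "compactin X K" "K \<subseteq> S" "\<And>x. x \<notin> K \<Longrightarrow> f x = 0" for K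
  proof (rule pasting_lemma[where I = "{S, topspace X - K}" and T = id and f = "\<lambda>_. f"])
    fix i assume i: "i \<in> {S, topspace X - K}"
    show "openin X (id i)" using i S closedin_compact[OF K(1)] by (auto intro: openin_diff)
    show "continuous_map (subtopology X (id i)) euclidean f"
    proof (cases "i = S")
      case False
      show ?thesis by (rule continuous_map_eq[of _ _ "\<lambda>_. 0"]) (use False i K(3) in auto)
    qed (use f in simp)
  qed (use K(2) in auto)
  then show ?thesis
    unfolding S.Cc_iff compactin_subtopology using continuous_map_from_subtopology by metis
qed

lemma Cc_restrict_closed:
  assumes S: "closedin X S" and f: "f \<in> Cc X"
  shows "restrict_zero S f \<in> Cc (subtopology X S)"
proof -
  interpret S: lch_space "subtopology X S" by (rule lch_closed[OF S])
  obtain K where K: "continuous_map X euclidean f" "compactin X K" "\<And>x. x \<notin> K \<Longrightarrow> f x = 0" using CcE[OF f] by metis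
  show ?thesis
  proof (rule S.CcI)
    show "continuous_map (subtopology X S) euclidean (restrict_zero S f)"
      by (rule continuous_map_eq[OF continuous_map_from_subtopology[OF K(1)]]) (simp add: restrict_zero_apply)
    show "compactin (subtopology X S) (K \<inter> S)"
      using K(2) S by (simp add: compactin_subtopology compact_Int_closedin)
  qed (use K in \<open>auto simp: restrict_zero_apply\<close>)
qed

lemma bump:
  assumes K: "compactin X K" and V: "openin X V" "K \<subseteq> V"
  obtains \<psi> :: "'a \<Rightarrow> real" and L where "continuous_map X euclideanreal \<psi>" "compactin X L" "L \<subseteq> V"
    "\<And>x. x \<notin> L \<Longrightarrow> \<psi> x = 0" "\<And>x. x \<in> K \<Longrightarrow> \<psi> x = 1" "\<And>x. 0 \<le> \<psi> x" "\<And>x. \<psi> x \<le> 1"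
proof -
  obtain U M where U: "openin X U" "compactin X M" "K \<subseteq> U" "U \<subseteq> M"
    using locally_compact_space_compact_closed_compact[of X] lc haus K by metis
  have "closedin X (topspace X - U \<inter> V)" using U V by (intro closedin_diff) auto
  moreover have "disjnt K (topspace X - U \<inter> V)" using U V by (auto simp: disjnt_def)
  ultimately obtain f where f: "continuous_map X (subtopology euclidean {0..1::real}) f"
      "f ` (topspace X - U \<inter> V) \<subseteq> {0}" "f ` K \<subseteq> {1}"
    using Urysohn_completely_regular_compact_closed[of 0 1, OF _ crs K] by auto
  have fc: "continuous_map X euclideanreal f" using f(1) continuous_map_in_subtopology by blast
  have f1: "f x \<le> 1" if "x \<in> topspace X" for x
    using f(1) that by (auto simp: continuous_map_in_subtopology Pi_iff)
  \<comment> \<open>the set where \<open>f \<noteq> 0\<close> lies in \<open>V\<close>, but its closure need not; cutting off at \<open>1/2\<close> leaves a closed set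
    inside \<open>V\<close>\<close>
  define \<psi> where "\<psi> x = (if x \<in> topspace X then max 0 (2 * f x - 1) else 0)" for x
  define L where "L = {x \<in> topspace X. f x \<in> {1/2..}}"
  have LU: "L \<subseteq> U \<inter> V" using f(2) by (fastforce simp: L_def)
  show ?thesis
  proof
    have "continuous_map X euclideanreal (\<lambda>x. max 0 (2 * f x - 1))"
      by (intro continuous_intros fc)
    then show "continuous_map X euclideanreal \<psi>" by (rule continuous_map_eq) (simp add: \<psi>_def)
    have "closedin X L" unfolding L_def by (rule closedin_continuous_map_preimage[OF fc]) simp
    then show "compactin X L" using closed_compactin[OF U(2)] LU U(4) by blast
    show "L \<subseteq> V" using LU by blast
    show "\<psi> x = 0" if "x \<notin> L" for x using that by (auto simp: \<psi>_def L_def)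
    show "\<psi> x = 1" if "x \<in> K" for x
      using that f(3) compactin_subset_topspace[OF K] by (auto simp: \<psi>_def)
    show "0 \<le> \<psi> x" "\<psi> x \<le> 1" for x using f1[of x] by (auto simp: \<psi>_def)
  qed
qed

lemma Cc_zero: "(\<lambda>_. 0) \<in> Cc X"
  by (rule CcI[of _ "{}"]) auto

lemma Cc_add: assumes "f \<in> Cc X" "g \<in> Cc X" shows "(\<lambda>x. f x + g x) \<in> Cc X"
proof -
  obtain K where K: "continuous_map X euclidean f" "compactin X K" "\<And>x. x \<notin> K \<Longrightarrow> f x = 0" using CcE[OF assms(1)] by metis
  obtain L where L: "continuous_map X euclidean g" "compactin X L" "\<And>x. x \<notin> L \<Longrightarrow> g x = 0" using CcE[OF assms(2)] by metis
  show ?thesis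
    by (rule CcI[of _ "K \<union> L"])
      (use K L in \<open>auto simp: continuous_map_iff_tendsto compactin_Un intro!: tendsto_add\<close>)
qed

lemma Cc_mult:
  assumes "continuous_map X euclidean g" "f \<in> Cc X" shows "(\<lambda>x. g x * f x) \<in> Cc X"
proof -
  obtain K where K: "continuous_map X euclidean f" "compactin X K" "\<And>x. x \<notin> K \<Longrightarrow> f x = 0" using CcE[OF assms(2)] by metis
  show ?thesis
    by (rule CcI[of _ K]) (use K assms(1) in \<open>auto simp: continuous_map_iff_tendsto intro!: tendsto_mult\<close>)
qed

lemma Cc_scale: "f \<in> Cc X \<Longrightarrow> (\<lambda>x. c * f x) \<in> Cc X"
  by (rule Cc_mult) auto

lemma Cc_divide:
  assumes f: "f \<in> Cc X" "compactin X K" "\<And>x. x \<notin> K \<Longrightarrow> f x = 0"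
    and g: "continuous_map X euclidean g" "\<And>x. x \<in> K \<Longrightarrow> g x \<noteq> 0"
  shows "(\<lambda>x. f x / g x) \<in> Cc X"
proof (rule CcI[of _ K])
  have fc: "continuous_map X euclidean f" using CcE[OF f(1)] by metis
  show "continuous_map X euclidean (\<lambda>x. f x / g x)"
    unfolding continuous_map_iff_tendsto
  proof
    fix x assume x: "x \<in> topspace X"
    show "((\<lambda>x. f x / g x) \<longlongrightarrow> f x / g x) (atin X x)"
    proof (cases "g x = 0")
      case True
      then show ?thesis
        using tendsto_zero_off[of K "\<lambda>x. f x / g x" x] closedin_compact[OF f(2)] f(3) g(2) x by auto
    qed (use fc g(1) x in \<open>auto simp: continuous_map_iff_tendsto intro!: tendsto_divide\<close>)
  qed
qed (use f in auto)

lemma continuous_map_of_real: "continuous_map X euclideanreal \<psi> \<Longrightarrow> continuous_map X euclidean (\<lambda>x. complex_of_real (\<psi> x))"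
  by (auto simp: continuous_map_iff_tendsto intro!: tendsto_of_real)

text \<open>A property of compactly supported functions that is stable under addition only has to be checked
  for supports inside the members of an open cover, by a partition of unity on the support.\<close>

lemma Cc_partition_induct:
  assumes f: "f \<in> Cc X" and cover: "\<And>x. x \<in> topspace X \<Longrightarrow> \<exists>B. openin X B \<and> x \<in> B \<and> \<B> B"
    and zero: "P (\<lambda>_. 0)" and add: "\<And>f g. f \<in> Cc X \<Longrightarrow> g \<in> Cc X \<Longrightarrow> P f \<Longrightarrow> P g \<Longrightarrow> P (\<lambda>x. f x + g x)"
    and small: "\<And>f K B. f \<in> Cc X \<Longrightarrow> openin X B \<Longrightarrow> \<B> B \<Longrightarrow> compactin X K \<Longrightarrow> K \<subseteq> B \<Longrightarrow>
      (\<And>x. x \<notin> K \<Longrightarrow> f x = 0) \<Longrightarrow> P f"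
  shows "P f"
proof -
  obtain K where K: "continuous_map X euclidean f" "compactin X K" "K \<subseteq> topspace X" "\<And>x. x \<notin> K \<Longrightarrow> f x = 0"
    using CcE[OF f] by metis
  define Q where "Q x B \<psi> L \<longleftrightarrow> openin X B \<and> \<B> B \<and> continuous_map X euclideanreal \<psi> \<and> compactin X L \<and> L \<subseteq> B \<and>
      (\<forall>y. y \<notin> L \<longrightarrow> \<psi> y = 0) \<and> (\<forall>y. 0 \<le> \<psi> y) \<and> \<psi> x = 1" for x B L and \<psi> :: "'a \<Rightarrow> real"
  have "\<exists>B \<psi> L. Q x B \<psi> L" if x: "x \<in> K" for x
  proof -
    obtain B where B: "openin X B" "x \<in> B" "\<B> B" using cover x K(3) by blast
    have "compactin X {x}" using x K(3) by auto
    then show ?thesis unfolding Q_def using bump[of "{x}" B] B by (metis empty_subsetI insert_subset singletonI)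
  qed
  then obtain B \<psi> L where "\<And>x. x \<in> K \<Longrightarrow> Q x (B x) (\<psi> x) (L x)" by metis
  then have \<psi>: "\<And>x. x \<in> K \<Longrightarrow> openin X (B x)" "\<And>x. x \<in> K \<Longrightarrow> \<B> (B x)"
      "\<And>x. x \<in> K \<Longrightarrow> continuous_map X euclideanreal (\<psi> x)"
      "\<And>x. x \<in> K \<Longrightarrow> compactin X (L x)" "\<And>x. x \<in> K \<Longrightarrow> L x \<subseteq> B x"
      "\<And>x y. x \<in> K \<Longrightarrow> y \<notin> L x \<Longrightarrow> \<psi> x y = 0" "\<And>x y. x \<in> K \<Longrightarrow> 0 \<le> \<psi> x y" "\<And>x. x \<in> K \<Longrightarrow> \<psi> x x = 1"
    unfolding Q_def by blast+
  define W where "W x = {y \<in> topspace X. \<psi> x y \<in> {0<..}}" for x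
  have "\<exists>\<F>. finite \<F> \<and> \<F> \<subseteq> W ` K \<and> K \<subseteq> \<Union>\<F>"
  proof (rule compactinD[OF K(2)])
    show "openin X U" if "U \<in> W ` K" for U
      using that \<psi>(3) unfolding W_def by (auto intro!: openin_continuous_map_preimage[where U = "{0<..}", simplified])
    show "K \<subseteq> \<Union> (W ` K)" using \<psi>(8) K(3) by (force simp: W_def)
  qed
  then obtain A where A: "finite A" "A \<subseteq> K" "K \<subseteq> \<Union> (W ` A)" by (metis finite_subset_image)
  define \<Psi> where "\<Psi> y = complex_of_real (\<Sum>x\<in>A. \<psi> x y)" for y
  have \<Psi>: "continuous_map X euclidean \<Psi>"
    unfolding \<Psi>_def using A \<psi>(3) by (intro continuous_map_of_real continuous_map_sum) auto
  have \<Psi>0: "\<Psi> y \<noteq> 0" if y: "y \<in> K" for y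
  proof -
    obtain x where x: "x \<in> A" "0 < \<psi> x y" using A(3) y by (auto simp: W_def)
    then have "0 < (\<Sum>x\<in>A. \<psi> x y)" using A \<psi>(7) by (intro sum_pos2[OF A(1)]) auto
    then show ?thesis unfolding \<Psi>_def by (metis of_real_eq_0_iff less_irrefl)
  qed
  have q: "(\<lambda>y. f y / \<Psi> y) \<in> Cc X" by (rule Cc_divide[OF f K(2) K(4) \<Psi> \<Psi>0])
  have piece: "(\<lambda>y. complex_of_real (\<psi> x y) * (f y / \<Psi> y)) \<in> Cc X" if "x \<in> K" for x
    using that by (intro Cc_mult q continuous_map_of_real \<psi>)
  have Pp: "P (\<lambda>y. complex_of_real (\<psi> x y) * (f y / \<Psi> y))" if x: "x \<in> K" for x
    by (rule small[OF piece[OF x] \<psi>(1)[OF x] \<psi>(2)[OF x] \<psi>(4)[OF x] \<psi>(5)[OF x]]) (simp add: \<psi>(6)[OF x])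
  have "(\<lambda>y. \<Sum>x\<in>A'. complex_of_real (\<psi> x y) * (f y / \<Psi> y)) \<in> Cc X \<and>
      P (\<lambda>y. \<Sum>x\<in>A'. complex_of_real (\<psi> x y) * (f y / \<Psi> y))" if "finite A'" "A' \<subseteq> A" for A'
    using that
  proof (induction A' rule: finite_induct)
    case empty then show ?case using zero Cc_zero by simp
  next
    case (insert x F)
    then have "x \<in> K" using A(2) by blast
    with insert piece[of x] Pp[of x] show ?case by (simp add: add Cc_add)
  qed
  from this[OF A(1)] have "P (\<lambda>y. \<Sum>x\<in>A. complex_of_real (\<psi> x y) * (f y / \<Psi> y))" by blast
  also have "(\<lambda>y. \<Sum>x\<in>A. complex_of_real (\<psi> x y) * (f y / \<Psi> y)) = f"
  proof
    fix y
    show "(\<Sum>x\<in>A. complex_of_real (\<psi> x y) * (f y / \<Psi> y)) = f y"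
      using \<Psi>0[of y] K(4)[of y] unfolding sum_distrib_right[symmetric] of_real_sum[symmetric] \<Psi>_def[symmetric]
      by (cases "y \<in> K") auto
  qed
  finally show ?thesis .
qed

text \<open>Tietze's theorem extends from a compact neighbourhood of the support within \<open>S\<close>; a bump function on the whole space then
  cuts the extension off.\<close>

lemma Cc_extension:
  assumes S: "closedin X S" and f: "f \<in> Cc (subtopology X S)"
  obtains F where "F \<in> Cc X" "restrict_zero S F = f"
proof -
  interpret S: lch_space "subtopology X S" by (rule lch_closed[OF S])
  obtain K where K: "continuous_map (subtopology X S) euclidean f" "compactin X K" "K \<subseteq> S" "\<And>x. x \<notin> K \<Longrightarrow> f x = 0"
    using S.CcE[OF f] by (metis compactin_subtopology)
  obtain \<psi> :: "'a \<Rightarrow> real" and L where \<psi>: "continuous_map X euclideanreal \<psi>" "compactin X L"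
    "\<And>x. x \<notin> L \<Longrightarrow> \<psi> x = 0" "\<And>x. x \<in> K \<Longrightarrow> \<psi> x = 1"
    using bump[OF K(2) openin_topspace compactin_subset_topspace[OF K(2)]] by metis
  have LS: "compactin X (L \<inter> S)" using \<psi>(2) S by (rule compact_Int_closedin)
  have ext: "\<exists>g. continuous_map X euclideanreal g \<and> (\<forall>x\<in>L \<inter> S. g x = p (f x))"
    if p: "continuous_on UNIV p" for p :: "complex \<Rightarrow> real"
  proof -
    have "continuous_map (subtopology X (L \<inter> S)) euclidean (p \<circ> f)"
    proof (rule continuous_map_compose)
      show "continuous_map (subtopology X (L \<inter> S)) euclidean f"
        using continuous_map_from_subtopology[OF K(1), of L] by (simp add: subtopology_subtopology Int_commute)
    qed (use p in simp)
    from Tietze_extension_completely_regular[OF crs LS _ _ this, of UNIV]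
    obtain g where "continuous_map X euclideanreal g" "\<And>x. x \<in> L \<inter> S \<Longrightarrow> g x = (p \<circ> f) x"
      by (metis is_interval_univ UNIV_not_empty subset_UNIV)
    then show ?thesis by auto
  qed
  obtain u where u: "continuous_map X euclideanreal u" "\<And>x. x \<in> L \<inter> S \<Longrightarrow> u x = Re (f x)"
    using ext[of Re] continuous_on_Re[OF continuous_on_id] by auto
  obtain v where v: "continuous_map X euclideanreal v" "\<And>x. x \<in> L \<inter> S \<Longrightarrow> v x = Im (f x)"
    using ext[of Im] continuous_on_Im[OF continuous_on_id] by auto
  define F where "F x = Complex (u x) (v x) * complex_of_real (\<psi> x)" for x
  show ?thesis
  proof
    show "F \<in> Cc X"
    proof (rule CcI[OF _ \<psi>(2)])
      show "continuous_map X euclidean F"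
        using u(1) v(1) \<psi>(1) unfolding F_def
        by (auto simp: continuous_map_iff_tendsto intro!: tendsto_mult tendsto_Complex tendsto_of_real)
    qed (simp add: F_def \<psi>(3))
    have "restrict_zero S F x = f x" for x
    proof (cases "x \<in> L \<inter> S")
      case True
      then have "Complex (u x) (v x) = f x" using u v by (simp add: complex_eq_iff)
      then show ?thesis using True \<psi>(4)[of x] K(4)[of x] by (cases "x \<in> K") (auto simp: restrict_zero_apply F_def)
    next
      case False
      then have "f x = 0" using K(3) K(4)[of x] \<psi>(3)[of x] \<psi>(4)[of x] by (cases "x \<in> K") auto
      then show ?thesis using False \<psi>(3)[of x] by (auto simp: restrict_zero_apply F_def)
    qed
    then show "restrict_zero S F = f" by blast
  qed
qed

lemma C0_level_closed:
  assumes "continuous_map X euclidean f" shows "closedin X {x \<in> topspace X. e \<le> cmod (f x)}"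
proof -
  have "closedin X {x \<in> topspace X. f x \<in> {z. e \<le> cmod z}}"
    by (rule closedin_continuous_map_preimage[OF assms]) (simp add: closed_Collect_le continuous_on_norm)
  then show ?thesis by simp
qed

lemma Cc_sub_C0: "f \<in> Cc X \<Longrightarrow> f \<in> C0 X"
proof -
  assume "f \<in> Cc X"
  then obtain K where K: "continuous_map X euclidean f" "compactin X K" "K \<subseteq> topspace X" "\<And>x. x \<notin> K \<Longrightarrow> f x = 0"
    using CcE by metis
  have "compactin X {x \<in> topspace X. e \<le> cmod (f x)}" if "0 < e" for e
  proof (rule closed_compactin[OF K(2)])
    show "{x \<in> topspace X. e \<le> cmod (f x)} \<subseteq> K" using K(4) that by force
  qed (rule C0_level_closed[OF K(1)])
  then show "f \<in> C0 X" using K unfolding C0_def by blast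
qed

lemma C0_bounded:
  assumes "f \<in> C0 X" obtains M where "0 \<le> M" "\<And>x. cmod (f x) \<le> M"
proof -
  have f: "continuous_map X euclidean f" "compactin X {x \<in> topspace X. 1 \<le> cmod (f x)}" "\<And>x. x \<notin> topspace X \<Longrightarrow> f x = 0"
    using assms unfolding C0_def by auto
  have "compact (f ` {x \<in> topspace X. 1 \<le> cmod (f x)})"
    using image_compactin[OF f(2,1)] by simp
  then obtain M where M: "\<And>y. y \<in> f ` {x \<in> topspace X. 1 \<le> cmod (f x)} \<Longrightarrow> cmod y \<le> M"
    using compact_imp_bounded bounded_iff by metis
  have "cmod (f x) \<le> max 1 M" for x
    using M[of "f x"] f(3)[of x] by (cases "x \<in> topspace X \<and> 1 \<le> cmod (f x)") force+
  then show ?thesis using that[of "max 1 M"] by simp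
qed

lemma C0_uniform_limit:
  assumes "\<And>e. 0 < e \<Longrightarrow> \<exists>g\<in>C0 X. \<forall>x. cmod (f x - g x) \<le> e"
  shows "f \<in> C0 X"
proof -
  have cont: "continuous_map X euclidean f"
    unfolding continuous_map_iff_tendsto
  proof
    fix x assume x: "x \<in> topspace X"
    show "(f \<longlongrightarrow> f x) (atin X x)"
    proof (rule tendstoI)
      fix e :: real assume "0 < e"
      then obtain g where g: "g \<in> C0 X" "\<And>x. cmod (f x - g x) \<le> e/4" using assms[of "e/4"] by auto
      then have "(g \<longlongrightarrow> g x) (atin X x)" using x unfolding C0_def by (auto simp: continuous_map_iff_tendsto)
      then have "\<forall>\<^sub>F y in atin X x. dist (g y) (g x) < e/4" using \<open>0 < e\<close> by (intro tendstoD) auto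
      then show "\<forall>\<^sub>F y in atin X x. dist (f y) (f x) < e"
      proof (rule eventually_mono)
        fix y assume y: "dist (g y) (g x) < e/4"
        have "dist (f y) (f x) \<le> dist (f y) (g y) + dist (g y) (g x) + dist (g x) (f x)"
          by (meson add_mono dist_triangle order_refl order_trans)
        then show "dist (f y) (f x) < e"
          using g(2)[of x] g(2)[of y] y \<open>0 < e\<close> by (simp add: dist_norm norm_minus_commute)
      qed
    qed
  qed
  have "f x = 0" if "x \<notin> topspace X" for x
  proof (rule ccontr)
    assume "f x \<noteq> 0"
    then obtain g where "g \<in> C0 X" "cmod (f x - g x) \<le> cmod (f x) / 2" using assms[of "cmod (f x) / 2"] by auto
    then show False using that \<open>f x \<noteq> 0\<close> unfolding C0_def by auto
  qed
  moreover have "compactin X {x \<in> topspace X. e \<le> cmod (f x)}" if e: "0 < e" for e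
  proof -
    obtain g where g: "g \<in> C0 X" "\<And>x. cmod (f x - g x) \<le> e/2" using assms[OF half_gt_zero[OF e]] by blast
    have "compactin X {x \<in> topspace X. e/2 \<le> cmod (g x)}" using g(1) half_gt_zero[OF e] unfolding C0_def by blast
    then show ?thesis
    proof (rule closed_compactin)
      have "e / 2 \<le> cmod (g x)" if "e \<le> cmod (f x)" for x
        using g(2)[of x] norm_triangle_ineq2[of "f x" "g x"] that by linarith
      then show "{x \<in> topspace X. e \<le> cmod (f x)} \<subseteq> {x \<in> topspace X. e/2 \<le> cmod (g x)}" by auto
    qed (rule C0_level_closed[OF cont])
  qed
  ultimately show ?thesis using cont unfolding C0_def by blast
qed

lemma C0_approx:
  assumes f: "f \<in> C0 X" and "0 < e"
  obtains g where "g \<in> Cc X" "\<And>x. cmod (f x - g x) \<le> e" "\<And>x. f x = 0 \<Longrightarrow> g x = 0"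
proof -
  have f': "continuous_map X euclidean f" "compactin X {x \<in> topspace X. e \<le> cmod (f x)}" "\<And>x. x \<notin> topspace X \<Longrightarrow> f x = 0"
    using f \<open>0 < e\<close> unfolding C0_def by auto
  obtain \<psi> :: "'a \<Rightarrow> real" and L where \<psi>: "continuous_map X euclideanreal \<psi>" "compactin X L"
      "\<And>x. x \<notin> L \<Longrightarrow> \<psi> x = 0" "\<And>x. x \<in> {x \<in> topspace X. e \<le> cmod (f x)} \<Longrightarrow> \<psi> x = 1" "\<And>x. 0 \<le> \<psi> x" "\<And>x. \<psi> x \<le> 1"
    using bump[OF f'(2) openin_topspace] by (metis (no_types, lifting) mem_Collect_eq subsetI)
  have \<psi>c: "(\<lambda>x. complex_of_real (\<psi> x)) \<in> Cc X"
    by (rule CcI[OF continuous_map_of_real[OF \<psi>(1)] \<psi>(2)]) (simp add: \<psi>(3))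
  show ?thesis
  proof
    show "(\<lambda>x. f x * complex_of_real (\<psi> x)) \<in> Cc X" by (rule Cc_mult[OF f'(1) \<psi>c])
    fix x
    show "cmod (f x - f x * complex_of_real (\<psi> x)) \<le> e"
    proof (cases "x \<in> topspace X \<and> e \<le> cmod (f x)")
      case True then show ?thesis using \<psi>(4)[of x] \<open>0 < e\<close> by simp
    next
      case False
      then have "cmod (f x) \<le> e" using f'(3)[of x] \<open>0 < e\<close> by auto
      moreover have "cmod (f x - f x * complex_of_real (\<psi> x)) = cmod (f x) * \<bar>1 - \<psi> x\<bar>"
      proof -
        have "f x - f x * complex_of_real (\<psi> x) = f x * complex_of_real (1 - \<psi> x)" by (simp add: algebra_simps)
        then show ?thesis by (metis norm_mult norm_of_real real_norm_def)
      qed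
      moreover have "cmod (f x) * \<bar>1 - \<psi> x\<bar> \<le> cmod (f x) * 1"
        using \<psi>(5,6)[of x] by (intro mult_left_mono) auto
      ultimately show ?thesis by linarith
    qed
  qed simp
qed

lemma C0_add: assumes "f \<in> C0 X" "g \<in> C0 X" shows "(\<lambda>x. f x + g x) \<in> C0 X"
proof (rule C0_uniform_limit)
  fix e :: real assume "0 < e"
  obtain f' where f': "f' \<in> Cc X" "\<And>x. cmod (f x - f' x) \<le> e/2" using C0_approx[OF assms(1) half_gt_zero[OF \<open>0 < e\<close>]] by metis
  obtain g' where g': "g' \<in> Cc X" "\<And>x. cmod (g x - g' x) \<le> e/2" using C0_approx[OF assms(2) half_gt_zero[OF \<open>0 < e\<close>]] by metis
  have "cmod ((f x + g x) - (f' x + g' x)) \<le> e" for x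
    using norm_triangle_ineq[of "f x - f' x" "g x - g' x"] f'(2)[of x] g'(2)[of x] by (simp add: algebra_simps)
  then show "\<exists>h\<in>C0 X. \<forall>x. cmod ((f x + g x) - h x) \<le> e"
    by (intro bexI[OF _ Cc_sub_C0[OF Cc_add[OF f'(1) g'(1)]]] allI)
qed

lemma C0_mult:
  assumes g: "continuous_map X euclidean g" "\<And>x. cmod (g x) \<le> M" and f: "f \<in> C0 X" shows "(\<lambda>x. g x * f x) \<in> C0 X"
proof (rule C0_uniform_limit)
  fix e :: real assume "0 < e"
  have M: "0 \<le> M" using g(2) norm_ge_zero order_trans by blast
  have "0 < e / (M + 1)" using \<open>0 < e\<close> M by simp
  then obtain f' where f': "f' \<in> Cc X" "\<And>x. cmod (f x - f' x) \<le> e / (M + 1)"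
    using C0_approx[OF f] by metis
  have "cmod (g x * f x - g x * f' x) \<le> e" for x
  proof -
    have "cmod (g x * f x - g x * f' x) = cmod (g x) * cmod (f x - f' x)"
      by (simp add: norm_mult[symmetric] algebra_simps)
    also have "\<dots> \<le> (M + 1) * (e / (M + 1))"
      using g(2)[of x] f'(2)[of x] M by (intro mult_mono) auto
    also have "\<dots> = e" using M by simp
    finally show ?thesis .
  qed
  then show "\<exists>h\<in>C0 X. \<forall>x. cmod (g x * f x - h x) \<le> e"
    by (intro bexI[OF _ Cc_sub_C0[OF Cc_mult[OF g(1) f'(1)]]] allI)
qed

end

section \<open>Convolution on an etale groupoid\<close>

lemma local_homeomorphism_imp_open_map:
  assumes f: "local_homeomorphism X Y f" and W: "openin X W" shows "openin Y (f ` W)"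
proof (subst openin_subopen, intro ballI)
  fix y assume "y \<in> f ` W"
  then obtain x where x: "x \<in> W" "y = f x" by blast
  then have "x \<in> topspace X" using W openin_subset by blast
  then obtain U where U: "openin X U" "x \<in> U" "openin Y (f ` U)"
    "homeomorphic_map (subtopology X U) (subtopology Y (f ` U)) f"
    using f unfolding local_homeomorphism_def by blast
  have "openin (subtopology X U) (U \<inter> W)" using U(1) W by (simp add: openin_open_subtopology openin_Int)
  then have "openin (subtopology Y (f ` U)) (f ` (U \<inter> W))"
    using homeomorphic_imp_open_map[OF U(4)] unfolding open_map_def by blast
  then show "\<exists>T. openin Y T \<and> y \<in> T \<and> T \<subseteq> f ` W"
    using openin_trans_full[OF _ U(3)] x U(2) by (intro exI[of _ "f ` (U \<inter> W)"]) auto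
qed

lemma local_homeomorphism_locally_inj:
  assumes "local_homeomorphism X Y f" "x \<in> topspace X"
  obtains U where "openin X U" "x \<in> U" "inj_on f U"
proof -
  obtain U where U: "openin X U" "x \<in> U" "homeomorphic_map (subtopology X U) (subtopology Y (f ` U)) f"
    using assms unfolding local_homeomorphism_def by blast
  then have "inj_on f (topspace (subtopology X U))" by (intro homeomorphic_imp_injective_map)
  then show ?thesis using that U openin_subset[OF U(1)] by (simp add: Int_absorb1)
qed

lemma continuous_map_mult_complex:
  fixes f g :: "'a \<Rightarrow> complex"
  shows "continuous_map X euclidean f \<Longrightarrow> continuous_map X euclidean g \<Longrightarrow> continuous_map X euclidean (\<lambda>x. f x * g x)"
  by (auto simp: continuous_map_iff_tendsto intro!: tendsto_mult)

sublocale topological_groupoid \<subseteq> algebraic_groupoid G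
  by unfold_locales
    (use composable_subset mul_closed inverse_closed inverse_inverse composable_inverse assoc cancel_left cancel_right in auto)

sublocale topological_groupoid \<subseteq> lch_space "gtop G"
  by unfold_locales (rule locally_compact Hausdorff)+

context topological_groupoid
begin

lemma continuous_map_mul:
  assumes "continuous_map Y (gtop G) a" "continuous_map Y (gtop G) b" "\<And>y. y \<in> topspace Y \<Longrightarrow> dmn G (a y) = rng G (b y)"
  shows "continuous_map Y (gtop G) (\<lambda>y. mul G (a y) (b y))"
proof -
  have ab: "a y \<in> arrows G" "b y \<in> arrows G" if "y \<in> topspace Y" for y
    using assms(1,2) that by (auto dest!: continuous_map_funspace)
  have "continuous_map Y (subtopology (prod_topology (gtop G) (gtop G)) (composable G)) (\<lambda>y. (a y, b y))"
    using assms ab by (intro continuous_map_into_subtopology continuous_map_pairedI) (auto simp: composable_iff)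
  from continuous_map_compose[OF this continuous_mul] show ?thesis by (simp add: o_def)
qed

lemma continuous_map_dmn: "continuous_map (gtop G) (gtop G) (dmn G)"
  unfolding dmn_def[abs_def]
  by (rule continuous_map_mul[OF continuous_inverse continuous_map_id[unfolded id_def]]) (simp add: dmn_inv)

lemma continuous_map_rng: "continuous_map (gtop G) (gtop G) (rng G)"
  unfolding rng_def[abs_def]
  by (rule continuous_map_mul[OF continuous_map_id[unfolded id_def] continuous_inverse]) (simp add: rng_inv)

lemma closedin_units: "closedin (gtop G) (units G)"
proof -
  have "closedin (gtop G) {g \<in> arrows G. dmn G g = id g}"
    by (rule closedin_continuous_maps_eq[OF Hausdorff continuous_map_dmn continuous_map_id])
  moreover have "{g \<in> arrows G. dmn G g = id g} = units G" using units_iff by auto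
  ultimately show ?thesis by simp
qed

lemma topspace_unit_top: "topspace (unit_top G) = units G"
  using unitsD by (auto simp: unit_top_def)

lemma closedin_composable: "closedin (prod_topology (gtop G) (gtop G)) (composable G)"
proof -
  have "closedin (prod_topology (gtop G) (gtop G))
      {p \<in> topspace (prod_topology (gtop G) (gtop G)). (dmn G \<circ> fst) p = (rng G \<circ> snd) p}"
    by (rule closedin_continuous_maps_eq[OF Hausdorff])
      (intro continuous_map_compose[OF continuous_map_fst continuous_map_dmn]
        continuous_map_compose[OF continuous_map_snd continuous_map_rng])+
  also have "{p \<in> topspace (prod_topology (gtop G) (gtop G)). (dmn G \<circ> fst) p = (rng G \<circ> snd) p} = composable G"
    by (auto simp: composable_iff)
  finally show ?thesis .
qed

definition set_product :: "'a set \<Rightarrow> 'a set \<Rightarrow> 'a set"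
  where "set_product K L = (\<lambda>(g, h). mul G g h) ` (K \<times> L \<inter> composable G)"

lemma compactin_set_product:
  assumes "compactin (gtop G) K" "compactin (gtop G) L" shows "compactin (gtop G) (set_product K L)"
  unfolding set_product_def
proof (rule image_compactin[OF _ continuous_mul])
  have "compactin (prod_topology (gtop G) (gtop G)) (K \<times> L)" using assms by (simp add: compactin_Times)
  then show "compactin (subtopology (prod_topology (gtop G) (gtop G)) (composable G)) (K \<times> L \<inter> composable G)"
    using closedin_composable by (simp add: compactin_subtopology compact_Int_closedin)
qed

lemma conv_off_set_product:
  assumes "\<And>x. x \<notin> K \<Longrightarrow> f x = 0" "\<And>x. x \<notin> L \<Longrightarrow> k x = 0" "g \<notin> set_product K L"
  shows "conv G f k g = 0"
proof (cases "g \<in> arrows G")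
  case True
  have "f (quo g h) * k h = 0" if h: "h \<in> arrows G" "dmn G h = dmn G g" for h
  proof (rule ccontr)
    assume "f (quo g h) * k h \<noteq> 0"
    then have "quo g h \<in> K" "h \<in> L" using assms by auto
    moreover have "(quo g h, h) \<in> composable G" using h True by (simp add: composable_iff quo)
    ultimately have "mul G (quo g h) h \<in> set_product K L" unfolding set_product_def by force
    then show False using quo_mul_cancel[of g h] h True assms(3) by simp
  qed
  then show ?thesis unfolding conv_def using True by (auto intro!: infsum_0)
qed (simp add: conv_def)

lemma set_product_reduction:
  assumes "invariant G D" "K \<subseteq> arrows G" "L \<subseteq> arrows G"
    and "K \<subseteq> reduction_arrows G D \<or> L \<subseteq> reduction_arrows G D"
  shows "set_product K L \<subseteq> reduction_arrows G D"
  using assms invariant_rng_iff[OF assms(1)]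
  by (fastforce simp: set_product_def composable_iff reduction_arrows_def dmn_mul mul_arrow)

lemma star_Cc: assumes "f \<in> Cc (gtop G)" shows "star G f \<in> Cc (gtop G)"
proof -
  obtain K where K: "continuous_map (gtop G) euclidean f" "compactin (gtop G) K" "K \<subseteq> arrows G" "\<And>x. x \<notin> K \<Longrightarrow> f x = 0"
    using CcE[OF assms] by metis
  show ?thesis
  proof (rule CcI)
    have "continuous_map (gtop G) euclidean (f \<circ> inverse_arrow G)"
      by (rule continuous_map_compose[OF continuous_inverse K(1)])
    then have "continuous_map (gtop G) euclidean (\<lambda>g. cnj (f (inverse_arrow G g)))"
      by (auto simp: continuous_map_iff_tendsto o_def intro!: tendsto_cnj)
    then show "continuous_map (gtop G) euclidean (star G f)" by (rule continuous_map_eq) (simp add: star_def)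
    show "compactin (gtop G) (inverse_arrow G ` K)" by (rule image_compactin[OF K(2) continuous_inverse])
    show "star G f x = 0" if "x \<notin> inverse_arrow G ` K" for x
      using that K(4)[of "inverse_arrow G x"] inv_inv[of x] by (force simp: star_def)
  qed
qed

end

context etale_groupoid
begin

text \<open>Near a unit \<open>x\<close> an arrow \<open>g\<close> and its range \<open>r(g)\<close> both lie in a set on which \<open>r\<close> is injective; they have the
  same range, so \<open>g = r(g)\<close>.\<close>

lemma openin_units: "openin (gtop G) (units G)"
proof (subst openin_subopen, intro ballI)
  fix x assume x: "x \<in> units G"
  then have "x \<in> arrows G" using unitsD by blast
  then obtain U where U: "openin (gtop G) U" "x \<in> U" "inj_on (rng G) U"
    using local_homeomorphism_locally_inj[OF local_homeo_rng] by metis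
  let ?V = "U \<inter> {g \<in> arrows G. rng G g \<in> U}"
  have "openin (gtop G) ?V"
    using U(1) by (intro openin_Int openin_continuous_map_preimage[OF continuous_map_rng])
  moreover have "x \<in> ?V" using U(2) x unitsD by simp
  moreover have "?V \<subseteq> units G"
  proof
    fix g assume g: "g \<in> ?V"
    then have "rng G (rng G g) = rng G g" using rng_units unitsD by blast
    then have "g = rng G g" using U(3) g by (auto dest: inj_onD)
    moreover have "rng G g \<in> units G" using g by (intro rng_units) simp
    ultimately show "g \<in> units G" by (simp only:)
  qed
  ultimately show "\<exists>T. openin (gtop G) T \<and> x \<in> T \<and> T \<subseteq> units G" by (intro exI[of _ ?V] conjI)
qed

lemma openin_unit_top_iff: "openin (unit_top G) U \<longleftrightarrow> openin (gtop G) U \<and> U \<subseteq> units G"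
  unfolding unit_top_def by (rule openin_open_subtopology[OF openin_units])

lemma closedin_unit_top_iff: "closedin (unit_top G) D \<longleftrightarrow> closedin (gtop G) D \<and> D \<subseteq> units G"
  unfolding unit_top_def by (rule closedin_closed_subtopology[OF closedin_units])

lemma openin_dmn_image: "openin (gtop G) W \<Longrightarrow> openin (gtop G) (dmn G ` W)"
  using local_homeomorphism_imp_open_map[OF local_homeo_dmn] openin_unit_top_iff by blast

lemma openin_rng_image: "openin (gtop G) W \<Longrightarrow> openin (gtop G) (rng G ` W)"
  using local_homeomorphism_imp_open_map[OF local_homeo_rng] openin_unit_top_iff by blast

definition bisection :: "'a set \<Rightarrow> bool"
  where "bisection B \<longleftrightarrow> openin (gtop G) B \<and> inj_on (dmn G) B \<and> inj_on (rng G) B"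

lemma bisection_cover: "g \<in> arrows G \<Longrightarrow> \<exists>B. openin (gtop G) B \<and> g \<in> B \<and> bisection B"
proof -
  assume g: "g \<in> arrows G"
  obtain U where U: "openin (gtop G) U" "g \<in> U" "inj_on (rng G) U"
    using local_homeomorphism_locally_inj[OF local_homeo_rng g] by metis
  obtain V where V: "openin (gtop G) V" "g \<in> V" "inj_on (dmn G) V"
    using local_homeomorphism_locally_inj[OF local_homeo_dmn g] by metis
  have "bisection (U \<inter> V)" using U V unfolding bisection_def by (auto intro: inj_on_subset openin_Int)
  then show ?thesis using U V by (intro exI[of _ "U \<inter> V"]) auto
qed

lemma bisection_section:
  assumes B: "bisection B"
  obtains \<sigma> where "continuous_map (subtopology (gtop G) (dmn G ` B)) (gtop G) \<sigma>"
    "\<And>u. u \<in> dmn G ` B \<Longrightarrow> \<sigma> u \<in> B \<and> dmn G (\<sigma> u) = u"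
proof -
  have B': "openin (gtop G) B" "inj_on (dmn G) B" "B \<subseteq> arrows G" "dmn G ` B \<subseteq> arrows G"
    using B openin_subset[of "gtop G" B] dmn_in unfolding bisection_def by auto
  have "homeomorphic_map (subtopology (gtop G) B) (subtopology (gtop G) (dmn G ` B)) (dmn G)"
  proof (rule bijective_open_imp_homeomorphic_map)
    show "continuous_map (subtopology (gtop G) B) (subtopology (gtop G) (dmn G ` B)) (dmn G)"
      by (intro continuous_map_into_subtopology continuous_map_from_subtopology continuous_map_dmn) auto
    have "open_map (gtop G) (gtop G) (dmn G)" unfolding open_map_def using openin_dmn_image by blast
    then show "open_map (subtopology (gtop G) B) (subtopology (gtop G) (dmn G ` B)) (dmn G)"
      by (intro open_map_into_subtopology open_map_from_subtopology B') auto
  qed (use B' in \<open>auto simp: Int_absorb1\<close>)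
  then obtain \<sigma> where \<sigma>: "homeomorphic_maps (subtopology (gtop G) B) (subtopology (gtop G) (dmn G ` B)) (dmn G) \<sigma>"
    using homeomorphic_map_maps by blast
  then have c: "continuous_map (subtopology (gtop G) (dmn G ` B)) (subtopology (gtop G) B) \<sigma>"
    "\<And>u. u \<in> dmn G ` B \<Longrightarrow> dmn G (\<sigma> u) = u"
    unfolding homeomorphic_maps_def using B'(4) by auto
  have "\<sigma> u \<in> B" if "u \<in> dmn G ` B" for u
    using continuous_map_funspace[OF c(1)] that B'(4) by auto
  moreover have "continuous_map (subtopology (gtop G) (dmn G ` B)) (gtop G) \<sigma>"
    using c(1) unfolding continuous_map_in_subtopology by simp
  ultimately show ?thesis using c(2) by (intro that[of \<sigma>]) auto
qed

text \<open>A function carried by a bisection has at most one non-zero value on each fibre, and a partition of unity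
  reduces the general case to this one.\<close>

lemma fibre_finite_Cc:
  assumes "f \<in> Cc (gtop G)" shows "fibre_finite G f"
proof (rule Cc_partition_induct[OF assms, where \<B> = bisection])
  show "\<exists>B. openin (gtop G) B \<and> x \<in> B \<and> bisection B" if "x \<in> arrows G" for x by (rule bisection_cover[OF that])
  show "fibre_finite G (\<lambda>_. 0)" unfolding fibre_finite_def fibre_bounded_def by (auto intro!: exI[of _ 0])
  show "fibre_finite G (\<lambda>x. f x + g x)" if "fibre_finite G f" "fibre_finite G g" for f g
    using that by (rule fibre_finite_add)
  fix f K B
  assume f: "f \<in> Cc (gtop G)" and B: "bisection B" and K: "K \<subseteq> B" "\<And>x. x \<notin> K \<Longrightarrow> f x = 0"
  obtain M where M: "\<And>x. cmod (f x) \<le> M" using C0_bounded[OF Cc_sub_C0[OF f]] by metis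
  have "finite {k \<in> arrows G. f k \<noteq> 0 \<and> p k = x} \<and> card {k \<in> arrows G. f k \<noteq> 0 \<and> p k = x} \<le> 1"
    if p: "inj_on p B" for p :: "'a \<Rightarrow> 'a" and x
  proof -
    let ?S = "{k \<in> arrows G. f k \<noteq> 0 \<and> p k = x}"
    have "?S \<subseteq> B" using K by blast
    then have "a = b" if "a \<in> ?S" "b \<in> ?S" for a b using that p by (auto dest: inj_onD)
    then have "?S = {} \<or> (\<exists>a. ?S = {a})" by blast
    then show ?thesis by (elim disjE exE) (simp_all only: finite.intros card.empty is_singletonI card_1_singleton_iff, auto)
  qed
  then have "fibre_bounded G f 1 M"
    using M B unfolding fibre_bounded_def bisection_def by auto
  then show "fibre_finite G f" using fibre_finite_def by blast
qed

text \<open>Against a function \<open>k\<close> carried by a bisection, \<open>f * k\<close> is locally a product of continuous functions: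
  its only summand at \<open>g\<close> is the one at the point of the bisection with the same source as \<open>g\<close>.\<close>

lemma conv_Cc:
  assumes f: "f \<in> Cc (gtop G)" and k: "k \<in> Cc (gtop G)"
  shows "conv G f k \<in> Cc (gtop G)"
proof (rule Cc_partition_induct[OF k, where \<B> = bisection])
  note ff = fibre_finite_Cc[OF f]
  have off: "conv G f k g = 0" if "g \<notin> arrows G" for k g using that by (simp add: conv_def)
  show "\<exists>B. openin (gtop G) B \<and> x \<in> B \<and> bisection B" if "x \<in> arrows G" for x by (rule bisection_cover[OF that])
  have "conv G f (\<lambda>_. 0) = (\<lambda>_. 0)" by (simp add: conv_def fun_eq_iff)
  then show "conv G f (\<lambda>_. 0) \<in> Cc (gtop G)" using Cc_zero by simp
  show "conv G f (\<lambda>x. k x + k' x) \<in> Cc (gtop G)" if "conv G f k \<in> Cc (gtop G)" "conv G f k' \<in> Cc (gtop G)" for k k'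
  proof -
    have "conv G f (\<lambda>x. k x + k' x) g = conv G f k g + conv G f k' g" for g
      by (cases "g \<in> arrows G") (simp_all add: off conv_finite[OF ff] distrib_left sum.distrib)
    then have "conv G f (\<lambda>x. k x + k' x) = (\<lambda>g. conv G f k g + conv G f k' g)" by blast
    then show ?thesis using Cc_add[OF that] by simp
  qed
  fix k L B
  assume kc: "k \<in> Cc (gtop G)" and B: "bisection B" and L: "compactin (gtop G) L" "L \<subseteq> B" "\<And>x. x \<notin> L \<Longrightarrow> k x = 0"
  obtain K where K: "continuous_map (gtop G) euclidean f" "compactin (gtop G) K" "\<And>x. x \<notin> K \<Longrightarrow> f x = 0"
    using CcE[OF f] by metis
  have k': "continuous_map (gtop G) euclidean k" using CcE[OF kc] by metis
  have B': "openin (gtop G) B" "inj_on (dmn G) B" "B \<subseteq> arrows G"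
    using B openin_subset[of "gtop G" B] unfolding bisection_def by auto
  obtain \<sigma> where \<sigma>: "continuous_map (subtopology (gtop G) (dmn G ` B)) (gtop G) \<sigma>"
    "\<And>u. u \<in> dmn G ` B \<Longrightarrow> \<sigma> u \<in> B \<and> dmn G (\<sigma> u) = u" using bisection_section[OF B] by metis
  define O1 where "O1 = {g \<in> arrows G. dmn G g \<in> dmn G ` B}"
  define O2 where "O2 = {g \<in> arrows G. dmn G g \<in> arrows G - dmn G ` L}"
  define F where "F g = f (quo g (\<sigma> (dmn G g))) * k (\<sigma> (dmn G g))" for g
  have val1: "conv G f k g = F g" if g: "g \<in> O1" for g
  proof -
    let ?s = "\<sigma> (dmn G g)"
    have s: "?s \<in> B" "dmn G ?s = dmn G g" "?s \<in> arrows G" "g \<in> arrows G" using \<sigma>(2) g B'(3) by (auto simp: O1_def)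
    have "conv G f k g = (\<Sum>\<^sub>\<infinity>h\<in>{?s}. f (quo g h) * k h)"
      unfolding conv_def if_P[OF s(4)]
    proof (rule infsum_cong_neutral)
      fix h assume h: "h \<in> {h \<in> arrows G. dmn G h = dmn G g} - {?s}"
      then have "h \<notin> B" using s inj_onD[OF B'(2), of h ?s] by auto
      then have "k h = 0" using L by blast
      then show "f (quo g h) * k h = 0" by simp
    qed (use s in auto)
    then show ?thesis by (simp add: F_def)
  qed
  have val2: "conv G f k g = 0" if g: "g \<in> O2" for g
  proof -
    have "k h = 0" if "dmn G h = dmn G g" for h using g L(3)[of h] that by (force simp: O2_def image_iff)
    then show ?thesis unfolding conv_def by (auto intro!: infsum_0)
  qed
  have O1: "openin (gtop G) O1" unfolding O1_def
    by (rule openin_continuous_map_preimage[OF continuous_map_dmn openin_dmn_image[OF B'(1)]])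
  have O2: "openin (gtop G) O2" unfolding O2_def
  proof (rule openin_continuous_map_preimage[OF continuous_map_dmn])
    have "closedin (gtop G) (dmn G ` L)" by (intro closedin_compact image_compactin[OF L(1) continuous_map_dmn])
    then show "openin (gtop G) (arrows G - dmn G ` L)" by (intro openin_diff) auto
  qed
  show "conv G f k \<in> Cc (gtop G)"
  proof (rule CcI)
    show "compactin (gtop G) (set_product K L)" by (rule compactin_set_product[OF K(2) L(1)])
    show "conv G f k g = 0" if "g \<notin> set_product K L" for g by (rule conv_off_set_product[OF K(3) L(3) that])
    show "continuous_map (gtop G) euclidean (conv G f k)"
    proof (rule pasting_lemma[where I = "{O1, O2}" and T = id and f = "\<lambda>_. conv G f k"])
      fix i assume i: "i \<in> {O1, O2}"
      show "openin (gtop G) (id i)" using i O1 O2 by auto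
      show "continuous_map (subtopology (gtop G) (id i)) euclidean (conv G f k)"
      proof (cases "i = O1")
        case False
        show ?thesis by (rule continuous_map_eq[of _ _ "\<lambda>_. 0"]) (use False i val2 in auto)
      next
        case True
        have d: "continuous_map (subtopology (gtop G) O1) (subtopology (gtop G) (dmn G ` B)) (dmn G)"
          by (intro continuous_map_into_subtopology continuous_map_from_subtopology continuous_map_dmn)
            (auto simp: O1_def)
        have s: "continuous_map (subtopology (gtop G) O1) (gtop G) (\<lambda>g. \<sigma> (dmn G g))"
          using continuous_map_compose[OF d \<sigma>(1)] by (simp add: o_def)
        have si: "continuous_map (subtopology (gtop G) O1) (gtop G) (\<lambda>g. inverse_arrow G (\<sigma> (dmn G g)))"
          using continuous_map_compose[OF s continuous_inverse] by (simp add: o_def)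
        have q: "continuous_map (subtopology (gtop G) O1) (gtop G) (\<lambda>g. quo g (\<sigma> (dmn G g)))"
        proof (rule continuous_map_mul[OF _ si])
          show "continuous_map (subtopology (gtop G) O1) (gtop G) (\<lambda>g. g)"
            using continuous_map_from_subtopology[OF continuous_map_id] by (simp add: id_def)
          show "dmn G g = rng G (inverse_arrow G (\<sigma> (dmn G g)))" if "g \<in> topspace (subtopology (gtop G) O1)" for g
            using that \<sigma>(2)[of "dmn G g"] B'(3) by (auto simp: O1_def rng_inv subset_iff)
        qed
        have "continuous_map (subtopology (gtop G) O1) euclidean F"
          using continuous_map_mult_complex[OF continuous_map_compose[OF q K(1)] continuous_map_compose[OF s k']]
          by (simp add: F_def[abs_def] o_def)
        then have "continuous_map (subtopology (gtop G) O1) euclidean (conv G f k)"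
          by (rule continuous_map_eq) (use val1 in auto)
        then show ?thesis using True by simp
      qed
    next
      fix g assume g: "g \<in> topspace (gtop G)"
      then have "g \<in> O1 \<or> g \<in> O2" using L(2) dmn_in by (auto simp: O1_def O2_def)
      then show "\<exists>j. j \<in> {O1, O2} \<and> g \<in> id j \<and> conv G f k g = conv G f k g" by auto
    qed auto
  qed
qed

lemma Cc_unit_top_iff: "f \<in> Cc (unit_top G) \<longleftrightarrow> f \<in> Cc (gtop G) \<and> (\<forall>x. x \<notin> units G \<longrightarrow> f x = 0)"
proof
  assume f: "f \<in> Cc (gtop G) \<and> (\<forall>x. x \<notin> units G \<longrightarrow> f x = 0)"
  then obtain K where K: "continuous_map (gtop G) euclidean f" "compactin (gtop G) K" "\<And>x. x \<notin> K \<Longrightarrow> f x = 0"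
    using CcE by metis
  then show "f \<in> Cc (unit_top G)"
    unfolding unit_top_def Cc_open_iff[OF openin_units]
    using f compact_Int_closedin[OF K(2) closedin_units] by (intro conjI exI[of _ "K \<inter> units G"]) auto
qed (unfold unit_top_def Cc_open_iff[OF openin_units], use Cc_iff in blast)

lemma lch_unit_top: "lch_space (unit_top G)"
  unfolding unit_top_def by (rule lch_open[OF openin_units])

lemma C0_unit_top: "f \<in> C0 (unit_top G) \<Longrightarrow> x \<notin> units G \<Longrightarrow> f x = 0"
  unfolding C0_def topspace_unit_top by blast

lemma fibre_finite_C0:
  assumes "f \<in> C0 (unit_top G)" shows "fibre_finite G f"
proof -
  interpret U: lch_space "unit_top G" by (rule lch_unit_top)
  obtain M where "\<And>x. cmod (f x) \<le> M" using U.C0_bounded[OF assms] by metis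
  then show ?thesis
    using fibre_bounded_unit_function C0_unit_top[OF assms] fibre_finite_def by blast
qed

end

section \<open>The reduced algebra and its restrictions to invariant sets\<close>

lemma closure_binary:
  assumes f: "bounded_bilinear f" and "\<And>x y. x \<in> M \<Longrightarrow> y \<in> N \<Longrightarrow> f x y \<in> R" "x \<in> closure M" "y \<in> closure N"
  shows "f x y \<in> closure R"
proof -
  obtain a where a: "\<And>n::nat. a n \<in> M" "a \<longlonglongrightarrow> x" using assms(3) closure_sequential by blast
  obtain b where b: "\<And>n::nat. b n \<in> N" "b \<longlonglongrightarrow> y" using assms(4) closure_sequential by blast
  have "(\<lambda>n. f (a n) (b n)) \<longlonglongrightarrow> f x y" by (rule bounded_bilinear.tendsto[OF f a(2) b(2)])
  then show ?thesis
    unfolding closure_sequential using a(1) b(1) assms(2) by (intro exI[of _ "\<lambda>n. f (a n) (b n)"]) simp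
qed

lemma closure_add:
  fixes M :: "'b::real_normed_vector set"
  assumes "\<And>x y. x \<in> M \<Longrightarrow> y \<in> M \<Longrightarrow> x + y \<in> M" "x \<in> closure M" "y \<in> closure M"
  shows "x + y \<in> closure M"
proof -
  obtain a where a: "\<And>n::nat. a n \<in> M" "a \<longlonglongrightarrow> x" using assms(2) closure_sequential by blast
  obtain b where b: "\<And>n::nat. b n \<in> M" "b \<longlonglongrightarrow> y" using assms(3) closure_sequential by blast
  have "(\<lambda>n. a n + b n) \<longlonglongrightarrow> x + y" by (rule tendsto_add[OF a(2) b(2)])
  then show ?thesis
    unfolding closure_sequential using a(1) b(1) assms(1) by (intro exI[of _ "\<lambda>n. a n + b n"]) simp
qed

lemma closure_linear_image:
  assumes "bounded_linear f" "\<And>x. x \<in> M \<Longrightarrow> f x \<in> N" "x \<in> closure M" shows "f x \<in> closure N"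
proof -
  obtain a where a: "\<And>n::nat. a n \<in> M" "a \<longlonglongrightarrow> x" using assms(3) closure_sequential by blast
  have "(\<lambda>n. f (a n)) \<longlonglongrightarrow> f x" by (rule bounded_linear.tendsto[OF assms(1) a(2)])
  then show ?thesis
    unfolding closure_sequential using a(1) assms(2) by (intro exI[of _ "\<lambda>n. f (a n)"]) simp
qed

lemma closed_idealD:
  assumes "I \<in> closed_ideals A"
  shows "I \<subseteq> A" "closed I" "0 \<in> I" "\<And>S T. S \<in> I \<Longrightarrow> T \<in> I \<Longrightarrow> S + T \<in> I" "\<And>c T. T \<in> I \<Longrightarrow> scaleC_op c T \<in> I"
    "\<And>S T. S \<in> A \<Longrightarrow> T \<in> I \<Longrightarrow> S o\<^sub>L T \<in> I" "\<And>S T. S \<in> A \<Longrightarrow> T \<in> I \<Longrightarrow> T o\<^sub>L S \<in> I"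
  using assms unfolding closed_ideals_def by auto

lemma closed_idealI:
  assumes "I \<subseteq> A" "closed I" "0 \<in> I" "\<And>S T. S \<in> I \<Longrightarrow> T \<in> I \<Longrightarrow> S + T \<in> I" "\<And>c T. T \<in> I \<Longrightarrow> scaleC_op c T \<in> I"
    "\<And>S T. S \<in> A \<Longrightarrow> T \<in> I \<Longrightarrow> S o\<^sub>L T \<in> I" "\<And>S T. S \<in> A \<Longrightarrow> T \<in> I \<Longrightarrow> T o\<^sub>L S \<in> I"
  shows "I \<in> closed_ideals A"
  unfolding closed_ideals_def mem_Collect_eq by (intro conjI ballI allI) (fact assms | erule (1) assms | erule assms)+

lemma closed_ideal_subspace: "I \<in> closed_ideals A \<Longrightarrow> subspace I"
  unfolding subspace_def scaleR_eq_scaleC_op using closed_idealD by metis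

lemma continuous_maps_agree_on_closure:
  fixes f g :: "'b::metric_space \<Rightarrow> 'c::metric_space"
  assumes "continuous_on (closure S) f" "continuous_on (closure S) g" "\<And>x. x \<in> S \<Longrightarrow> f x = g x" "x \<in> closure S"
  shows "f x = g x"
proof -
  obtain a where a: "\<And>n::nat. a n \<in> S" "a \<longlonglongrightarrow> x" using assms(4) closure_sequential by blast
  have "\<forall>n. a n \<in> closure S" using a(1) closure_subset by (meson subsetD)
  then have "(\<lambda>n. f (a n)) \<longlonglongrightarrow> f x" "(\<lambda>n. g (a n)) \<longlonglongrightarrow> g x"
    using assms(1,2) a(2) assms(4) unfolding continuous_on_sequentially comp_def by meson+
  then show ?thesis using assms(3) a(1) LIMSEQ_unique by fastforce
qed

lemma blinfun_assoc: "R o\<^sub>L (S o\<^sub>L T) = (R o\<^sub>L S) o\<^sub>L T"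
  by (rule blinfun_eqI) simp

lemma bounded_linear_compose_left: "bounded_linear (\<lambda>T. P o\<^sub>L T)"
  by (rule bounded_bilinear.bounded_linear_right[OF bounded_bilinear_blinfun_compose])

lemma bounded_linear_compose_right: "bounded_linear (\<lambda>T. T o\<^sub>L P)"
  by (rule bounded_bilinear.bounded_linear_left[OF bounded_bilinear_blinfun_compose])

context etale_groupoid
begin

abbreviation rep :: "('a \<Rightarrow> complex) \<Rightarrow> 'a op" where "rep \<equiv> regular_rep G"

abbreviation P :: "'a set \<Rightarrow> 'a op" where "P D \<equiv> proj (reduction_arrows G D)"

lemma rep_in_Cr: "f \<in> Cc (gtop G) \<Longrightarrow> rep f \<in> Cr G"
  unfolding Cr_def by (rule subsetD[OF closure_subset]) (rule imageI)

lemma rep_mult: "f \<in> Cc (gtop G) \<Longrightarrow> k \<in> Cc (gtop G) \<Longrightarrow> rep f o\<^sub>L rep k = rep (conv G f k)"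
  by (intro regular_rep_mult fibre_finite_Cc conv_Cc)

lemma rep_closure_linear:
  assumes Q: "Q \<subseteq> Cc (gtop G)" "(\<lambda>_. 0) \<in> Q" "\<And>f g. f \<in> Q \<Longrightarrow> g \<in> Q \<Longrightarrow> (\<lambda>x. f x + g x) \<in> Q"
    "\<And>c f. f \<in> Q \<Longrightarrow> (\<lambda>x. c * f x) \<in> Q"
  shows "0 \<in> closure (rep ` Q)"
    "S \<in> closure (rep ` Q) \<Longrightarrow> T \<in> closure (rep ` Q) \<Longrightarrow> S + T \<in> closure (rep ` Q)"
    "T \<in> closure (rep ` Q) \<Longrightarrow> scaleC_op c T \<in> closure (rep ` Q)"
proof -
  have ff: "fibre_finite G f" if "f \<in> Q" for f using that Q(1) fibre_finite_Cc by blast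
  have "rep (\<lambda>_. 0) \<in> rep ` Q" using Q(2) by blast
  from subsetD[OF closure_subset this] show "0 \<in> closure (rep ` Q)" by (simp add: regular_rep_zero)
  have "S + T \<in> rep ` Q" if "S \<in> rep ` Q" "T \<in> rep ` Q" for S T
    using that Q(3) by (auto simp: regular_rep_add[OF ff ff, symmetric])
  then show "S \<in> closure (rep ` Q) \<Longrightarrow> T \<in> closure (rep ` Q) \<Longrightarrow> S + T \<in> closure (rep ` Q)"
    by (rule closure_add)
  have "scaleC_op c T \<in> rep ` Q" if "T \<in> rep ` Q" for T
    using that Q(4) by (auto simp: regular_rep_scale[OF ff, symmetric])
  then show "T \<in> closure (rep ` Q) \<Longrightarrow> scaleC_op c T \<in> closure (rep ` Q)"
    by (rule closure_linear_image[OF bounded_linear_scaleC_op])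
qed

lemma Cr_mult: "S \<in> Cr G \<Longrightarrow> T \<in> Cr G \<Longrightarrow> S o\<^sub>L T \<in> Cr G"
  unfolding Cr_def by (rule closure_binary[OF bounded_bilinear_blinfun_compose, where M = "rep ` Cc (gtop G)" and N = "rep ` Cc (gtop G)"])
    (auto simp: rep_mult conv_Cc)

lemma Cr_ideal_self: "Cr G \<in> closed_ideals (Cr G)"
proof (rule closed_idealI)
  note lin = rep_closure_linear[OF order_refl Cc_zero Cc_add Cc_scale, folded Cr_def]
  show "closed (Cr G)" by (simp add: Cr_def)
  show "0 \<in> Cr G" by (rule lin)
  show "S + T \<in> Cr G" if "S \<in> Cr G" "T \<in> Cr G" for S T by (rule lin(2)[OF _ _ _ that])
  show "scaleC_op c T \<in> Cr G" if "T \<in> Cr G" for c T by (rule lin(3)[OF _ _ _ that])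
qed (rule order_refl, (erule (1) Cr_mult)+)

text \<open>The adjoints of an approximating sequence form a Cauchy sequence, since taking adjoints does not increase norms.\<close>

lemma Cr_adjoint:
  assumes "T \<in> Cr G" obtains Ts where "Ts \<in> Cr G" "adjoint_op T Ts"
proof -
  obtain a where a: "\<And>n::nat. a n \<in> rep ` Cc (gtop G)" "a \<longlonglongrightarrow> T"
    using assms unfolding Cr_def closure_sequential by blast
  have "\<forall>n. \<exists>f. f \<in> Cc (gtop G) \<and> a n = rep f" using a(1) by blast
  then obtain f where f: "\<And>n. f n \<in> Cc (gtop G)" "\<And>n. a n = rep (f n)" by metis
  define b where "b n = rep (star G (f n))" for n
  have b: "b n \<in> Cr G" for n unfolding b_def by (intro rep_in_Cr star_Cc f)
  have adj: "adjoint_op (a n) (b n)" for n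
    unfolding b_def f(2) by (intro adjoint_regular_rep fibre_finite_Cc f)
  have diff: "norm (b m - b n) \<le> norm (a m - a n)" for m n
  proof (rule norm_blinfun_bound)
    have "adjoint_op (a m - a n) (b m - b n)"
      using adj unfolding adjoint_op_def by (simp add: blinfun.diff_left inner_diff_left inner_diff_right)
    then show "norm ((b m - b n) \<xi>) \<le> norm (a m - a n) * norm \<xi>" for \<xi> by (rule norm_adjoint_apply_le)
  qed simp
  have "Cauchy b"
  proof (rule CauchyI)
    fix e :: real assume "0 < e"
    then obtain M where "\<forall>m\<ge>M. \<forall>n\<ge>M. norm (a m - a n) < e"
      using CauchyD[OF LIMSEQ_imp_Cauchy[OF a(2)]] by blast
    then show "\<exists>M. \<forall>m\<ge>M. \<forall>n\<ge>M. norm (b m - b n) < e" using diff by (meson le_less_trans)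
  qed
  then obtain Ts where Ts: "b \<longlonglongrightarrow> Ts" by (auto simp: Cauchy_convergent_iff convergent_def)
  show ?thesis
  proof
    show "Ts \<in> Cr G" using Ts b closed_sequentially[of "Cr G" b Ts] by (simp add: Cr_def)
    have "T \<xi> \<bullet> \<eta> = \<xi> \<bullet> Ts \<eta>" for \<xi> \<eta>
    proof (rule LIMSEQ_unique)
      show "(\<lambda>n. a n \<xi> \<bullet> \<eta>) \<longlonglongrightarrow> T \<xi> \<bullet> \<eta>"
        by (intro tendsto_inner blinfun.tendsto a(2) tendsto_const)
      show "(\<lambda>n. a n \<xi> \<bullet> \<eta>) \<longlonglongrightarrow> \<xi> \<bullet> Ts \<eta>"
        unfolding adjoint_opD[OF adj] by (intro tendsto_inner blinfun.tendsto Ts tendsto_const)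
    qed
    then show "adjoint_op T Ts" by (simp add: adjoint_op_def)
  qed
qed

lemma proj_commutes_Cr: assumes "T \<in> Cr G" shows "P D o\<^sub>L T = T o\<^sub>L P D"
proof (rule continuous_maps_agree_on_closure[where S = "rep ` Cc (gtop G)" and f = "\<lambda>T. P D o\<^sub>L T" and g = "\<lambda>T. T o\<^sub>L P D"])
  show "continuous_on (closure (rep ` Cc (gtop G))) (\<lambda>T. P D o\<^sub>L T)"
    by (rule linear_continuous_on[OF bounded_linear_compose_left])
  show "continuous_on (closure (rep ` Cc (gtop G))) (\<lambda>T. T o\<^sub>L P D)"
    by (rule linear_continuous_on[OF bounded_linear_compose_right])
  show "T \<in> closure (rep ` Cc (gtop G))" using assms by (simp add: Cr_def)
qed (auto intro: proj_commutes_regular_rep fibre_finite_Cc)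

text \<open>Together with \<open>T\<close> the ideal contains \<open>T\<^sup>* T\<close>, so the fixed point built from \<open>T\<close> stays in it.\<close>

lemma closed_proj_ideal:
  assumes I: "I \<in> closed_ideals (Cr G)" shows "closed ((\<lambda>T. P D o\<^sub>L T) ` I)"
proof (rule closed_compression)
  note I' = closed_idealD[OF I]
  show "closed I" "subspace I" using I' closed_ideal_subspace[OF I] by auto
  show "P D o\<^sub>L P D = P D" "norm (P D) \<le> 1" by (rule proj_idem norm_proj_le)+
  show "P D o\<^sub>L T = T o\<^sub>L P D" if "T \<in> I" for T using that I'(1) proj_commutes_Cr by blast
  fix T assume T: "T \<in> I"
  then obtain Ts where Ts: "Ts \<in> Cr G" "adjoint_op T Ts" using Cr_adjoint I'(1) by blast
  have "X o\<^sub>L (Ts o\<^sub>L T) \<in> I" if "X \<in> I" for X using that I'(1,6) Ts(1) T by blast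
  then show "\<exists>Ts. adjoint_op T Ts \<and> P D o\<^sub>L Ts = Ts o\<^sub>L P D \<and> (\<forall>X\<in>I. X o\<^sub>L (Ts o\<^sub>L T) \<in> I)"
    using Ts proj_commutes_Cr by blast
qed

lemma gtop_reduction: "gtop (reduction G D) = subtopology (gtop G) (reduction_arrows G D)"
  by (simp add: reduction_def)

lemma openin_reduction_arrows: "openin (gtop G) U \<Longrightarrow> openin (gtop G) (reduction_arrows G U)"
  unfolding reduction_arrows_def by (rule openin_continuous_map_preimage[OF continuous_map_dmn])

lemma closedin_reduction_arrows: "closedin (gtop G) D \<Longrightarrow> closedin (gtop G) (reduction_arrows G D)"
  unfolding reduction_arrows_def by (rule closedin_continuous_map_preimage[OF continuous_map_dmn])

lemma units_sub_reduction: "D \<subseteq> units G \<Longrightarrow> D \<subseteq> reduction_arrows G D"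
  using unitsD by (force simp: reduction_arrows_def)

lemma unit_top_reduction: "invariant G D \<Longrightarrow> unit_top (reduction G D) = subtopology (gtop G) D"
  using units_sub_reduction[of D]
  by (simp add: unit_top_def units_reduction gtop_reduction subtopology_subtopology invariant_def Int_absorb1)

text \<open>For closed \<open>D\<close>, restriction to \<open>G\<^sub>D\<close> is realised by compression to the square-summable functions
  on \<open>G\<^sub>D\<close>. It is onto, because its image is dense, by Tietze's theorem, and closed.\<close>

lemma Cr_reduction_closed:
  assumes D: "closedin (unit_top G) D" "invariant G D"
  shows "Cr (reduction G D) = (\<lambda>T. P D o\<^sub>L T) ` Cr G"
proof -
  have cl: "closedin (gtop G) (reduction_arrows G D)"
    using D closedin_unit_top_iff closedin_reduction_arrows by blast
  have restr: "regular_rep (reduction G D) (restrict_zero (reduction_arrows G D) f) = P D o\<^sub>L rep f"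
    if "f \<in> Cc (gtop G)" for f
    by (rule regular_rep_restrict[OF D(2) fibre_finite_Cc[OF that]])
  have "regular_rep (reduction G D) ` Cc (gtop (reduction G D)) = (\<lambda>T. P D o\<^sub>L T) ` rep ` Cc (gtop G)"
  proof (intro equalityI subsetI)
    fix T assume "T \<in> regular_rep (reduction G D) ` Cc (gtop (reduction G D))"
    then obtain f where f: "f \<in> Cc (subtopology (gtop G) (reduction_arrows G D))" "T = regular_rep (reduction G D) f"
      by (auto simp: gtop_reduction)
    then obtain F where "F \<in> Cc (gtop G)" "restrict_zero (reduction_arrows G D) F = f" using Cc_extension[OF cl] by metis
    then show "T \<in> (\<lambda>T. P D o\<^sub>L T) ` rep ` Cc (gtop G)" using f(2) restr by auto
  next
    fix T assume "T \<in> (\<lambda>T. P D o\<^sub>L T) ` rep ` Cc (gtop G)"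
    then obtain f where f: "f \<in> Cc (gtop G)" "T = P D o\<^sub>L rep f" by blast
    then show "T \<in> regular_rep (reduction G D) ` Cc (gtop (reduction G D))"
      using restr Cc_restrict_closed[OF cl f(1)] gtop_reduction by (metis image_eqI)
  qed
  then have eq: "Cr (reduction G D) = closure ((\<lambda>T. P D o\<^sub>L T) ` rep ` Cc (gtop G))" by (simp add: Cr_def)
  show ?thesis
  proof
    show "Cr (reduction G D) \<subseteq> (\<lambda>T. P D o\<^sub>L T) ` Cr G"
      unfolding eq by (rule closure_minimal[OF _ closed_proj_ideal[OF Cr_ideal_self]]) (use rep_in_Cr in blast)
    show "(\<lambda>T. P D o\<^sub>L T) ` Cr G \<subseteq> Cr (reduction G D)"
      unfolding eq Cr_def[of G]
      using closure_linear_image[OF bounded_linear_compose_left, where M = "rep ` Cc (gtop G)" and N = "(\<lambda>T. P D o\<^sub>L T) ` rep ` Cc (gtop G)"]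
      by blast
  qed
qed

lemma open_invariantD:
  assumes "U \<in> open_invariant G"
  shows "openin (gtop G) U" "U \<subseteq> units G" "invariant G U" "openin (gtop G) (reduction_arrows G U)"
    "closedin (unit_top G) (units G - U)" "invariant G (units G - U)" "units G - (units G - U) = U"
proof -
  show 1: "openin (gtop G) U" "U \<subseteq> units G" "invariant G U"
    using assms openin_unit_top_iff unfolding open_invariant_def by auto
  show "openin (gtop G) (reduction_arrows G U)" by (rule openin_reduction_arrows[OF 1(1)])
  show "closedin (unit_top G) (units G - U)"
    using closedin_diff[OF closedin_topspace, of "unit_top G" U] assms by (simp add: topspace_unit_top open_invariant_def)
  show "invariant G (units G - U)" by (rule invariant_complement[OF 1(3)])
  show "units G - (units G - U) = U" using 1(2) by blast
qed

lemma complement_open_invariant: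
  assumes "closedin (unit_top G) D" "invariant G D" shows "units G - D \<in> open_invariant G"
  using assms invariant_complement openin_diff[OF openin_topspace, of "unit_top G" D]
  by (auto simp: open_invariant_def topspace_unit_top)

lemma Cc_reduction_open_iff:
  assumes "U \<in> open_invariant G"
  shows "f \<in> Cc (gtop (reduction G U)) \<longleftrightarrow> f \<in> Cc (gtop G) \<and>
    (\<exists>K. compactin (gtop G) K \<and> K \<subseteq> reduction_arrows G U \<and> (\<forall>x. x \<notin> K \<longrightarrow> f x = 0))"
  unfolding gtop_reduction Cc_open_iff[OF open_invariantD(4)[OF assms]] Cc_iff by blast

lemma rep_reduction_open:
  assumes U: "U \<in> open_invariant G" and f: "f \<in> Cc (gtop (reduction G U))"
  shows "regular_rep (reduction G U) f = rep f"
  by (rule regular_rep_reduction_supported[OF open_invariantD(3)[OF U]])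
    (use f Cc_reduction_open_iff[OF U] fibre_finite_Cc in auto)

text \<open>For open \<open>U\<close>, extension by zero is an inclusion: both algebras act on the same Hilbert space.\<close>

lemma Cr_reduction_open:
  assumes "U \<in> open_invariant G" shows "Cr (reduction G U) = closure (rep ` Cc (gtop (reduction G U)))"
  unfolding Cr_def using rep_reduction_open[OF assms] by (metis (no_types, lifting) image_cong)

lemma Cr_reduction_open_ideal:
  assumes U: "U \<in> open_invariant G" shows "Cr (reduction G U) \<in> closed_ideals (Cr G)"
proof -
  let ?Q = "Cc (gtop (reduction G U))"
  interpret R: lch_space "gtop (reduction G U)"
    unfolding gtop_reduction by (rule lch_open[OF open_invariantD(4)[OF U]])
  have Q: "?Q \<subseteq> Cc (gtop G)" using Cc_reduction_open_iff[OF U] by blast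
  note lin = rep_closure_linear[OF Q R.Cc_zero R.Cc_add R.Cc_scale]
  have conv_in: "conv G f k \<in> ?Q \<and> conv G k f \<in> ?Q" if f: "f \<in> Cc (gtop G)" and k: "k \<in> ?Q" for f k
  proof -
    obtain K where K: "compactin (gtop G) K" "\<And>x. x \<notin> K \<Longrightarrow> f x = 0" "K \<subseteq> arrows G" using CcE[OF f] by metis
    obtain L where L: "compactin (gtop G) L" "\<And>x. x \<notin> L \<Longrightarrow> k x = 0" "L \<subseteq> reduction_arrows G U"
      using k Cc_reduction_open_iff[OF U] by blast
    have sub: "set_product K L \<subseteq> reduction_arrows G U" "set_product L K \<subseteq> reduction_arrows G U"
      by (rule set_product_reduction[OF open_invariantD(3)[OF U]]; use K L reduction_arrows_sub[of G U] in blast)+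
    have "conv G f k \<in> Cc (gtop G)" "conv G k f \<in> Cc (gtop G)" using conv_Cc f k Q by blast+
    moreover have "compactin (gtop G) (set_product K L)" "compactin (gtop G) (set_product L K)"
      by (rule compactin_set_product; fact K L)+
    ultimately show ?thesis
      unfolding Cc_reduction_open_iff[OF U]
      using sub conv_off_set_product[where f = f and k = k, OF K(2) L(2)]
        conv_off_set_product[where f = k and k = f, OF L(2) K(2)]
      by (intro conjI exI[of _ "set_product K L"] exI[of _ "set_product L K"]) auto
  qed
  have "S o\<^sub>L T \<in> closure (rep ` ?Q) \<and> T o\<^sub>L S \<in> closure (rep ` ?Q)" if "S \<in> Cr G" "T \<in> closure (rep ` ?Q)" for S T
  proof
    show "S o\<^sub>L T \<in> closure (rep ` ?Q)"
      by (rule closure_binary[OF bounded_bilinear_blinfun_compose _ that[unfolded Cr_def]])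
        (use conv_in Q in \<open>auto simp: rep_mult subset_iff\<close>)
    show "T o\<^sub>L S \<in> closure (rep ` ?Q)"
      by (rule closure_binary[OF bounded_bilinear_blinfun_compose _ that(2) that(1)[unfolded Cr_def]])
        (use conv_in Q in \<open>auto simp: rep_mult subset_iff\<close>)
  qed
  note mult = this
  show ?thesis
    unfolding Cr_reduction_open[OF U]
  proof (rule closed_idealI)
    show "closure (rep ` ?Q) \<subseteq> Cr G" unfolding Cr_def using Q by (intro closure_mono image_mono)
    show "0 \<in> closure (rep ` ?Q)" by (rule lin)
    show "S + T \<in> closure (rep ` ?Q)" if "S \<in> closure (rep ` ?Q)" "T \<in> closure (rep ` ?Q)" for S T
      by (rule lin(2)[OF _ _ _ that])
    show "scaleC_op c T \<in> closure (rep ` ?Q)" if "T \<in> closure (rep ` ?Q)" for c T by (rule lin(3)[OF _ _ _ that])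
  qed (use mult in auto)
qed

lemma Cr_reduction_open_mono:
  assumes "U \<in> open_invariant G" "V \<in> open_invariant G" "U \<subseteq> V"
  shows "Cr (reduction G U) \<subseteq> Cr (reduction G V)"
proof -
  have "reduction_arrows G U \<subseteq> reduction_arrows G V" using assms(3) by (auto simp: reduction_arrows_def)
  then have "Cc (gtop (reduction G U)) \<subseteq> Cc (gtop (reduction G V))"
    unfolding subset_iff Cc_reduction_open_iff[OF assms(1)] Cc_reduction_open_iff[OF assms(2)] by meson
  then show ?thesis unfolding Cr_reduction_open[OF assms(1)] Cr_reduction_open[OF assms(2)]
    by (intro closure_mono image_mono)
qed

lemma proj_kernel_ideal: "{T \<in> Cr G. P D o\<^sub>L T = 0} \<in> closed_ideals (Cr G)"
proof -
  note A = closed_idealD[OF Cr_ideal_self]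
  have "closed ((\<lambda>T. P D o\<^sub>L T) -` {0})"
    by (intro continuous_closed_vimage linear_continuous_at[OF bounded_linear_compose_left] closed_singleton)
  then have "closed (Cr G \<inter> (\<lambda>T. P D o\<^sub>L T) -` {0})" using A(2) by (intro closed_Int)
  also have "Cr G \<inter> (\<lambda>T. P D o\<^sub>L T) -` {0} = {T \<in> Cr G. P D o\<^sub>L T = 0}" by auto
  finally have "closed {T \<in> Cr G. P D o\<^sub>L T = 0}" .
  moreover have "P D o\<^sub>L scaleC_op c T = scaleC_op c (P D o\<^sub>L T)" for c and T :: "'a op"
    by (auto intro!: blinfun_eqI ell2_eqI)
  then have "P D o\<^sub>L scaleC_op c T = 0" if "P D o\<^sub>L T = 0" for c and T :: "'a op"
    using that by (simp add: bounded_linear.linear[OF bounded_linear_scaleC_op] linear_0)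
  moreover have "P D o\<^sub>L (S + T) = 0" if "P D o\<^sub>L S = 0" "P D o\<^sub>L T = 0" for S T :: "'a op"
    using that by (simp add: bounded_bilinear.add_right[OF bounded_bilinear_blinfun_compose])
  moreover have "P D o\<^sub>L (S o\<^sub>L T) = 0 \<and> P D o\<^sub>L (T o\<^sub>L S) = 0" if "S \<in> Cr G" "P D o\<^sub>L T = 0" for S T
  proof
    show "P D o\<^sub>L (S o\<^sub>L T) = 0"
      using that(2) proj_commutes_Cr[OF that(1), of D]
      by (metis blinfun_assoc[of "P D" S T] blinfun_assoc[of S "P D" T] bounded_bilinear.zero_right[OF bounded_bilinear_blinfun_compose])
    show "P D o\<^sub>L (T o\<^sub>L S) = 0"
      using that(2) by (simp add: blinfun_assoc bounded_bilinear.zero_left[OF bounded_bilinear_blinfun_compose])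
  qed
  ultimately show ?thesis
    unfolding closed_ideals_def using A by auto
qed

lemma Cr_reduction_open_sub_kernel:
  assumes D: "closedin (unit_top G) D" "invariant G D"
  shows "Cr (reduction G (units G - D)) \<subseteq> {T \<in> Cr G. P D o\<^sub>L T = 0}"
proof -
  let ?U = "units G - D"
  have U: "?U \<in> open_invariant G" by (rule complement_open_invariant[OF D])
  interpret R: algebraic_groupoid "reduction G D" by (rule algebraic_groupoid_reduction[OF D(2)])
  have "P D o\<^sub>L rep f = 0" if f: "f \<in> Cc (gtop (reduction G ?U))" for f
  proof -
    obtain K where "K \<subseteq> reduction_arrows G ?U" "\<And>x. x \<notin> K \<Longrightarrow> f x = 0" "f \<in> Cc (gtop G)"
      using f Cc_reduction_open_iff[OF U] by blast
    then have "restrict_zero (reduction_arrows G D) f = (\<lambda>_. 0)" "fibre_finite G f"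
      using fibre_finite_Cc by (auto simp: restrict_zero_def reduction_arrows_def fun_eq_iff)
    then show ?thesis using regular_rep_restrict[OF D(2), of f] R.regular_rep_zero by simp
  qed
  moreover have "rep f \<in> Cr G" if "f \<in> Cc (gtop (reduction G ?U))" for f
    using that Cc_reduction_open_iff[OF U] rep_in_Cr by blast
  ultimately show ?thesis
    unfolding Cr_reduction_open[OF U]
    by (intro closure_minimal closed_idealD(2)[OF proj_kernel_ideal]) auto
qed

text \<open>By density, the maps in the definition of inner exactness can only be the inclusion and \<open>T \<mapsto> P T\<close>.\<close>

lemma inner_exact_iff:
  "inner_exact G \<longleftrightarrow> (\<forall>D. closedin (unit_top G) D \<and> invariant G D \<longrightarrow>
     Cr (reduction G (units G - D)) = {T \<in> Cr G. P D o\<^sub>L T = 0})"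
proof -
  have "(\<exists>\<iota> \<pi>. induced_map (reduction G (units G - D)) G (\<lambda>f. f) \<iota> \<and>
            induced_map G (reduction G D) (restrict_zero (reduction_arrows G D)) \<pi> \<and>
            short_exact (Cr (reduction G (units G - D))) (Cr G) (Cr (reduction G D)) \<iota> \<pi>) \<longleftrightarrow>
        Cr (reduction G (units G - D)) = {T \<in> Cr G. P D o\<^sub>L T = 0}" (is "?L \<longleftrightarrow> ?R")
    if D: "closedin (unit_top G) D" "invariant G D" for D
  proof -
    let ?U = "units G - D"
    have U: "?U \<in> open_invariant G" by (rule complement_open_invariant[OF D])
    have restr: "P D o\<^sub>L rep f = regular_rep (reduction G D) (restrict_zero (reduction_arrows G D) f)"
      if "f \<in> Cc (gtop G)" for f
      by (rule regular_rep_restrict[OF D(2) fibre_finite_Cc[OF that], symmetric])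
    have cont: "continuous_on S (\<lambda>T. P D o\<^sub>L T)" for S
      by (rule linear_continuous_on[OF bounded_linear_compose_left])
    show ?thesis
    proof
      assume ?L
      then obtain \<iota> \<pi> where ex: "induced_map (reduction G ?U) G (\<lambda>f. f) \<iota>"
        "induced_map G (reduction G D) (restrict_zero (reduction_arrows G D)) \<pi>"
        "short_exact (Cr (reduction G ?U)) (Cr G) (Cr (reduction G D)) \<iota> \<pi>" by blast
      have "\<iota> T = T" if "T \<in> Cr (reduction G ?U)" for T
      proof (rule continuous_maps_agree_on_closure[where g = "\<lambda>T. T" and S = "rep ` Cc (gtop (reduction G ?U))"])
        show "continuous_on (closure (rep ` Cc (gtop (reduction G ?U)))) \<iota>"
          using ex(1) Cr_reduction_open[OF U] by (simp add: induced_map_def)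
        show "\<iota> T = T" if "T \<in> rep ` Cc (gtop (reduction G ?U))" for T
          using that ex(1) rep_reduction_open[OF U] unfolding induced_map_def by fastforce
        show "T \<in> closure (rep ` Cc (gtop (reduction G ?U)))" using that Cr_reduction_open[OF U] by simp
      qed (rule continuous_on_id)
      then have "\<iota> ` Cr (reduction G ?U) = Cr (reduction G ?U)" by force
      moreover have "\<pi> T = P D o\<^sub>L T" if "T \<in> Cr G" for T
      proof (rule continuous_maps_agree_on_closure[where S = "rep ` Cc (gtop G)" and f = \<pi> and g = "\<lambda>T. P D o\<^sub>L T"])
        show "continuous_on (closure (rep ` Cc (gtop G))) \<pi>"
          using ex(2) by (simp add: induced_map_def Cr_def)
        show "\<pi> T = P D o\<^sub>L T" if "T \<in> rep ` Cc (gtop G)" for T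
          using that ex(2) restr unfolding induced_map_def by fastforce
        show "T \<in> closure (rep ` Cc (gtop G))" using that by (simp add: Cr_def)
      qed (rule cont)
      then have "{T \<in> Cr G. \<pi> T = 0} = {T \<in> Cr G. P D o\<^sub>L T = 0}" by auto
      ultimately show ?R using ex(3) unfolding short_exact_def by simp
    next
      assume R: ?R
      have "induced_map (reduction G ?U) G (\<lambda>f. f) (\<lambda>T. T)"
        unfolding induced_map_def using rep_reduction_open[OF U] continuous_on_id by auto
      moreover have "induced_map G (reduction G D) (restrict_zero (reduction_arrows G D)) (\<lambda>T. P D o\<^sub>L T)"
        unfolding induced_map_def using restr cont by auto
      moreover have "short_exact (Cr (reduction G ?U)) (Cr G) (Cr (reduction G D)) (\<lambda>T. T) (\<lambda>T. P D o\<^sub>L T)"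
        unfolding short_exact_def using R Cr_reduction_closed[OF D] by simp
      ultimately show ?L by blast
    qed
  qed
  then show ?thesis
    unfolding inner_exact_def by (intro all_cong1 imp_cong refl) (elim conjE)
qed

end

section \<open>Ideals and open invariant sets\<close>

lemma ThetaE:
  assumes "x \<in> Theta G I"
  obtains f where "f \<in> C0 (unit_top G)" "regular_rep G f \<in> I" "x \<in> units G" "f x \<noteq> 0"
  using assms unfolding Theta_def by blast

lemma ThetaI: "f \<in> C0 (unit_top G) \<Longrightarrow> regular_rep G f \<in> I \<Longrightarrow> x \<in> units G \<Longrightarrow> f x \<noteq> 0 \<Longrightarrow> x \<in> Theta G I"
  unfolding Theta_def by blast

lemma Theta_mono: "I \<subseteq> J \<Longrightarrow> Theta G I \<subseteq> Theta G J"
  unfolding Theta_def by blast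

context etale_groupoid
begin

lemma Cc_C0_unit: "f \<in> Cc (unit_top G) \<Longrightarrow> f \<in> C0 (unit_top G)"
  using lch_space.Cc_sub_C0[OF lch_unit_top] .

lemma bump_Cc:
  assumes "openin (gtop G) V" "compactin (gtop G) K" "K \<subseteq> V"
  obtains h L where "h \<in> Cc (gtop G)" "compactin (gtop G) L" "L \<subseteq> V" "\<And>x. x \<notin> L \<Longrightarrow> h x = 0" "\<And>x. x \<in> K \<Longrightarrow> h x = 1"
proof -
  obtain \<psi> :: "'a \<Rightarrow> real" and L where \<psi>: "continuous_map (gtop G) euclideanreal \<psi>" "compactin (gtop G) L" "L \<subseteq> V"
    "\<And>x. x \<notin> L \<Longrightarrow> \<psi> x = 0" "\<And>x. x \<in> K \<Longrightarrow> \<psi> x = 1"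
    using bump[OF assms(2,1,3)] by metis
  show ?thesis
  proof
    show "(\<lambda>x. complex_of_real (\<psi> x)) \<in> Cc (gtop G)"
      by (rule CcI[OF continuous_map_of_real[OF \<psi>(1)] \<psi>(2)]) (simp add: \<psi>(4))
  qed (use \<psi> in auto)
qed

lemma openin_support: assumes "f \<in> C0 (unit_top G)" shows "openin (unit_top G) {x \<in> units G. f x \<noteq> 0}"
proof -
  have "continuous_map (unit_top G) euclidean f" using assms unfolding C0_def by blast
  from openin_continuous_map_preimage[OF this, of "- {0}"] show ?thesis
    by (simp add: topspace_unit_top open_Compl)
qed

text \<open>An ideal contains every compactly supported function that lives on \<open>\<Theta>(I)\<close>: near a point where
  \<open>f \<in> I\<close> does not vanish, \<open>h = (h/f) f\<close>.\<close>

lemma rep_in_ideal_if_supported_on_Theta: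
  assumes I: "I \<in> closed_ideals (Cr G)" and U: "openin (gtop G) (Theta G I)"
    and h: "h \<in> Cc (subtopology (gtop G) (Theta G I))"
  shows "rep h \<in> I"
proof -
  let ?Y = "subtopology (gtop G) (Theta G I)"
  interpret Y: lch_space ?Y by (rule lch_open[OF U])
  note I' = closed_idealD[OF I]
  have TU: "Theta G I \<subseteq> units G" by (auto elim: ThetaE)
  have CcY: "f \<in> Cc (gtop G)" "\<And>x. x \<notin> Theta G I \<Longrightarrow> f x = 0" if "f \<in> Cc ?Y" for f
    using that Cc_iff unfolding Cc_open_iff[OF U] by blast+
  define \<B> where "\<B> B \<longleftrightarrow> (\<exists>f. f \<in> C0 (unit_top G) \<and> rep f \<in> I \<and> B = {x \<in> units G. f x \<noteq> 0})" for B
  show ?thesis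
  proof (rule Y.Cc_partition_induct[OF h, where \<B> = \<B>])
    fix x assume "x \<in> topspace ?Y"
    then obtain f where f: "f \<in> C0 (unit_top G)" "rep f \<in> I" "x \<in> units G" "f x \<noteq> 0" by (auto elim: ThetaE)
    have "openin (gtop G) {x \<in> units G. f x \<noteq> 0}" using openin_support[OF f(1)] openin_unit_top_iff by blast
    moreover have "{x \<in> units G. f x \<noteq> 0} \<subseteq> Theta G I" using ThetaI[OF f(1,2)] by blast
    ultimately have "openin ?Y {x \<in> units G. f x \<noteq> 0}" using openin_open_subtopology[OF U] by blast
    then show "\<exists>B. openin ?Y B \<and> x \<in> B \<and> \<B> B" using f unfolding \<B>_def by blast
  next
    show "rep (\<lambda>_. 0) \<in> I" using I'(3) by (simp add: regular_rep_zero)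
  next
    show "rep (\<lambda>x. f x + g x) \<in> I" if "f \<in> Cc ?Y" "g \<in> Cc ?Y" "rep f \<in> I" "rep g \<in> I" for f g
      using that I'(4) by (simp add: regular_rep_add fibre_finite_Cc CcY(1))
  next
    fix k K B
    assume k: "k \<in> Cc ?Y" and B: "\<B> B" and K: "compactin ?Y K" "K \<subseteq> B" "\<And>x. x \<notin> K \<Longrightarrow> k x = 0"
    obtain f where f: "f \<in> C0 (unit_top G)" "rep f \<in> I" "B = {x \<in> units G. f x \<noteq> 0}" using B \<B>_def by blast
    have "continuous_map (unit_top G) euclidean f" using f(1) unfolding C0_def by blast
    then have fc: "continuous_map ?Y euclidean f"
      using continuous_map_from_subtopology[of "unit_top G" euclidean f "Theta G I"] TU
      by (simp add: unit_top_def subtopology_subtopology Int_absorb1)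
    have q: "(\<lambda>x. k x / f x) \<in> Cc ?Y" by (rule Y.Cc_divide[OF k K(1,3) fc]) (use K(2) f(3) in auto)
    have "rep (\<lambda>x. k x / f x) o\<^sub>L rep f = rep k"
    proof (rule regular_rep_unit_mult)
      show "fibre_finite G (\<lambda>x. k x / f x)" "fibre_finite G f" "fibre_finite G k"
        using fibre_finite_Cc CcY(1) q k fibre_finite_C0[OF f(1)] by auto
      show "k x / f x = 0" if "x \<notin> units G" for x using CcY(2)[OF k] TU that by auto
      show "k g = (if g \<in> arrows G then k (rng G g) / f (rng G g) * f g else 0)" for g
      proof (cases "g \<in> units G")
        case True
        then show ?thesis using unitsD K(2,3) f(3) by (cases "g \<in> K") auto
      next
        case False
        then show ?thesis using C0_unit_top[OF f(1)] CcY(2)[OF k] TU by auto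
      qed
    qed
    then show "rep k \<in> I" using I'(6)[OF rep_in_Cr[OF CcY(1)[OF q]] f(2)] by simp
  qed
qed

text \<open>Conjugate a function that is non-zero at \<open>d(g)\<close> by a bump function on a bisection through \<open>g\<close>.\<close>

lemma Theta_invariant:
  assumes I: "I \<in> closed_ideals (Cr G)" shows "invariant G (Theta G I)"
  unfolding invariant_def
proof (intro conjI ballI impI)
  show "Theta G I \<subseteq> units G" by (auto elim: ThetaE)
  fix g assume g: "g \<in> arrows G" "dmn G g \<in> Theta G I"
  note I' = closed_idealD[OF I]
  obtain f where f: "f \<in> C0 (unit_top G)" "rep f \<in> I" "f (dmn G g) \<noteq> 0" using ThetaE[OF g(2)] by metis
  have du: "dmn G g \<in> units G" "dmn G g \<in> arrows G" using dmn_units dmn_in g by auto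
  obtain B where B: "openin (gtop G) B" "g \<in> B" "bisection B" using bisection_cover[OF g(1)] by blast
  have B': "B \<subseteq> arrows G" "inj_on (dmn G) B" "inj_on (rng G) B"
    using B openin_subset[of "gtop G" B] unfolding bisection_def by auto
  obtain \<phi> L where \<phi>: "\<phi> \<in> Cc (gtop G)" "L \<subseteq> B" "\<And>x. x \<notin> L \<Longrightarrow> \<phi> x = 0" "\<phi> g = 1"
    using bump_Cc[OF B(1), of "{g}"] B(2) g(1)
    by (metis compactin_sing empty_subsetI insert_subset singletonI)
  obtain \<rho> M where \<rho>: "\<rho> \<in> Cc (gtop G)" "M \<subseteq> units G" "\<And>x. x \<notin> M \<Longrightarrow> \<rho> x = 0" "\<rho> (dmn G g) = 1"
    using bump_Cc[OF openin_units, of "{dmn G g}"] du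
    by (metis compactin_sing empty_subsetI insert_subset singletonI)
  have \<rho>u: "\<rho> \<in> Cc (unit_top G)" using \<rho> Cc_unit_top_iff by blast
  \<comment> \<open>cut \<open>f\<close> off around \<open>d(g)\<close> to have compact support\<close>
  define k where "k x = f x * \<rho> x" for x
  have "continuous_map (unit_top G) euclidean f" using f(1) unfolding C0_def by blast
  then have "k \<in> Cc (unit_top G)" unfolding k_def[abs_def] by (rule lch_space.Cc_mult[OF lch_unit_top _ \<rho>u])
  then have k: "k \<in> Cc (gtop G)" "\<And>x. x \<notin> units G \<Longrightarrow> k x = 0" using Cc_unit_top_iff by auto
  have "rep \<rho> o\<^sub>L rep f = rep k"
  proof (rule regular_rep_unit_mult)
    show "k g = (if g \<in> arrows G then \<rho> (rng G g) * f g else 0)" for g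
      using C0_unit_top[OF f(1), of g] unitsD[of g] by (cases "g \<in> units G") (auto simp: k_def)
  qed (use fibre_finite_Cc[OF \<rho>(1)] fibre_finite_Cc[OF k(1)] fibre_finite_C0[OF f(1)] \<rho> in auto)
  then have kI: "rep k \<in> I" using I'(6)[OF rep_in_Cr[OF \<rho>(1)] f(2)] by simp
  define F where "F = conv G \<phi> (conv G k (star G \<phi>))"
  have star: "star G \<phi> \<in> Cc (gtop G)" by (rule star_Cc[OF \<phi>(1)])
  have ks: "conv G k (star G \<phi>) \<in> Cc (gtop G)" by (rule conv_Cc[OF k(1) star])
  have F: "F \<in> Cc (gtop G)" unfolding F_def by (rule conv_Cc[OF \<phi>(1) ks])
  have "rep F = rep \<phi> o\<^sub>L (rep k o\<^sub>L rep (star G \<phi>))"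
    unfolding F_def by (simp add: rep_mult k star \<phi>(1) ks)
  then have FI: "rep F \<in> I" using I'(6,7) kI rep_in_Cr[OF \<phi>(1)] rep_in_Cr[OF star] by simp
  have \<phi>B: "\<And>x. x \<notin> B \<Longrightarrow> \<phi> x = 0" using \<phi>(2,3) by blast
  have "F x = 0" if "x \<notin> units G" for x
    unfolding F_def by (rule conjugate_off_units[OF k(2) \<phi>B B' that])
  then have "F \<in> C0 (unit_top G)" using F Cc_unit_top_iff Cc_C0_unit by blast
  moreover have "F (rng G g) = k (dmn G g)"
    using conjugate_at_range[OF k(2) \<phi>B B' B(2)] \<phi>(4) by (simp add: F_def)
  ultimately show "rng G g \<in> Theta G I"
    using ThetaI[OF _ FI rng_units[OF g(1)]] f(3) \<rho>(4) by (simp add: k_def)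
qed

lemma Theta_open_invariant:
  assumes I: "I \<in> closed_ideals (Cr G)" shows "Theta G I \<in> open_invariant G"
proof -
  have "openin (unit_top G) (Theta G I)" unfolding Theta_def by (rule openin_Union) (use openin_support in auto)
  then show ?thesis using Theta_invariant[OF I] by (simp add: open_invariant_def)
qed

text \<open>A function \<open>f\<close> supported in \<open>G\<^sub>U\<close> equals \<open>h * f\<close> for a function \<open>h\<close> on \<open>U\<close> that is \<open>1\<close> on the ranges of
  the support.\<close>

lemma Cr_Theta_sub:
  assumes I: "I \<in> closed_ideals (Cr G)" shows "Cr (reduction G (Theta G I)) \<subseteq> I"
proof -
  let ?U = "Theta G I"
  have U: "?U \<in> open_invariant G" by (rule Theta_open_invariant[OF I])
  note U' = open_invariantD[OF U] and I' = closed_idealD[OF I]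
  have "rep f \<in> I" if f: "f \<in> Cc (gtop (reduction G ?U))" for f
  proof -
    obtain K where K: "f \<in> Cc (gtop G)" "compactin (gtop G) K" "K \<subseteq> reduction_arrows G ?U" "\<And>x. x \<notin> K \<Longrightarrow> f x = 0"
      using f Cc_reduction_open_iff[OF U] by blast
    have rK: "compactin (gtop G) (rng G ` K)" "rng G ` K \<subseteq> ?U"
      using image_compactin[OF K(2) continuous_map_rng] K(3) invariant_rng_iff[OF U'(3)]
      by (auto simp: reduction_arrows_def)
    obtain h L where h: "h \<in> Cc (gtop G)" "compactin (gtop G) L" "L \<subseteq> ?U" "\<And>x. x \<notin> L \<Longrightarrow> h x = 0"
      "\<And>x. x \<in> rng G ` K \<Longrightarrow> h x = 1"
      using bump_Cc[OF U'(1) rK] by metis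
    have "h \<in> Cc (subtopology (gtop G) ?U)" unfolding Cc_open_iff[OF U'(1)] using h Cc_iff by blast
    then have hI: "rep h \<in> I" by (rule rep_in_ideal_if_supported_on_Theta[OF I U'(1)])
    have "rep h o\<^sub>L rep f = rep f"
    proof (rule regular_rep_unit_mult)
      show "h x = 0" if "x \<notin> units G" for x using h(3,4) U'(2) that by blast
      show "f g = (if g \<in> arrows G then h (rng G g) * f g else 0)" for g
        using K(3) K(4)[of g] h(5)[of "rng G g"] reduction_arrows_sub[of G ?U] by (cases "g \<in> K") auto
    qed (use fibre_finite_Cc h(1) K(1) in auto)
    then show ?thesis using I'(7)[OF rep_in_Cr[OF K(1)] hI] by simp
  qed
  then show ?thesis
    unfolding Cr_reduction_open[OF U] by (intro closure_minimal I'(2)) blast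
qed

lemma proj_unit_function_zero_iff:
  assumes f: "f \<in> C0 (unit_top G)" and D: "invariant G D"
  shows "P D o\<^sub>L rep f = 0 \<longleftrightarrow> (\<forall>x\<in>D. f x = 0)"
proof
  note ap = regular_rep_unit_function[OF fibre_finite_C0[OF f] C0_unit_top[OF f]]
  show "\<forall>x\<in>D. f x = 0" if z: "P D o\<^sub>L rep f = 0"
  proof
    fix x assume x: "x \<in> D"
    then have xu: "x \<in> units G" "x \<in> reduction_arrows G D"
      using D units_sub_reduction unfolding invariant_def by auto
    have "ell2_apply ((P D o\<^sub>L rep f) (single x 1)) x = f x"
      using xu unitsD by (simp add: ap)
    then show "f x = 0" by (simp add: z)
  qed
  show "P D o\<^sub>L rep f = 0" if z: "\<forall>x\<in>D. f x = 0"
    using z invariant_rng_iff[OF D]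
    by (intro op_eqI_singles ell2_eqI) (auto simp: ap reduction_arrows_def)
qed

lemma dist_unit_functions:
  assumes "fibre_finite G f" "\<And>x. x \<notin> units G \<Longrightarrow> f x = 0" "fibre_finite G g" "\<And>x. x \<notin> units G \<Longrightarrow> g x = 0"
    and "\<And>x. cmod (f x - g x) \<le> e"
  shows "dist (rep g) (rep f) \<le> e"
proof -
  have ng: "fibre_finite G (\<lambda>x. -1 * g x)" by (rule fibre_finite_scale[OF assms(3)])
  have "rep (\<lambda>x. f x + -1 * g x) = rep f + scaleC_op (-1) (rep g)"
    by (simp only: regular_rep_add[OF assms(1) ng] regular_rep_scale[OF assms(3)])
  also have "scaleC_op (-1) (rep g) = - rep g"
    using scaleR_eq_scaleC_op[of "-1" "rep g"] by simp
  finally have "rep (\<lambda>x. f x - g x) = rep f - rep g" by simp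
  moreover have "fibre_bounded G (\<lambda>x. f x - g x) 1 e" by (rule fibre_bounded_unit_function) (use assms in auto)
  ultimately show ?thesis using regular_rep_bound(2) by (fastforce simp: dist_norm norm_minus_commute)
qed

lemma Theta_Cr_reduction:
  assumes U: "U \<in> open_invariant G" shows "Theta G (Cr (reduction G U)) = U"
proof
  note U' = open_invariantD[OF U]
  show "Theta G (Cr (reduction G U)) \<subseteq> U"
  proof
    fix x assume "x \<in> Theta G (Cr (reduction G U))"
    then obtain f where f: "f \<in> C0 (unit_top G)" "rep f \<in> Cr (reduction G U)" "x \<in> units G" "f x \<noteq> 0"
      by (elim ThetaE)
    have "P (units G - U) o\<^sub>L rep f = 0"
      using f(2) Cr_reduction_open_sub_kernel[OF U'(5,6)] U'(7) by auto
    then show "x \<in> U" using proj_unit_function_zero_iff[OF f(1) U'(6)] f(3,4) by blast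
  qed
  show "U \<subseteq> Theta G (Cr (reduction G U))"
  proof
    fix x assume x: "x \<in> U"
    then have xa: "x \<in> units G" "x \<in> arrows G" using U'(2) unitsD by auto
    obtain h L where h: "h \<in> Cc (gtop G)" "compactin (gtop G) L" "L \<subseteq> U" "\<And>x. x \<notin> L \<Longrightarrow> h x = 0" "h x = 1"
      using bump_Cc[OF U'(1), of "{x}"] x xa by auto
    have "h \<in> Cc (unit_top G)" unfolding Cc_unit_top_iff using h U'(2) by blast
    then have hC: "h \<in> C0 (unit_top G)" by (rule Cc_C0_unit)
    have "h \<in> Cc (gtop (reduction G U))"
      unfolding Cc_reduction_open_iff[OF U] using h units_sub_reduction[OF U'(2)] by blast
    then have "rep h \<in> Cr (reduction G U)"
      unfolding Cr_reduction_open[OF U] by (intro subsetD[OF closure_subset] imageI)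
    then show "x \<in> Theta G (Cr (reduction G U))" using hC h(5) xa by (intro ThetaI) auto
  qed
qed

lemma Theta_proj_kernel:
  assumes D: "closedin (unit_top G) D" "invariant G D"
  shows "Theta G {T \<in> Cr G. P D o\<^sub>L T = 0} = units G - D"
proof
  show "Theta G {T \<in> Cr G. P D o\<^sub>L T = 0} \<subseteq> units G - D"
    using proj_unit_function_zero_iff[OF _ D(2)] by (auto elim!: ThetaE)
  show "units G - D \<subseteq> Theta G {T \<in> Cr G. P D o\<^sub>L T = 0}"
    using Theta_mono[OF Cr_reduction_open_sub_kernel[OF D], of G] Theta_Cr_reduction[OF complement_open_invariant[OF D]] by simp
qed

end

context etale_groupoid
begin

lemma C0_restrict_closed:
  assumes f: "f \<in> C0 (unit_top G)" and D: "closedin (unit_top G) D" "invariant G D"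
  shows "restrict_zero (reduction_arrows G D) f \<in> C0 (unit_top (reduction G D))"
proof -
  have DU: "D \<subseteq> units G" using D closedin_unit_top_iff by blast
  have top: "unit_top (reduction G D) = subtopology (unit_top G) D"
    using unit_top_reduction[OF D(2)] DU by (simp add: unit_top_def subtopology_subtopology Int_absorb1)
  have mem: "x \<in> reduction_arrows G D \<longleftrightarrow> x \<in> D" if "x \<in> units G" for x
    using that unitsD by (auto simp: reduction_arrows_def)
  have f': "continuous_map (unit_top G) euclidean f" "\<And>x. x \<notin> units G \<Longrightarrow> f x = 0"
    "\<And>e. 0 < e \<Longrightarrow> compactin (unit_top G) {x \<in> units G. e \<le> cmod (f x)}"
    using f unfolding C0_def topspace_unit_top by auto
  have "continuous_map (subtopology (unit_top G) D) euclidean (restrict_zero (reduction_arrows G D) f)"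
    by (rule continuous_map_eq[OF continuous_map_from_subtopology[OF f'(1)]])
      (use DU mem in \<open>auto simp: restrict_zero_apply topspace_unit_top\<close>)
  moreover have "restrict_zero (reduction_arrows G D) f x = 0" if "x \<notin> topspace (subtopology (unit_top G) D)" for x
    using that mem[of x] f'(2)[of x] by (auto simp: restrict_zero_apply topspace_unit_top)
  moreover have "compactin (subtopology (unit_top G) D)
      {x \<in> topspace (subtopology (unit_top G) D). e \<le> cmod (restrict_zero (reduction_arrows G D) f x)}" if "0 < e" for e
  proof -
    have "{x \<in> topspace (subtopology (unit_top G) D). e \<le> cmod (restrict_zero (reduction_arrows G D) f x)} =
        {x \<in> units G. e \<le> cmod (f x)} \<inter> D"
      using mem by (auto simp: topspace_unit_top restrict_zero_apply)
    then show ?thesis using compact_Int_closedin[OF f'(3)[OF that] D(1)] by (simp add: compactin_subtopology)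
  qed
  ultimately show ?thesis unfolding top C0_def by blast
qed

lemma proj_mult:
  assumes "S \<in> Cr G" shows "P D o\<^sub>L (S o\<^sub>L T) = (P D o\<^sub>L S) o\<^sub>L (P D o\<^sub>L T)"
proof -
  have "(P D o\<^sub>L S) o\<^sub>L (P D o\<^sub>L T) = (P D o\<^sub>L (S o\<^sub>L P D)) o\<^sub>L T" by (simp add: blinfun_assoc)
  also have "\<dots> = ((P D o\<^sub>L P D) o\<^sub>L S) o\<^sub>L T"
    unfolding proj_commutes_Cr[OF assms, symmetric] by (simp add: blinfun_assoc)
  finally show ?thesis by (simp add: proj_idem blinfun_assoc)
qed

lemma proj_scaleC: "P D o\<^sub>L scaleC_op c T = scaleC_op c (P D o\<^sub>L T)"
  by (auto intro!: blinfun_eqI ell2_eqI)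

lemma proj_add: "P D o\<^sub>L (S + T) = (P D o\<^sub>L S) + (P D o\<^sub>L T)"
  by (rule bounded_bilinear.add_right[OF bounded_bilinear_blinfun_compose])

text \<open>Ideals of \<open>C\<^sup>*\<^sub>r(G\<^sub>D)\<close> and of \<open>C\<^sup>*\<^sub>r(G)\<close> are related by inverse and by direct images. That a
  direct image is closed is where the spectral estimate enters.\<close>

lemma preimage_ideal:
  assumes D: "closedin (unit_top G) D" "invariant G D" and J: "J \<in> closed_ideals (Cr (reduction G D))"
  shows "{T \<in> Cr G. P D o\<^sub>L T \<in> J} \<in> closed_ideals (Cr G)"
proof (rule closed_idealI)
  note A = closed_idealD[OF Cr_ideal_self] and J' = closed_idealD[OF J]
  have R: "P D o\<^sub>L S \<in> Cr (reduction G D)" if "S \<in> Cr G" for S using that Cr_reduction_closed[OF D] by blast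
  have "closed ((\<lambda>T. P D o\<^sub>L T) -` J)"
    by (intro continuous_closed_vimage linear_continuous_at[OF bounded_linear_compose_left] J')
  then have "closed (Cr G \<inter> (\<lambda>T. P D o\<^sub>L T) -` J)" using A(2) by (intro closed_Int)
  also have "Cr G \<inter> (\<lambda>T. P D o\<^sub>L T) -` J = {T \<in> Cr G. P D o\<^sub>L T \<in> J}" by auto
  finally show "closed {T \<in> Cr G. P D o\<^sub>L T \<in> J}" .
  show "0 \<in> {T \<in> Cr G. P D o\<^sub>L T \<in> J}" using A(3) J'(3) by simp
  fix S T c
  show "S + T \<in> {T \<in> Cr G. P D o\<^sub>L T \<in> J}" if "S \<in> {T \<in> Cr G. P D o\<^sub>L T \<in> J}" "T \<in> {T \<in> Cr G. P D o\<^sub>L T \<in> J}"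
    using that A(4) J'(4) by (simp add: proj_add)
  show "scaleC_op c T \<in> {T \<in> Cr G. P D o\<^sub>L T \<in> J}" if "T \<in> {T \<in> Cr G. P D o\<^sub>L T \<in> J}"
    using that A(5) J'(5) by (simp add: proj_scaleC)
  show "S o\<^sub>L T \<in> {T \<in> Cr G. P D o\<^sub>L T \<in> J}" "T o\<^sub>L S \<in> {T \<in> Cr G. P D o\<^sub>L T \<in> J}"
    if "S \<in> Cr G" "T \<in> {T \<in> Cr G. P D o\<^sub>L T \<in> J}"
    using that A(6,7) J'(6,7) R by (simp_all add: proj_mult)
qed auto

lemma image_ideal:
  assumes D: "closedin (unit_top G) D" "invariant G D" and I: "I \<in> closed_ideals (Cr G)"
  shows "(\<lambda>T. P D o\<^sub>L T) ` I \<in> closed_ideals (Cr (reduction G D))"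
proof (rule closed_idealI)
  note I' = closed_idealD[OF I]
  have eq: "Cr (reduction G D) = (\<lambda>T. P D o\<^sub>L T) ` Cr G" by (rule Cr_reduction_closed[OF D])
  show "(\<lambda>T. P D o\<^sub>L T) ` I \<subseteq> Cr (reduction G D)" unfolding eq using I'(1) by blast
  show "closed ((\<lambda>T. P D o\<^sub>L T) ` I)" by (rule closed_proj_ideal[OF I])
  show "0 \<in> (\<lambda>T. P D o\<^sub>L T) ` I" by (rule image_eqI[OF _ I'(3)]) simp
  fix S T c
  show "S + T \<in> (\<lambda>T. P D o\<^sub>L T) ` I" if "S \<in> (\<lambda>T. P D o\<^sub>L T) ` I" "T \<in> (\<lambda>T. P D o\<^sub>L T) ` I"
    using that I'(4) by (auto simp: proj_add[symmetric])
  show "scaleC_op c T \<in> (\<lambda>T. P D o\<^sub>L T) ` I" if "T \<in> (\<lambda>T. P D o\<^sub>L T) ` I"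
    using that I'(5) by (auto simp: proj_scaleC[symmetric])
  show "S o\<^sub>L T \<in> (\<lambda>T. P D o\<^sub>L T) ` I" "T o\<^sub>L S \<in> (\<lambda>T. P D o\<^sub>L T) ` I"
    if ST: "S \<in> Cr (reduction G D)" "T \<in> (\<lambda>T. P D o\<^sub>L T) ` I"
  proof -
    obtain S' T' where S': "S' \<in> Cr G" "S = P D o\<^sub>L S'" and T': "T' \<in> I" "T = P D o\<^sub>L T'"
      using ST unfolding eq by blast
    have "T' \<in> Cr G" using T'(1) I'(1) by blast
    have "S o\<^sub>L T = P D o\<^sub>L (S' o\<^sub>L T')" "T o\<^sub>L S = P D o\<^sub>L (T' o\<^sub>L S')"
      unfolding S'(2) T'(2) by (simp_all add: proj_mult S'(1) \<open>T' \<in> Cr G\<close>)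
    then show "S o\<^sub>L T \<in> (\<lambda>T. P D o\<^sub>L T) ` I" "T o\<^sub>L S \<in> (\<lambda>T. P D o\<^sub>L T) ` I"
      using I'(6,7)[OF S'(1) T'(1)] by auto
  qed
qed

text \<open>Both ideals are mapped to \<open>G\<^sup>(\<^sup>0\<^sup>) - D\<close> by \<open>\<Theta>\<close>.\<close>

lemma separates_imp_kernel:
  assumes "C0_separates_ideals G" and D: "closedin (unit_top G) D" "invariant G D"
  shows "Cr (reduction G (units G - D)) = {T \<in> Cr G. P D o\<^sub>L T = 0}"
proof (rule inj_onD)
  show "inj_on (Theta G) (closed_ideals (Cr G))" using assms(1) by (simp add: C0_separates_ideals_def)
  have U: "units G - D \<in> open_invariant G" by (rule complement_open_invariant[OF D])
  show "Theta G (Cr (reduction G (units G - D))) = Theta G {T \<in> Cr G. P D o\<^sub>L T = 0}"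
    by (simp add: Theta_Cr_reduction[OF U] Theta_proj_kernel[OF D])
  show "Cr (reduction G (units G - D)) \<in> closed_ideals (Cr G)" by (rule Cr_reduction_open_ideal[OF U])
qed (rule proj_kernel_ideal)

text \<open>If \<open>J\<close> contains no non-zero function, then neither its preimage in the algebra of \<open>G\<close> nor the kernel of the
  restriction contains a function that is non-zero somewhere on \<open>D\<close>. So \<open>\<Theta>\<close> does not distinguish them, and \<open>J = 0\<close>.\<close>

lemma separates_imp_residual_intersection:
  assumes sep: "C0_separates_ideals G" shows "residual_intersection_property G"
  unfolding residual_intersection_property_def intersection_property_def
proof (intro allI impI ballI)
  fix D J
  assume "closedin (unit_top G) D \<and> invariant G D" and J: "J \<in> closed_ideals (Cr (reduction G D))" and nz: "J \<noteq> {0}"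
  then have D: "closedin (unit_top G) D" "invariant G D" by auto
  note J' = closed_idealD[OF J]
  let ?I = "{T \<in> Cr G. P D o\<^sub>L T \<in> J}" and ?K = "{T \<in> Cr G. P D o\<^sub>L T = 0}"
  show "J \<inter> C0_units (reduction G D) \<noteq> {0}"
  proof
    assume triv: "J \<inter> C0_units (reduction G D) = {0}"
    have "Theta G ?I = units G - D"
    proof
      have "?K \<subseteq> ?I" using J'(3) by auto
      from Theta_mono[OF this, of G] show "units G - D \<subseteq> Theta G ?I" by (simp only: Theta_proj_kernel[OF D])
      show "Theta G ?I \<subseteq> units G - D"
      proof
        fix x assume "x \<in> Theta G ?I"
        then obtain f where f: "f \<in> C0 (unit_top G)" "P D o\<^sub>L rep f \<in> J" "x \<in> units G" "f x \<noteq> 0"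
          by (elim ThetaE) auto
        have "P D o\<^sub>L rep f \<in> C0_units (reduction G D)"
          unfolding C0_units_def regular_rep_restrict[OF D(2) fibre_finite_C0[OF f(1)], symmetric]
          using C0_restrict_closed[OF f(1) D] by blast
        then have "P D o\<^sub>L rep f = 0" using f(2) triv by blast
        then show "x \<in> units G - D" using proj_unit_function_zero_iff[OF f(1) D(2)] f(3,4) by blast
      qed
    qed
    then have "?I = ?K"
      using sep preimage_ideal[OF D J] proj_kernel_ideal[of D] Theta_proj_kernel[OF D]
      unfolding C0_separates_ideals_def by (metis (no_types, lifting) inj_onD)
    have "T = 0" if T: "T \<in> J" for T
    proof -
      obtain S where S: "S \<in> Cr G" "T = P D o\<^sub>L S" using J'(1) T Cr_reduction_closed[OF D] by blast
      then have "S \<in> ?K" using T \<open>?I = ?K\<close> by blast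
      then show ?thesis using S(2) by simp
    qed
    then show False using nz J'(3) by blast
  qed
qed

text \<open>Conversely, divide by \<open>\<Theta>(I)\<close>: by exactness, a function in the image of \<open>I\<close> in \<open>C\<^sup>*\<^sub>r(G\<^sub>D)\<close> lifts
  to a function in \<open>I\<close> itself, which vanishes on \<open>D\<close>. So the intersection property of \<open>G\<^sub>D\<close> kills the
  image of \<open>I\<close>.\<close>

lemma ideal_eq_Cr_Theta:
  assumes exact: "inner_exact G" and rip: "residual_intersection_property G" and I: "I \<in> closed_ideals (Cr G)"
  shows "I = Cr (reduction G (Theta G I))"
proof
  show "Cr (reduction G (Theta G I)) \<subseteq> I" by (rule Cr_Theta_sub[OF I])
  define D where "D = units G - Theta G I"
  note I' = closed_idealD[OF I]
  have U: "Theta G I \<in> open_invariant G" by (rule Theta_open_invariant[OF I])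
  have D: "closedin (unit_top G) D" "invariant G D" and UD: "units G - D = Theta G I"
    using open_invariantD(5-7)[OF U] by (simp_all add: D_def)
  have DU: "D \<subseteq> units G" by (auto simp: D_def)
  interpret R: algebraic_groupoid "reduction G D" by (rule algebraic_groupoid_reduction[OF D(2)])
  interpret U: lch_space "unit_top G" by (rule lch_unit_top)
  interpret Y: lch_space "subtopology (unit_top G) D" by (rule U.lch_closed[OF D(1)])
  have top: "unit_top (reduction G D) = subtopology (unit_top G) D"
    using unit_top_reduction[OF D(2)] DU by (simp add: unit_top_def subtopology_subtopology Int_absorb1)
  have ker: "{T \<in> Cr G. P D o\<^sub>L T = 0} = Cr (reduction G (Theta G I))"
    using exact D unfolding inner_exact_iff UD[symmetric] by blast
  have restr: "restrict_zero (reduction_arrows G D) h = restrict_zero D h" if "\<And>x. x \<notin> units G \<Longrightarrow> h x = 0" for h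
    using that unitsD DU by (force simp: restrict_zero_def reduction_arrows_def fun_eq_iff)
  have ffR: "fibre_finite (reduction G D) (restrict_zero D h)"
    if "h \<in> Cc (unit_top G)" for h
    using fibre_finite_restrict[OF fibre_finite_Cc, of h D "reduction_arrows G D"] restr[of h] that Cc_unit_top_iff by auto
  have "T = 0" if T: "T \<in> (\<lambda>T. P D o\<^sub>L T) ` I \<inter> C0_units (reduction G D)" for T
  proof -
    obtain S where S: "S \<in> I" "T = P D o\<^sub>L S" using T by blast
    obtain f where f: "f \<in> C0 (unit_top (reduction G D))" "T = regular_rep (reduction G D) f"
      using T unfolding C0_units_def by blast
    have f0: "f x = 0" if "x \<notin> D" for x
      using f(1) that DU unfolding top C0_def by (auto simp: topspace_unit_top)
    have fc: "continuous_map (subtopology (unit_top G) D) euclidean f" using f(1) unfolding top C0_def by blast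
    obtain M where "\<And>x. cmod (f x) \<le> M" using Y.C0_bounded f(1) unfolding top by metis
    then have ff: "fibre_finite (reduction G D) f"
      using R.fibre_bounded_unit_function[of f M] f0 units_reduction[OF D(2)] fibre_finite_def by metis
    have "f x = 0" for x
    proof (rule ccontr)
      assume fx: "f x \<noteq> 0"
      then have x: "x \<in> D" "x \<in> units G" "x \<in> arrows G" using f0 DU unitsD by auto
      \<comment> \<open>only compactly supported functions are extended from \<open>D\<close>, so localise \<open>f\<close> around \<open>x\<close> first\<close>
      obtain \<rho> L where \<rho>: "\<rho> \<in> Cc (gtop G)" "L \<subseteq> units G" "\<And>x. x \<notin> L \<Longrightarrow> \<rho> x = 0" "\<rho> x = 1"
        using bump_Cc[OF openin_units, of "{x}"] x by (metis compactin_sing empty_subsetI insert_subset singletonI)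
      then have \<rho>u: "\<rho> \<in> Cc (unit_top G)" unfolding Cc_unit_top_iff by blast
      have \<rho>0: "\<rho> x = 0" if "x \<notin> units G" for x using \<rho>(2,3) that by blast
      define w where "w = (\<lambda>y. f y * restrict_zero D \<rho> y)"
      have w: "w \<in> Cc (subtopology (unit_top G) D)"
        unfolding w_def by (rule Y.Cc_mult[OF fc U.Cc_restrict_closed[OF D(1) \<rho>u]])
      obtain F where F: "F \<in> Cc (unit_top G)" "restrict_zero D F = w" using U.Cc_extension[OF D(1) w] by metis
      have F': "F \<in> Cc (gtop G)" "\<And>x. x \<notin> units G \<Longrightarrow> F x = 0" using F(1) Cc_unit_top_iff by auto
      have P\<rho>: "regular_rep (reduction G D) (restrict_zero D \<rho>) = P D o\<^sub>L rep \<rho>"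
        using regular_rep_restrict[OF D(2) fibre_finite_Cc[OF \<rho>(1)]] restr[of \<rho>] \<rho>0 by simp
      have PF: "regular_rep (reduction G D) w = P D o\<^sub>L rep F"
        using regular_rep_restrict[OF D(2) fibre_finite_Cc[OF F'(1)]] restr[of F] F'(2) F(2) by auto
      have "regular_rep (reduction G D) f o\<^sub>L regular_rep (reduction G D) (restrict_zero D \<rho>) = regular_rep (reduction G D) w"
      proof (rule R.regular_rep_unit_mult)
        show "f x = 0" if "x \<notin> units (reduction G D)" for x using that f0 units_reduction[OF D(2)] by simp
        show "fibre_finite (reduction G D) w" using ffR[OF F(1)] F(2) by simp
        show "w g = (if g \<in> arrows (reduction G D) then f (rng (reduction G D) g) * restrict_zero D \<rho> g else 0)" for g
        proof (cases "g \<in> D")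
          case True
          then have "g \<in> reduction_arrows G D" "rng G g = g" using units_sub_reduction[OF DU] DU unitsD by blast+
          then show ?thesis by (simp add: w_def)
        qed (simp add: w_def restrict_zero_apply)
      qed (use ff ffR[OF \<rho>u] in auto)
      then have eq: "P D o\<^sub>L rep F = P D o\<^sub>L (S o\<^sub>L rep \<rho>)"
        unfolding PF P\<rho> f(2)[symmetric] S(2) proj_mult[OF subsetD[OF I'(1) S(1)]] by simp
      have S\<rho>: "S o\<^sub>L rep \<rho> \<in> I" by (rule I'(7)[OF rep_in_Cr[OF \<rho>(1)] S(1)])
      have neg: "- (S o\<^sub>L rep \<rho>) \<in> Cr G"
        using subspace_neg[OF closed_ideal_subspace[OF I] S\<rho>] I'(1) by blast
      have "rep F - (S o\<^sub>L rep \<rho>) \<in> {T \<in> Cr G. P D o\<^sub>L T = 0}"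
        using eq closed_idealD(4)[OF Cr_ideal_self rep_in_Cr[OF F'(1)] neg]
        by (simp add: bounded_bilinear.diff_right[OF bounded_bilinear_blinfun_compose])
      then have "rep F - (S o\<^sub>L rep \<rho>) \<in> I" using ker Cr_Theta_sub[OF I] by blast
      from I'(4)[OF this S\<rho>] have "rep F \<in> I" by simp
      moreover have "F x \<noteq> 0"
        using fun_cong[OF F(2), of x] x(1) fx \<rho>(4) by (simp add: w_def restrict_zero_apply)
      ultimately have "x \<in> Theta G I" by (rule ThetaI[OF Cc_C0_unit[OF F(1)] _ x(2)])
      then show False using x(1) by (simp add: D_def)
    qed
    then have "f = (\<lambda>_. 0)" by blast
    then show ?thesis using f(2) R.regular_rep_zero by simp
  qed
  moreover have "0 \<in> (\<lambda>T. P D o\<^sub>L T) ` I \<inter> C0_units (reduction G D)"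
  proof
    show "0 \<in> (\<lambda>T. P D o\<^sub>L T) ` I" by (rule closed_idealD(3)[OF image_ideal[OF D I]])
    show "0 \<in> C0_units (reduction G D)"
      unfolding C0_units_def top using R.regular_rep_zero Y.Cc_sub_C0[OF Y.Cc_zero] by (metis image_eqI)
  qed
  ultimately have "(\<lambda>T. P D o\<^sub>L T) ` I \<inter> C0_units (reduction G D) = {0}" by blast
  then have "(\<lambda>T. P D o\<^sub>L T) ` I = {0}"
    using rip D image_ideal[OF D I] unfolding residual_intersection_property_def intersection_property_def by blast
  then have "I \<subseteq> {T \<in> Cr G. P D o\<^sub>L T = 0}" using I'(1) by blast
  then show "I \<subseteq> Cr (reduction G (Theta G I))" using ker by simp
qed

lemma separates_iff: "C0_separates_ideals G \<longleftrightarrow> inner_exact G \<and> residual_intersection_property G"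
proof
  assume "C0_separates_ideals G"
  then show "inner_exact G \<and> residual_intersection_property G"
    using separates_imp_kernel separates_imp_residual_intersection inner_exact_iff by blast
next
  assume "inner_exact G \<and> residual_intersection_property G"
  then show "C0_separates_ideals G"
    unfolding C0_separates_ideals_def by (intro inj_onI) (metis ideal_eq_Cr_Theta)
qed

lemma bij_Theta_iff:
  "bij_betw (Theta G) (closed_ideals (Cr G)) (open_invariant G) \<longleftrightarrow> C0_separates_ideals G"
proof -
  have "Theta G ` closed_ideals (Cr G) = open_invariant G"
  proof (intro equalityI subsetI)
    fix U assume "U \<in> open_invariant G"
    then show "U \<in> Theta G ` closed_ideals (Cr G)"
      by (intro image_eqI[of _ _ "Cr (reduction G U)"] Theta_Cr_reduction[symmetric] Cr_reduction_open_ideal)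
  qed (use Theta_open_invariant in blast)
  then show ?thesis by (simp add: bij_betw_def C0_separates_ideals_def)
qed

lemma open_invariant_Int: "U \<in> open_invariant G \<Longrightarrow> V \<in> open_invariant G \<Longrightarrow> U \<inter> V \<in> open_invariant G"
  by (auto simp: open_invariant_def invariant_def)

lemma open_invariant_Un: "U \<in> open_invariant G \<Longrightarrow> V \<in> open_invariant G \<Longrightarrow> U \<union> V \<in> open_invariant G"
  by (auto simp: open_invariant_def invariant_def)

lemma closed_ideals_Int: "I \<in> closed_ideals A \<Longrightarrow> J \<in> closed_ideals A \<Longrightarrow> I \<inter> J \<in> closed_ideals A"
  unfolding closed_ideals_def by (simp add: closed_Int) blast

lemma ideal_join_closed_ideal:
  assumes "I \<in> closed_ideals (Cr G)" "J \<in> closed_ideals (Cr G)"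
  shows "ideal_join (Cr G) I J \<in> closed_ideals (Cr G)"
proof (rule closed_idealI)
  have "Cr G \<in> {K \<in> closed_ideals (Cr G). I \<union> J \<subseteq> K}" using Cr_ideal_self assms closed_idealD(1) by blast
  then show "ideal_join (Cr G) I J \<subseteq> Cr G" unfolding ideal_join_def by blast
  show "closed (ideal_join (Cr G) I J)" unfolding ideal_join_def by (intro closed_Inter) (auto dest: closed_idealD(2))
qed (auto simp: ideal_join_def dest: closed_idealD)

text \<open>\<open>U \<mapsto> C\<^sup>*\<^sub>r(G\<^sub>U)\<close> is the lower adjoint of \<open>\<Theta>\<close>; once \<open>\<Theta>\<close> is injective it is the inverse.\<close>

lemma Cr_reduction_sub_iff:
  assumes U: "U \<in> open_invariant G" and I: "I \<in> closed_ideals (Cr G)"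
  shows "Cr (reduction G U) \<subseteq> I \<longleftrightarrow> U \<subseteq> Theta G I"
proof
  assume "Cr (reduction G U) \<subseteq> I"
  from Theta_mono[OF this, of G] show "U \<subseteq> Theta G I" by (simp add: Theta_Cr_reduction[OF U])
next
  assume "U \<subseteq> Theta G I"
  from Cr_reduction_open_mono[OF U Theta_open_invariant[OF I] this] Cr_Theta_sub[OF I]
  show "Cr (reduction G U) \<subseteq> I" by blast
qed

lemma separates_sub_Cr_reduction_iff:
  assumes "C0_separates_ideals G" and U: "U \<in> open_invariant G" and I: "I \<in> closed_ideals (Cr G)"
  shows "I \<subseteq> Cr (reduction G U) \<longleftrightarrow> Theta G I \<subseteq> U"
proof
  assume "I \<subseteq> Cr (reduction G U)"
  from Theta_mono[OF this, of G] show "Theta G I \<subseteq> U" by (simp add: Theta_Cr_reduction[OF U])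
next
  assume sub: "Theta G I \<subseteq> U"
  have "I = Cr (reduction G (Theta G I))" using ideal_eq_Cr_Theta assms(1) separates_iff I by blast
  then show "I \<subseteq> Cr (reduction G U)" using Cr_reduction_open_mono[OF Theta_open_invariant[OF I] U sub] by simp
qed

lemma Theta_lattice_isomorphism:
  assumes sep: "C0_separates_ideals G"
  shows "lattice_isomorphism (closed_ideals (Cr G)) (\<inter>) (ideal_join (Cr G)) (open_invariant G) (\<inter>) (\<union>) (Theta G)"
  unfolding lattice_isomorphism_def
proof (intro conjI ballI)
  show "bij_betw (Theta G) (closed_ideals (Cr G)) (open_invariant G)" using sep bij_Theta_iff by blast
  fix I J assume I: "I \<in> closed_ideals (Cr G)" and J: "J \<in> closed_ideals (Cr G)"
  note TI = Theta_open_invariant[OF I] and TJ = Theta_open_invariant[OF J]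
  note IJ = closed_ideals_Int[OF I J] and jn = ideal_join_closed_ideal[OF I J]
  show "Theta G (I \<inter> J) = Theta G I \<inter> Theta G J"
  proof
    let ?W = "Theta G I \<inter> Theta G J"
    have W: "?W \<in> open_invariant G" by (rule open_invariant_Int[OF TI TJ])
    have "Cr (reduction G ?W) \<subseteq> I \<inter> J" using Cr_reduction_sub_iff[OF W] I J by simp
    then show "?W \<subseteq> Theta G (I \<inter> J)" using Cr_reduction_sub_iff[OF W IJ] by simp
  qed (simp add: Theta_mono)
  show "Theta G (ideal_join (Cr G) I J) = Theta G I \<union> Theta G J"
  proof
    let ?W = "Theta G I \<union> Theta G J"
    have W: "?W \<in> open_invariant G" by (rule open_invariant_Un[OF TI TJ])
    have "I \<subseteq> Cr (reduction G ?W)" "J \<subseteq> Cr (reduction G ?W)"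
      using separates_sub_Cr_reduction_iff[OF sep W] I J by auto
    then have "ideal_join (Cr G) I J \<subseteq> Cr (reduction G ?W)"
      unfolding ideal_join_def using Cr_reduction_open_ideal[OF W] by blast
    then show "Theta G (ideal_join (Cr G) I J) \<subseteq> ?W" using separates_sub_Cr_reduction_iff[OF sep W jn] by simp
    have "I \<subseteq> ideal_join (Cr G) I J" "J \<subseteq> ideal_join (Cr G) I J" unfolding ideal_join_def by blast+
    then show "?W \<subseteq> Theta G (ideal_join (Cr G) I J)" by (simp add: Theta_mono)
  qed
qed

end

section \<open>The Fell topologies\<close>

lemma topspace_fell: "topspace (fell_topology A) = closed_ideals A"
  unfolding fell_topology_def topology_generated_by_topspace by auto

lemma openin_fell: "I \<in> closed_ideals A \<Longrightarrow> openin (fell_topology A) {J \<in> closed_ideals A. \<not> I \<subseteq> J}"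
  unfolding fell_topology_def by (rule topology_generated_by_Basis) blast

lemma continuous_map_into_fell:
  assumes "\<And>x. x \<in> topspace X \<Longrightarrow> f x \<in> closed_ideals A"
    and "\<And>I. I \<in> closed_ideals A \<Longrightarrow> openin X {x \<in> topspace X. \<not> I \<subseteq> f x}"
  shows "continuous_map X (fell_topology A) f"
  unfolding fell_topology_def
proof (rule continuous_on_generated_topo)
  fix U assume "U \<in> insert (closed_ideals A) ((\<lambda>I. {J \<in> closed_ideals A. \<not> I \<subseteq> J}) ` closed_ideals A)"
  then consider "U = closed_ideals A" | I where "I \<in> closed_ideals A" "U = {J \<in> closed_ideals A. \<not> I \<subseteq> J}" by blast
  then show "openin X (f -` U \<inter> topspace X)"
  proof cases
    case 1
    then have "f -` U \<inter> topspace X = topspace X" using assms(1) by blast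
    then show ?thesis by simp
  next
    case 2
    then have "f -` U \<inter> topspace X = {x \<in> topspace X. \<not> I \<subseteq> f x}" using assms(1) by blast
    then show ?thesis using assms(2) 2 by simp
  qed
qed (use assms(1) in blast)

context etale_groupoid
begin

lemma rep_C0_inj:
  assumes f: "f \<in> C0 (unit_top G)" and k: "k \<in> C0 (unit_top G)" and eq: "rep f = rep k" shows "f = k"
proof
  fix x
  have v: "h x = ell2_apply (rep h (single x 1)) x" if "h \<in> C0 (unit_top G)" "x \<in> units G" for h
    using regular_rep_unit_function[OF fibre_finite_C0[OF that(1)] C0_unit_top[OF that(1)], of x 1 x] that(2) unitsD by simp
  show "f x = k x"
  proof (cases "x \<in> units G")
    case True
    show ?thesis unfolding v[OF f True] v[OF k True] eq ..
  qed (simp add: C0_unit_top f k)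
qed

text \<open>A set of functions is contained in \<open>C\<^sub>0(U)\<close> if all of them vanish off \<open>U\<close>. This reduces the Fell topology on
  the ideals of \<open>C\<^sub>0(G\<^sup>(\<^sup>0\<^sup>))\<close> to inclusions of open sets.\<close>

lemma sub_ideal_of_open_iff:
  assumes "K \<subseteq> C0_units G" shows "K \<subseteq> ideal_of_open G U \<longleftrightarrow> Theta G K \<subseteq> U"
proof
  assume sub: "K \<subseteq> ideal_of_open G U"
  show "Theta G K \<subseteq> U"
  proof
    fix x assume "x \<in> Theta G K"
    then obtain f where f: "f \<in> C0 (unit_top G)" "rep f \<in> K" "f x \<noteq> 0" by (elim ThetaE)
    then obtain k where k: "k \<in> C0 (unit_top G)" "\<forall>x. x \<notin> U \<longrightarrow> k x = 0" "rep f = rep k"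
      using sub unfolding ideal_of_open_def by blast
    then show "x \<in> U" using rep_C0_inj[OF f(1) k(1,3)] f(3) by blast
  qed
next
  assume sub: "Theta G K \<subseteq> U"
  show "K \<subseteq> ideal_of_open G U"
  proof
    fix T assume T: "T \<in> K"
    then obtain f where f: "f \<in> C0 (unit_top G)" "T = rep f" using assms unfolding C0_units_def by blast
    have "f x = 0" if "x \<notin> U" for x
      using ThetaI[OF f(1), of K x] T f(2) that sub C0_unit_top[OF f(1), of x] by blast
    then show "T \<in> ideal_of_open G U" unfolding ideal_of_open_def using f by blast
  qed
qed

lemma Theta_ideal_of_open:
  assumes "openin (unit_top G) U" shows "Theta G (ideal_of_open G U) = U"
proof
  have U: "openin (gtop G) U" "U \<subseteq> units G" using assms openin_unit_top_iff by auto
  show "Theta G (ideal_of_open G U) \<subseteq> U"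
    by (rule sub_ideal_of_open_iff[THEN iffD1]) (auto simp: ideal_of_open_def C0_units_def)
  show "U \<subseteq> Theta G (ideal_of_open G U)"
  proof
    fix x assume x: "x \<in> U"
    then have xa: "x \<in> units G" "x \<in> arrows G" using U unitsD by auto
    obtain h L where h: "h \<in> Cc (gtop G)" "L \<subseteq> U" "\<And>x. x \<notin> L \<Longrightarrow> h x = 0" "h x = 1"
      using bump_Cc[OF U(1), of "{x}"] x xa by (metis compactin_sing empty_subsetI insert_subset singletonI)
    then have "h \<in> C0 (unit_top G)" using Cc_unit_top_iff U(2) Cc_C0_unit by blast
    then show "x \<in> Theta G (ideal_of_open G U)"
      using h xa by (intro ThetaI[of h]) (auto simp: ideal_of_open_def)
  qed
qed

lemma ideal_of_open_closed_ideal: "ideal_of_open G U \<in> closed_ideals (C0_units G)"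
proof (rule closed_idealI)
  interpret U: lch_space "unit_top G" by (rule lch_unit_top)
  let ?Q = "{f \<in> C0 (unit_top G). \<forall>x. x \<notin> U \<longrightarrow> f x = 0}"
  have I: "ideal_of_open G U = rep ` ?Q" by (simp add: ideal_of_open_def)
  have cont: "continuous_map (unit_top G) euclidean f" if "f \<in> C0 (unit_top G)" for f using that unfolding C0_def by blast
  have mult: "(\<lambda>x. f x * k x) \<in> C0 (unit_top G)" if "f \<in> C0 (unit_top G)" "k \<in> C0 (unit_top G)" for f k
    using U.C0_bounded[OF that(1)] U.C0_mult[OF cont[OF that(1)] _ that(2)] by metis
  have rep_mult: "rep f o\<^sub>L rep k = rep (\<lambda>x. f x * k x)" if "f \<in> C0 (unit_top G)" "k \<in> C0 (unit_top G)" for f k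
  proof (rule regular_rep_unit_mult)
    show "f g * k g = (if g \<in> arrows G then f (rng G g) * k g else 0)" for g
      using C0_unit_top[OF that(2), of g] unitsD[of g] by (cases "g \<in> units G") auto
  qed (use that mult fibre_finite_C0 C0_unit_top in auto)
  show "ideal_of_open G U \<subseteq> C0_units G" by (auto simp: ideal_of_open_def C0_units_def)
  show "0 \<in> ideal_of_open G U"
    unfolding I using regular_rep_zero U.Cc_sub_C0[OF U.Cc_zero] by (intro image_eqI[of _ _ "\<lambda>_. 0"]) auto
  show "S + T \<in> ideal_of_open G U" if "S \<in> ideal_of_open G U" "T \<in> ideal_of_open G U" for S T
  proof -
    obtain f k where "f \<in> ?Q" "S = rep f" "k \<in> ?Q" "T = rep k" using \<open>S \<in> _\<close> \<open>T \<in> _\<close> unfolding I by blast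
    then show ?thesis unfolding I
      using U.C0_add by (intro image_eqI[of _ _ "\<lambda>x. f x + k x"]) (auto simp: regular_rep_add fibre_finite_C0)
  qed
  show "scaleC_op c T \<in> ideal_of_open G U" if "T \<in> ideal_of_open G U" for c T
  proof -
    obtain f where "f \<in> ?Q" "T = rep f" using \<open>T \<in> _\<close> unfolding I by blast
    then show ?thesis unfolding I
      using U.C0_mult[of "\<lambda>_. c" "cmod c" f]
      by (intro image_eqI[of _ _ "\<lambda>x. c * f x"]) (auto simp: regular_rep_scale fibre_finite_C0)
  qed
  show "S o\<^sub>L T \<in> ideal_of_open G U" "T o\<^sub>L S \<in> ideal_of_open G U"
    if "S \<in> C0_units G" "T \<in> ideal_of_open G U" for S T
  proof -
    obtain f k where fk: "f \<in> C0 (unit_top G)" "S = rep f" "k \<in> ?Q" "T = rep k"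
      using \<open>S \<in> _\<close> \<open>T \<in> _\<close> unfolding I C0_units_def by blast
    show "S o\<^sub>L T \<in> ideal_of_open G U" unfolding I
      using fk mult[of f k] by (intro image_eqI[of _ _ "\<lambda>x. f x * k x"]) (auto simp: rep_mult)
    show "T o\<^sub>L S \<in> ideal_of_open G U" unfolding I
      using fk mult[of k f] by (intro image_eqI[of _ _ "\<lambda>x. k x * f x"]) (auto simp: rep_mult)
  qed
  show "closed (ideal_of_open G U)"
  proof -
    have "T \<in> rep ` ?Q" if "T \<in> closure (rep ` ?Q)" for T
    proof -
      \<comment> \<open>the limit function is read off from the diagonal of the limit operator\<close>
      define f where "f x = (if x \<in> units G then ell2_apply (T (single x 1)) x else 0)" for x
      have near: "cmod (f x - k x) \<le> norm (T - rep k)" if k: "k \<in> C0 (unit_top G)" for k x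
      proof (cases "x \<in> units G")
        case True
        then have "f x - k x = ell2_apply ((T - rep k) (single x 1)) x"
          using regular_rep_unit_function[OF fibre_finite_C0[OF k] C0_unit_top[OF k], of x 1 x] unitsD
          by (simp add: f_def blinfun.diff_left)
        then have "cmod (f x - k x) \<le> norm ((T - rep k) (single x 1))" by (metis cmod_ell2_apply_le)
        also have "\<dots> \<le> norm (T - rep k)" using norm_blinfun[of "T - rep k" "single x 1"] by simp
        finally show ?thesis .
      qed (simp add: f_def C0_unit_top[OF k])
      have ap: "\<exists>k\<in>?Q. norm (T - rep k) \<le> e" if "0 < e" for e
        using \<open>T \<in> closure _\<close> that unfolding closure_approachable by (force simp: dist_norm norm_minus_commute)
      have f: "f \<in> C0 (unit_top G)"
      proof (rule U.C0_uniform_limit)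
        fix e :: real assume "0 < e"
        then obtain k where "k \<in> ?Q" "norm (T - rep k) \<le> e" using ap by blast
        then show "\<exists>k\<in>C0 (unit_top G). \<forall>x. cmod (f x - k x) \<le> e"
          using near[of k] by (intro bexI[of _ k]) (auto intro: order_trans)
      qed
      have small: "cmod (f x) \<le> e" if "0 < e" "x \<notin> U" for x e
      proof -
        obtain k where "k \<in> ?Q" "norm (T - rep k) \<le> e" using ap \<open>0 < e\<close> by blast
        then show ?thesis using near[of k x] \<open>x \<notin> U\<close> by auto
      qed
      have fU: "f x = 0" if "x \<notin> U" for x
        using small[OF _ that] field_le_epsilon[of "cmod (f x)" 0] by auto
      have "norm (T - rep f) \<le> e" if "0 < e" for e
      proof -
        obtain k where k: "k \<in> ?Q" "norm (T - rep k) \<le> e/2" using ap[of "e/2"] \<open>0 < e\<close> by auto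
        have "dist (rep k) (rep f) \<le> e/2"
        proof (rule dist_unit_functions)
          show "cmod (f x - k x) \<le> e/2" for x using near[of k x] k by auto
        qed (use f k fibre_finite_C0 C0_unit_top in auto)
        then show ?thesis using k(2) norm_triangle_ineq[of "T - rep k" "rep k - rep f"] by (simp add: dist_norm)
      qed
      then have "norm (T - rep f) \<le> 0" using field_le_epsilon[of "norm (T - rep f)" 0] by auto
      then show ?thesis using f fU by (intro image_eqI[of _ _ f]) auto
    qed
    then have "closure (rep ` ?Q) = rep ` ?Q" by (intro equalityI closure_subset subsetI)
    then show ?thesis by (simp only: I closure_eq)
  qed
qed

lemma saturation:
  assumes V: "openin (unit_top G) V"
  defines "W \<equiv> rng G ` {g \<in> arrows G. dmn G g \<in> V}"
  shows "W \<in> open_invariant G" "\<And>U. invariant G U \<Longrightarrow> W \<subseteq> U \<longleftrightarrow> V \<subseteq> U"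
proof -
  have V': "openin (gtop G) V" "V \<subseteq> units G" using V openin_unit_top_iff by auto
  have "openin (gtop G) W"
    unfolding W_def by (rule openin_rng_image[OF openin_continuous_map_preimage[OF continuous_map_dmn V'(1)]])
  moreover have "W \<subseteq> units G" unfolding W_def using rng_units by blast
  moreover have "rng G h \<in> W" if h: "h \<in> arrows G" "dmn G h \<in> W" for h
  proof -
    obtain g where g: "g \<in> arrows G" "dmn G g \<in> V" "dmn G h = rng G g" using h(2) unfolding W_def by blast
    then have "mul G h g \<in> {g \<in> arrows G. dmn G g \<in> V}" "rng G (mul G h g) = rng G h"
      using h by (auto simp: mul_arrow dmn_mul rng_mul)
    then show ?thesis unfolding W_def by (intro image_eqI[of _ _ "mul G h g"]) auto
  qed
  ultimately show "W \<in> open_invariant G"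
    by (auto simp: open_invariant_def openin_unit_top_iff invariant_def)
  fix U assume U: "invariant G U"
  show "W \<subseteq> U \<longleftrightarrow> V \<subseteq> U"
  proof
    assume sub: "W \<subseteq> U"
    have "v \<in> W" if "v \<in> V" for v
      using that V'(2) unitsD[of v] unfolding W_def by (intro image_eqI[of _ _ v]) auto
    then show "V \<subseteq> U" using sub by blast
  next
    assume "V \<subseteq> U"
    then show "W \<subseteq> U" using U unfolding W_def invariant_def by auto
  qed
qed

lemma openin_Theta: "openin (unit_top G) (Theta G K)"
  unfolding Theta_def by (rule openin_Union) (use openin_support in auto)

text \<open>The topology on \<open>\<O>(G\<^sup>(\<^sup>0\<^sup>))\<close> is given by arbitrary open sets \<open>V\<close>, that on the ideals of
  \<open>C\<^sup>*\<^sub>r(G)\<close> by invariant ones. An invariant set contains \<open>V\<close> if and only if it contains the saturation of \<open>V\<close>,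
  so both families cut out the same sets.\<close>

lemma Theta_homeomorphic_map:
  assumes sep: "C0_separates_ideals G"
  shows "homeomorphic_map (fell_topology (Cr G)) (open_invariant_topology G) (Theta G)"
proof -
  let ?X = "fell_topology (Cr G)" and ?Y = "open_invariant_topology G" and ?\<Psi> = "\<lambda>U. Cr (reduction G U)"
  have tY: "topspace ?Y = open_invariant G"
    unfolding open_invariant_topology_def topspace_pullback_topology topspace_fell using ideal_of_open_closed_ideal by auto
  have "homeomorphic_maps ?X ?Y (Theta G) ?\<Psi>"
    unfolding homeomorphic_maps_def topspace_fell tY
  proof (intro conjI ballI)
    show "continuous_map ?X ?Y (Theta G)"
      unfolding open_invariant_topology_def
    proof (rule continuous_map_pullback')
      show "continuous_map ?X (fell_topology (C0_units G)) (ideal_of_open G \<circ> Theta G)"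
      proof (rule continuous_map_into_fell)
        fix K assume K: "K \<in> closed_ideals (C0_units G)"
        define W where "W = rng G ` {g \<in> arrows G. dmn G g \<in> Theta G K}"
        have W: "W \<in> open_invariant G" "\<And>U. invariant G U \<Longrightarrow> W \<subseteq> U \<longleftrightarrow> Theta G K \<subseteq> U"
          using saturation[OF openin_Theta] unfolding W_def by blast+
        have "{I \<in> closed_ideals (Cr G). \<not> K \<subseteq> ideal_of_open G (Theta G I)} =
            {I \<in> closed_ideals (Cr G). \<not> Cr (reduction G W) \<subseteq> I}"
          by (intro Collect_cong conj_cong refl)
            (simp only: sub_ideal_of_open_iff[OF closed_idealD(1)[OF K]] W(2)[OF Theta_invariant] Cr_reduction_sub_iff[OF W(1)])
        then show "openin ?X {I \<in> topspace ?X. \<not> K \<subseteq> (ideal_of_open G \<circ> Theta G) I}"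
          using openin_fell[OF Cr_reduction_open_ideal[OF W(1)]] by (simp add: topspace_fell)
      qed (use ideal_of_open_closed_ideal in auto)
    qed (use Theta_open_invariant in \<open>auto simp: topspace_fell\<close>)
    show "continuous_map ?Y ?X ?\<Psi>"
    proof (rule continuous_map_into_fell)
      fix I assume I: "I \<in> closed_ideals (Cr G)"
      let ?K = "ideal_of_open G (Theta G I)"
      have "I \<subseteq> ?\<Psi> U \<longleftrightarrow> ?K \<subseteq> ideal_of_open G U" if "U \<in> open_invariant G" for U
        by (simp only: sub_ideal_of_open_iff[OF closed_idealD(1)[OF ideal_of_open_closed_ideal]]
            Theta_ideal_of_open[OF openin_Theta] separates_sub_Cr_reduction_iff[OF sep that I])
      then have eq: "{U \<in> topspace ?Y. \<not> I \<subseteq> ?\<Psi> U} =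
          ideal_of_open G -` {J \<in> closed_ideals (C0_units G). \<not> ?K \<subseteq> J} \<inter> open_invariant G"
        unfolding tY vimage_def Int_def mem_Collect_eq
        using ideal_of_open_closed_ideal by (intro Collect_cong) blast
      show "openin ?Y {U \<in> topspace ?Y. \<not> I \<subseteq> ?\<Psi> U}"
        unfolding eq unfolding open_invariant_topology_def openin_pullback_topology
        by (intro exI[of _ "{J \<in> closed_ideals (C0_units G). \<not> ?K \<subseteq> J}"] conjI refl openin_fell ideal_of_open_closed_ideal)
    qed (use Cr_reduction_open_ideal tY in auto)
    show "?\<Psi> (Theta G I) = I" if "I \<in> closed_ideals (Cr G)" for I
      using ideal_eq_Cr_Theta sep separates_iff that by blast
    show "Theta G (?\<Psi> U) = U" if "U \<in> open_invariant G" for U by (rule Theta_Cr_reduction[OF that])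
  qed
  then show ?thesis using homeomorphic_map_maps by blast
qed

end

theorem theorem3p10:
  fixes G :: "'a groupoid"
  assumes "etale_groupoid G"
  shows "(bij_betw (Theta G) (closed_ideals (Cr G)) (open_invariant G)
            \<longleftrightarrow> C0_separates_ideals G)
       \<and> (C0_separates_ideals G
            \<longleftrightarrow> inner_exact G \<and> residual_intersection_property G)
       \<and> (bij_betw (Theta G) (closed_ideals (Cr G)) (open_invariant G) \<longrightarrow>
            lattice_isomorphism (closed_ideals (Cr G)) (\<inter>) (ideal_join (Cr G))
              (open_invariant G) (\<inter>) (\<union>) (Theta G)
            \<and> homeomorphic_map (fell_topology (Cr G)) (open_invariant_topology G) (Theta G))"
proof -
  interpret etale_groupoid G by fact
  show ?thesis
    using bij_Theta_iff separates_iff Theta_lattice_isomorphism Theta_homeomorphic_map by blast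
qed

end
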